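(* There is a constant $C>0$ depending only on the coefficients $a,b,c$ (not on $f$, $u$, $N$ or the mesh) such that for every equidistributing mesh with $N$ elements (i.e. every mesh satisfying $\rho_i h_i=\sigma_h/N$ for $i=1,\dots,N$, where $\rho_i,\sigma_h,\alpha_h$ are computed from the linear finite element solution $u_h$ on that same mesh) one has $$\|(u-u_h)'\|_\Omega\le \frac{C\sqrt{\alpha_h}}{N},$$ where $\alpha_h$ has the property (for equidistributing meshes with $N$ elements, $N\to\infty$) $$\lim_{N\to\infty}\sqrt{\alpha_h}=\|r\|_{L^{2/3}(\Omega)} .$$ If further $r'\in L^1(\Omega)$, then there exists a constant $c_*>0$, depending only on $a,b,c$, such that for $N>c_*$ and every equidistributing mesh with $N$ elements, $$\Big(1+\big(\tfrac{c_*}{N}\big)^{2/3}\Big)^{-3/2}\|r\|_{L^{2/3}(\Omega)}\le\sqrt{\alpha_h}\le\Big(1-\big(\tfrac{c_*}{N}\big)^{2/3}\Big)^{-3/2}\Big[\|r\|_{L^{2/3}(\Omega)}^{2/3}+\Big(\frac{c_*\|r'\|_{L^1(\Omega)}}{N}\Big)^{2/3}\Big]^{3/2}.$$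
   Context: Let $\Omega=(0,1)$. The functions $a,b\in W^{1,\infty}(\Omega)$, $c\in L^\infty(\Omega)$, $f\in L^2(\Omega)$ satisfy $a(x)\ge a_0>0$ and $c(x)-\frac12 b'(x)\ge 0$ a.e. in $\Omega$ for some constant $a_0$; $f$ is not a.e. zero. Put $B(w,v)=\int_\Omega(aw'v'+bw'v+cwv)\,dx$ and $(f,v)=\int_\Omega fv\,dx$. $u\in V=H_0^1(\Omega)$ is the solution of $B(u,v)=(f,v)$ for all $v\in V$ (weak form of $-(au')'+bu'+cu=f$, $u(0)=u(1)=0$). A mesh with $N$ elements is $0=x_0<x_1<\dots<x_N=1$, with $h_i=x_i-x_{i-1}$ and $K_i=(x_{i-1},x_i)$. $V_h$ is the space of continuous functions on $[0,1]$ that are linear on each $K_i$ and vanish at $0$ and $1$; $u_h\in V_h$ is the finite element solution: $B(u_h,v_h)=(f,v_h)$ for all $v_h\in V_h$. $r=f+a'u'-bu'-cu$ and $r_h=f+a'u_h'-bu_h'-cu_h$ (with $u_h'$ taken elementwise). Further $\langle r_h\rangle_i=\big(\frac1{h_i}\int_{K_i}|r_h|^2dx\big)^{1/2}$, $\alpha_h=\big[\sum_{i=1}^N h_i\langle r_h\rangle_i^{2/3}\big]^3$, $\rho_i=\big(1+\frac1{\alpha_h}\langle r_h\rangle_i^2\big)^{1/3}$, $\rho$ is the piecewise constant function equal to $\rho_i$ on $K_i$, and $\sigma_h=\sum_{i=1}^N\rho_ih_i$. $\|\cdot\|_\Omega$ is the $L^2(\Omega)$ norm; $\|v\|_{L^p(\Omega)}=(\int_\Omega|v|^pdx)^{1/p}$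 also for $0<p<1$. *)

theory Defs
  imports "HOL-Analysis.Analysis"
begin

section \<open>Function spaces on the unit interval\<close>

text \<open>Elements of Lebesgue and Sobolev spaces are represented by functions of type
  \<^typ>\<open>real \<Rightarrow> real\<close>, of which only the values almost everywhere on \<open>Omega\<close> matter.\<close>

abbreviation Omega :: "real set"
  where "Omega \<equiv> {0<..<1}"

definition Lp_space :: "real \<Rightarrow> (real \<Rightarrow> real) set"
  where "Lp_space p = {v \<in> borel_measurable (lebesgue_on Omega).
           integrable (lebesgue_on Omega) (\<lambda>x. \<bar>v x\<bar> powr p)}"

text \<open>Used for \<open>0 < p < 1\<close> as well, where it is only a quasi-norm.\<close>

definition Lp_norm :: "real \<Rightarrow> (real \<Rightarrow> real) \<Rightarrow> real"
  where "Lp_norm p v = (LINT x|lebesgue_on Omega. \<bar>v x\<bar> powr p) powr (1 / p)"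

definition Linf_space :: "(real \<Rightarrow> real) set"
  where "Linf_space = {v \<in> borel_measurable (lebesgue_on Omega).
           \<exists>M. AE x in lebesgue_on Omega. \<bar>v x\<bar> \<le> M}"

definition locally_integrable :: "(real \<Rightarrow> real) \<Rightarrow> bool"
  where "locally_integrable v \<longleftrightarrow>
           (\<forall>K. compact K \<longrightarrow> K \<subseteq> Omega \<longrightarrow> integrable (lebesgue_on K) v)"

text \<open>The space of test functions (smooth, with compact support in \<open>Omega\<close>), extended by
  zero to the whole real line.\<close>

definition test_functions :: "(real \<Rightarrow> real) set"
  where "test_functions = {\<phi>. (\<forall>k x. (deriv ^^ k) \<phi> differentiable (at x)) \<and>
           (\<exists>K. compact K \<and> K \<subseteq> Omega \<and> (\<forall>x. x \<notin> K \<longrightarrow> \<phi> x = 0))}"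

definition has_weak_deriv :: "(real \<Rightarrow> real) \<Rightarrow> (real \<Rightarrow> real) \<Rightarrow> bool"
  where "has_weak_deriv v g \<longleftrightarrow> locally_integrable v \<and> locally_integrable g \<and>
           (\<forall>\<phi>\<in>test_functions.
              (LINT x|lebesgue_on Omega. v x * deriv \<phi> x) = - (LINT x|lebesgue_on Omega. g x * \<phi> x))"

definition weakly_differentiable :: "(real \<Rightarrow> real) \<Rightarrow> bool"
  where "weakly_differentiable v \<longleftrightarrow> (\<exists>g. has_weak_deriv v g)"

text \<open>A representative of the weak derivative, which is unique up to null sets;
  meaningful only for weakly differentiable functions.\<close>

definition wderiv :: "(real \<Rightarrow> real) \<Rightarrow> real \<Rightarrow> real"
  where "wderiv v = (SOME g. has_weak_deriv v g)"

definition W1inf_space :: "(real \<Rightarrow> real) set"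
  where "W1inf_space = {v \<in> Linf_space. weakly_differentiable v \<and> wderiv v \<in> Linf_space}"

definition H1_space :: "(real \<Rightarrow> real) set"
  where "H1_space = {v \<in> Lp_space 2. weakly_differentiable v \<and> wderiv v \<in> Lp_space 2}"

definition H1_norm :: "(real \<Rightarrow> real) \<Rightarrow> real"
  where "H1_norm v = sqrt ((Lp_norm 2 v)\<^sup>2 + (Lp_norm 2 (wderiv v))\<^sup>2)"

text \<open>The closure of the test functions in \<open>H1_space\<close>.\<close>

definition H10_space :: "(real \<Rightarrow> real) set"
  where "H10_space = {v \<in> H1_space. \<exists>\<phi>. (\<forall>n::nat. \<phi> n \<in> test_functions) \<and>
           (\<lambda>n. H1_norm (\<lambda>x. v x - \<phi> n x)) \<longlonglongrightarrow> 0}"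

section \<open>The boundary value problem\<close>

definition admissible_coeffs :: "(real \<Rightarrow> real) \<Rightarrow> (real \<Rightarrow> real) \<Rightarrow> (real \<Rightarrow> real) \<Rightarrow> bool"
  where "admissible_coeffs a b c \<longleftrightarrow>
           a \<in> W1inf_space \<and> b \<in> W1inf_space \<and> c \<in> Linf_space \<and>
           (\<exists>a\<^sub>0>0. AE x in lebesgue_on Omega. a x \<ge> a\<^sub>0) \<and>
           (AE x in lebesgue_on Omega. c x - 1/2 * wderiv b x \<ge> 0)"

definition admissible_rhs :: "(real \<Rightarrow> real) \<Rightarrow> bool"
  where "admissible_rhs f \<longleftrightarrow> f \<in> Lp_space 2 \<and> \<not> (AE x in lebesgue_on Omega. f x = 0)"

definition bilin :: "(real \<Rightarrow> real) \<Rightarrow> (real \<Rightarrow> real) \<Rightarrow> (real \<Rightarrow> real) \<Rightarrow>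
    (real \<Rightarrow> real) \<Rightarrow> (real \<Rightarrow> real) \<Rightarrow> real"
  where "bilin a b c w v = (LINT x|lebesgue_on Omega.
           a x * wderiv w x * wderiv v x + b x * wderiv w x * v x + c x * w x * v x)"

definition L2_inner :: "(real \<Rightarrow> real) \<Rightarrow> (real \<Rightarrow> real) \<Rightarrow> real"
  where "L2_inner f v = (LINT x|lebesgue_on Omega. f x * v x)"

definition weak_solution :: "(real \<Rightarrow> real) \<Rightarrow> (real \<Rightarrow> real) \<Rightarrow> (real \<Rightarrow> real) \<Rightarrow>
    (real \<Rightarrow> real) \<Rightarrow> (real \<Rightarrow> real) \<Rightarrow> bool"
  where "weak_solution a b c f u \<longleftrightarrow>
           u \<in> H10_space \<and> (\<forall>v\<in>H10_space. bilin a b c u v = L2_inner f v)"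

definition residual :: "(real \<Rightarrow> real) \<Rightarrow> (real \<Rightarrow> real) \<Rightarrow> (real \<Rightarrow> real) \<Rightarrow>
    (real \<Rightarrow> real) \<Rightarrow> (real \<Rightarrow> real) \<Rightarrow> real \<Rightarrow> real"
  where "residual a b c f u x =
           f x + wderiv a x * wderiv u x - b x * wderiv u x - c x * u x"

section \<open>Meshes and linear finite elements\<close>

text \<open>A mesh is given by its number \<open>N\<close> of elements and its nodes \<open>X 0, \<dots>, X N\<close>; elements are
  numbered \<open>1, \<dots>, N\<close>.\<close>

definition is_mesh :: "nat \<Rightarrow> (nat \<Rightarrow> real) \<Rightarrow> bool"
  where "is_mesh N X \<longleftrightarrow> X 0 = 0 \<and> X N = 1 \<and> (\<forall>i\<in>{1..N}. X (i - 1) < X i)"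

definition mesh_width :: "(nat \<Rightarrow> real) \<Rightarrow> nat \<Rightarrow> real"
  where "mesh_width X i = X i - X (i - 1)"

definition mesh_elem :: "(nat \<Rightarrow> real) \<Rightarrow> nat \<Rightarrow> real set"
  where "mesh_elem X i = {X (i - 1)<..<X i}"

definition fe_space :: "nat \<Rightarrow> (nat \<Rightarrow> real) \<Rightarrow> (real \<Rightarrow> real) set"
  where "fe_space N X = {v. continuous_on {0..1} v \<and> v 0 = 0 \<and> v 1 = 0 \<and>
           (\<forall>i\<in>{1..N}. \<exists>m q. \<forall>x\<in>mesh_elem X i. v x = m * x + q)}"

definition fe_solution :: "(real \<Rightarrow> real) \<Rightarrow> (real \<Rightarrow> real) \<Rightarrow> (real \<Rightarrow> real) \<Rightarrow>
    (real \<Rightarrow> real) \<Rightarrow> nat \<Rightarrow> (nat \<Rightarrow> real) \<Rightarrow> (real \<Rightarrow> real) \<Rightarrow> bool"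
  where "fe_solution a b c f N X u\<^sub>h \<longleftrightarrow> u\<^sub>h \<in> fe_space N X \<and>
           (\<forall>v\<in>fe_space N X. bilin a b c u\<^sub>h v = L2_inner f v)"

text \<open>The classical derivative of a finite element function is its elementwise derivative in
  the interior of each element; its values at the nodes are irrelevant.\<close>

definition fe_residual :: "(real \<Rightarrow> real) \<Rightarrow> (real \<Rightarrow> real) \<Rightarrow> (real \<Rightarrow> real) \<Rightarrow>
    (real \<Rightarrow> real) \<Rightarrow> (real \<Rightarrow> real) \<Rightarrow> real \<Rightarrow> real"
  where "fe_residual a b c f u\<^sub>h x =
           f x + wderiv a x * deriv u\<^sub>h x - b x * deriv u\<^sub>h x - c x * u\<^sub>h x"

text \<open>In the following quantities the argument \<open>g\<close> stands for the discrete residual.\<close>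

definition elem_mean :: "(nat \<Rightarrow> real) \<Rightarrow> (real \<Rightarrow> real) \<Rightarrow> nat \<Rightarrow> real"
  where "elem_mean X g i =
           sqrt (1 / mesh_width X i * (LINT x|lebesgue_on (mesh_elem X i). \<bar>g x\<bar>\<^sup>2))"

definition mesh_alpha :: "nat \<Rightarrow> (nat \<Rightarrow> real) \<Rightarrow> (real \<Rightarrow> real) \<Rightarrow> real"
  where "mesh_alpha N X g = (\<Sum>i=1..N. mesh_width X i * elem_mean X g i powr (2/3)) ^ 3"

definition mesh_rho :: "nat \<Rightarrow> (nat \<Rightarrow> real) \<Rightarrow> (real \<Rightarrow> real) \<Rightarrow> nat \<Rightarrow> real"
  where "mesh_rho N X g i = (1 + 1 / mesh_alpha N X g * (elem_mean X g i)\<^sup>2) powr (1/3)"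

definition mesh_sigma :: "nat \<Rightarrow> (nat \<Rightarrow> real) \<Rightarrow> (real \<Rightarrow> real) \<Rightarrow> real"
  where "mesh_sigma N X g = (\<Sum>i=1..N. mesh_rho N X g i * mesh_width X i)"

definition equidistributing :: "nat \<Rightarrow> (nat \<Rightarrow> real) \<Rightarrow> (real \<Rightarrow> real) \<Rightarrow> bool"
  where "equidistributing N X g \<longleftrightarrow>
           (\<forall>i\<in>{1..N}. mesh_rho N X g i * mesh_width X i = mesh_sigma N X g / real N)"

text \<open>A mesh that is equidistributing for the residual of its own finite element solution
  \<open>u\<^sub>h\<close>.\<close>

definition equidistributing_fe_mesh :: "(real \<Rightarrow> real) \<Rightarrow> (real \<Rightarrow> real) \<Rightarrow> (real \<Rightarrow> real) \<Rightarrow>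
    (real \<Rightarrow> real) \<Rightarrow> nat \<Rightarrow> (nat \<Rightarrow> real) \<Rightarrow> (real \<Rightarrow> real) \<Rightarrow> bool"
  where "equidistributing_fe_mesh a b c f N X u\<^sub>h \<longleftrightarrow>
           is_mesh N X \<and> fe_solution a b c f N X u\<^sub>h \<and>
           equidistributing N X (fe_residual a b c f u\<^sub>h)"

definition alpha_h :: "(real \<Rightarrow> real) \<Rightarrow> (real \<Rightarrow> real) \<Rightarrow> (real \<Rightarrow> real) \<Rightarrow>
    (real \<Rightarrow> real) \<Rightarrow> nat \<Rightarrow> (nat \<Rightarrow> real) \<Rightarrow> (real \<Rightarrow> real) \<Rightarrow> real"
  where "alpha_h a b c f N X u\<^sub>h = mesh_alpha N X (fe_residual a b c f u\<^sub>h)"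

end

theory Submission
  imports Defs
begin

text \<open>
  Up to null sets, a function in \<open>H10_space\<close> is the primitive of a square integrable function with
  mean zero, and a finite element function is the primitive of a step function on the mesh. Hence
  everything can be expressed by derivatives and their primitives over \<open>(0, 1)\<close>, and integration by
  parts reduces to Fubini's theorem (\<open>integration_by_parts_Prim\<close>). The two inclusions needed are the
  lemma of du Bois-Reymond (\<open>du_Bois_Reymond\<close>) and the density of the test functions in \<open>L\<^sup>2\<close>
  (\<open>test_functions_dense_L2\<close>); the second one also shows that finite element functions are
  admissible in the continuous problem.

  \<^bold>\<open>Error estimate.\<close> The assumption \<open>c - b'/2 \<ge> 0\<close> makes the bilinear form coercive,
  \<open>B(v, v) \<ge> a\<^sub>0 \<parallel>v'\<parallel>\<^sup>2\<close>. For the error \<open>e = u - u\<^sub>h\<close> and its nodal interpolant \<open>I e\<close>, Galerkin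
  orthogonality and elementwise integration by parts, where \<open>u\<^sub>h'\<close> is constant and \<open>e - I e\<close> vanishes
  at the nodes, give \<open>B(e, e) = \<integral> r\<^sub>h (e - I e)\<close>. Together with \<open>\<parallel>e - I e\<parallel> \<le> 2 h\<^sub>i \<parallel>e'\<parallel>\<close> on the \<open>i\<close>-th
  element this bounds \<open>\<parallel>e'\<parallel>\<^sup>2\<close> by a constant times \<open>\<Sum> h\<^sub>i\<^sup>3 \<langle>r\<^sub>h\<rangle>\<^sub>i\<^sup>2\<close> (\<open>fe_error\<close>). For an
  equidistributing mesh \<open>\<sigma>\<^sub>h \<le> 2\<close> and \<open>\<langle>r\<^sub>h\<rangle>\<^sub>i\<^sup>2 \<le> \<alpha>\<^sub>h \<rho>\<^sub>i\<^sup>3\<close>, so that this sum is at most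
  \<open>\<alpha>\<^sub>h \<Sum> (h\<^sub>i \<rho>\<^sub>i)\<^sup>3 = \<alpha>\<^sub>h \<sigma>\<^sub>h\<^sup>3 / N\<^sup>2\<close> (\<open>equidistributing_bounds\<close>).

  \<^bold>\<open>Size of \<open>\<alpha>\<^sub>h\<close>.\<close> Let \<open>S g = \<Sum> h\<^sub>i \<langle>g\<rangle>\<^sub>i\<close> with \<open>\<langle>g\<rangle>\<^sub>i\<close> raised to the power \<open>2/3\<close>, so that
  \<open>\<alpha>\<^sub>h = (S r\<^sub>h)\<^sup>3\<close>. By subadditivity and concavity of the power, \<open>S r\<close> and \<open>S r\<^sub>h\<close> differ by at most the
  power \<open>2/3\<close> of \<open>\<parallel>r - r\<^sub>h\<parallel>\<close> (\<open>S_triangle\<close>). Since \<open>r - r\<^sub>h\<close> is bounded by \<open>e'\<close>, the error estimate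
  turns this into a relative perturbation: \<open>\<bar>S r - S r\<^sub>h\<bar> \<le> q S r\<^sub>h\<close> where \<open>q\<close> is the power \<open>2/3\<close> of
  a constant over \<open>N\<close> (\<open>equidistributing_estimates\<close>). It remains to compare \<open>S r\<close> with the integral
  of the power \<open>2/3\<close> of \<open>\<bar>r\<bar>\<close>. Jensen's inequality shows that \<open>S r\<close> is the larger one, and if \<open>r'\<close>
  is integrable, then \<open>S r\<close> exceeds the integral by at most the power \<open>2/3\<close> of \<open>2 \<parallel>r'\<parallel>\<^sub>1 / N\<close>, because
  \<open>h\<^sub>i \<le> 2 / N\<close> (\<open>S_le_integral_powr\<close>). The limit for general \<open>r\<close> follows by approximating \<open>r\<close> by
  test functions (\<open>S_tendsto\<close>).
\<close>

section \<open>Smooth functions and test functions\<close>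

text \<open>All iterated derivatives exist on the whole real line, as in the definition of the test
  functions.\<close>

definition smooth :: "(real \<Rightarrow> real) \<Rightarrow> bool"
  where "smooth f \<longleftrightarrow> (\<forall>k x. (deriv ^^ k) f differentiable (at x))"

text \<open>Smoothness is coinductive: it suffices to find a class of functions that contains the given one
  and is closed under differentiation.\<close>

lemma smooth_coinduct:
  assumes F: "\<And>f. f \<in> F \<Longrightarrow> \<exists>f'\<in>F. \<forall>x. (f has_real_derivative f' x) (at x)" and f: "f \<in> F"
  shows "smooth f"
proof -
  have "(deriv ^^ k) f \<in> F" for k
  proof (induction k)
    case (Suc k)
    obtain f' where f': "f' \<in> F" "\<And>x. ((deriv ^^ k) f has_real_derivative f' x) (at x)"
      using F[OF Suc] by blast
    then have "deriv ((deriv ^^ k) f) = f'"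
      by (auto intro: DERIV_imp_deriv)
    with f' show ?case by simp
  qed (use f in simp)
  then show ?thesis
    unfolding smooth_def using F by (meson real_differentiable_def)
qed

lemma smooth_differentiable: "smooth f \<Longrightarrow> f differentiable (at x)"
  unfolding smooth_def by (metis funpow_0)

lemma smooth_has_deriv: "smooth f \<Longrightarrow> (f has_real_derivative deriv f x) (at x)"
  by (meson DERIV_deriv_iff_real_differentiable smooth_differentiable)

lemma smooth_deriv: "smooth f \<Longrightarrow> smooth (deriv f)"
  unfolding smooth_def by (metis funpow_Suc_right comp_apply)

lemma smooth_continuous_on: "smooth f \<Longrightarrow> continuous_on S f"
  by (meson DERIV_isCont continuous_at_imp_continuous_on smooth_has_deriv)

lemma smooth_affine: "smooth (\<lambda>x. p * x + q)"
proof (rule smooth_coinduct[where F = "{f. \<exists>p q. f = (\<lambda>x. p * x + q)}"])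
  fix f :: "real \<Rightarrow> real"
  assume "f \<in> {f. \<exists>p q. f = (\<lambda>x. p * x + q)}"
  then obtain p q where f: "f = (\<lambda>x. p * x + q)" by blast
  have "\<forall>x. (f has_real_derivative 0 * x + p) (at x)"
    unfolding f by (auto intro!: derivative_eq_intros)
  then show "\<exists>f'\<in>{f. \<exists>p q. f = (\<lambda>x. p * x + q)}. \<forall>x. (f has_real_derivative f' x) (at x)"
    by (intro bexI[of _ "\<lambda>x. 0 * x + p"] CollectI exI[of _ "0::real"] exI[of _ p] refl)
qed blast

lemma smooth_const: "smooth (\<lambda>x. q)"
  using smooth_affine[of 0 q] by simp

text \<open>The algebra generated by the smooth functions is closed under differentiation, so that it
  consists of smooth functions.\<close>

inductive_set smooth_alg :: "(real \<Rightarrow> real) set" where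
  base: "smooth f \<Longrightarrow> f \<in> smooth_alg"
| add: "f \<in> smooth_alg \<Longrightarrow> g \<in> smooth_alg \<Longrightarrow> (\<lambda>x. f x + g x) \<in> smooth_alg"
| mult: "f \<in> smooth_alg \<Longrightarrow> g \<in> smooth_alg \<Longrightarrow> (\<lambda>x. f x * g x) \<in> smooth_alg"
| affine: "f \<in> smooth_alg \<Longrightarrow> (\<lambda>x. f (p * x + q)) \<in> smooth_alg"

lemma smooth_alg_deriv:
  "f \<in> smooth_alg \<Longrightarrow> \<exists>f'\<in>smooth_alg. \<forall>x. (f has_real_derivative f' x) (at x)"
proof (induction rule: smooth_alg.induct)
  case (base f)
  then show ?case by (meson smooth_has_deriv smooth_deriv smooth_alg.base)
next
  case (add f g)
  then obtain f' g' where "f' \<in> smooth_alg" "g' \<in> smooth_alg"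
    "\<And>x. (f has_real_derivative f' x) (at x)" "\<And>x. (g has_real_derivative g' x) (at x)" by blast
  then show ?case
    by (intro bexI[of _ "\<lambda>x. f' x + g' x"]) (auto intro: smooth_alg.intros DERIV_add)
next
  case (mult f g)
  then obtain f' g' where *: "f' \<in> smooth_alg" "g' \<in> smooth_alg"
    "\<And>x. (f has_real_derivative f' x) (at x)" "\<And>x. (g has_real_derivative g' x) (at x)" by blast
  show ?case
    by (intro bexI[of _ "\<lambda>x. f' x * g x + g' x * f x"] allI DERIV_mult smooth_alg.add
        smooth_alg.mult mult.hyps *)
next
  case (affine f p q)
  then obtain f' where *: "f' \<in> smooth_alg" "\<And>x. (f has_real_derivative f' x) (at x)" by blast
  have "((\<lambda>x. f (p * x + q)) has_real_derivative f' (p * x + q) * p) (at x)" for x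
    by (rule DERIV_chain2[OF *(2)]) (auto intro!: derivative_eq_intros)
  moreover have "(\<lambda>x. f' (p * x + q) * p) \<in> smooth_alg"
    using smooth_alg.mult[OF smooth_alg.affine[OF *(1)] smooth_alg.base[OF smooth_const]] .
  ultimately show ?case by (intro bexI[of _ "\<lambda>x. f' (p * x + q) * p"] allI)
qed

lemma smooth_alg_smooth: "f \<in> smooth_alg \<Longrightarrow> smooth f"
  by (rule smooth_coinduct[where F = smooth_alg], rule smooth_alg_deriv)

lemma smooth_add: "smooth f \<Longrightarrow> smooth g \<Longrightarrow> smooth (\<lambda>x. f x + g x)"
  by (rule smooth_alg_smooth, rule smooth_alg.add) (rule smooth_alg.base, assumption)+

lemma smooth_mult: "smooth f \<Longrightarrow> smooth g \<Longrightarrow> smooth (\<lambda>x. f x * g x)"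
  by (rule smooth_alg_smooth, rule smooth_alg.mult) (rule smooth_alg.base, assumption)+

lemma smooth_compose_affine: "smooth f \<Longrightarrow> smooth (\<lambda>x. f (p * x + q))"
  by (rule smooth_alg_smooth, rule smooth_alg.affine, rule smooth_alg.base)

lemma smooth_cmult: "smooth f \<Longrightarrow> smooth (\<lambda>x. c * f x)"
  by (intro smooth_mult smooth_const)

lemma smooth_diff: "smooth f \<Longrightarrow> smooth g \<Longrightarrow> smooth (\<lambda>x. f x - g x)"
  using smooth_add[OF _ smooth_cmult[of g "-1"], of f] by simp

lemma smooth_antiderivative:
  assumes "\<And>x. (F has_real_derivative f x) (at x)" "smooth f"
  shows "smooth F"
  by (rule smooth_coinduct[where F = "insert F (Collect smooth)"])
     (use assms smooth_has_deriv smooth_deriv in blast)+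

lemma smooth_real_polynomial_function:
  fixes p :: "real \<Rightarrow> real"
  shows "real_polynomial_function p \<Longrightarrow> smooth p"
proof (induction p rule: real_polynomial_function.induct)
  case (linear f)
  have "f x = f 1 * x + 0" for x
    using bounded_linear.linear[OF linear] linear_scale[of f x 1] by (simp add: mult.commute)
  then have "f = (\<lambda>x. f 1 * x + 0)" by blast
  then show ?case using smooth_affine[of "f 1" 0] by simp
qed (auto intro: smooth_const smooth_add smooth_mult)

subsection \<open>A smooth function vanishing on a half line\<close>

text \<open>The functions \<open>P(1/x) exp(-1/x)\<close> for \<open>x > 0\<close>, extended by zero, with a polynomial \<open>P\<close>. The
  derivative is again of this form, for the polynomial \<open>y\<^sup>2 (P(y) - P'(y))\<close>.\<close>

definition flat_exp :: "real poly \<Rightarrow> real \<Rightarrow> real"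
  where "flat_exp P x = (if x > 0 then poly P (1 / x) * exp (- (1 / x)) else 0)"

lemma poly_times_exp_tendsto_0: "((\<lambda>y::real. poly P y * exp (- y)) \<longlongrightarrow> 0) at_top"
proof -
  have "((\<lambda>y. \<Sum>i\<le>degree P. coeff P i * (y ^ i / exp y)) \<longlongrightarrow> (\<Sum>i\<le>degree P. coeff P i * 0)) at_top"
    by (intro tendsto_sum tendsto_mult tendsto_const tendsto_power_div_exp_0)
  then show ?thesis
    by (simp add: poly_altdef sum_distrib_right exp_minus field_simps sum_divide_distrib)
qed

lemma flat_exp_deriv:
  "(flat_exp P has_real_derivative flat_exp ([:0, 0, 1:] * (P - pderiv P)) x) (at x)"
proof -
  consider "x > 0" | "x < 0" | "x = 0" by linarith
  then show ?thesis
  proof cases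
    case 1
    have "((\<lambda>x. poly P (1 / x) * exp (- (1 / x))) has_real_derivative
        flat_exp ([:0, 0, 1:] * (P - pderiv P)) x) (at x)"
      using 1 by (auto intro!: derivative_eq_intros DERIV_chain2[OF poly_DERIV]
          simp: flat_exp_def field_simps power2_eq_square)
    then show ?thesis
      by (rule has_field_derivative_transform_within_open[where S = "{0<..}"])
         (use 1 in \<open>auto simp: flat_exp_def\<close>)
  next
    case 2
    have "((\<lambda>x. 0) has_real_derivative flat_exp ([:0, 0, 1:] * (P - pderiv P)) x) (at x)"
      using 2 by (auto simp: flat_exp_def)
    then show ?thesis
      by (rule has_field_derivative_transform_within_open[where S = "{..<0}"])
         (use 2 in \<open>auto simp: flat_exp_def\<close>)
  next
    case 3
    have "((\<lambda>h. poly (pCons 0 P) (inverse h) * exp (- inverse h)) \<longlongrightarrow> 0) (at_right 0)"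
      by (rule filterlim_compose[OF poly_times_exp_tendsto_0 filterlim_inverse_at_top_right])
    then have r: "((\<lambda>h. flat_exp P h / h) \<longlongrightarrow> 0) (at_right 0)"
      by (rule Lim_transform_eventually)
         (auto simp: flat_exp_def eventually_at_filter field_simps)
    have l: "((\<lambda>h. flat_exp P h / h) \<longlongrightarrow> 0) (at_left 0)"
      by (rule Lim_transform_eventually[OF tendsto_const])
         (auto simp: flat_exp_def eventually_at_filter)
    have "((\<lambda>h. flat_exp P h / h) \<longlongrightarrow> 0) (at 0)"
      using l r by (simp add: filterlim_split_at)
    then show ?thesis
      unfolding 3 DERIV_def by (simp add: flat_exp_def)
  qed
qed

text \<open>The case \<open>P = 1\<close>.\<close>

definition flat :: "real \<Rightarrow> real"
  where "flat x = (if x > 0 then exp (- (1 / x)) else 0)"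

lemma smooth_flat: "smooth flat"
proof -
  have "smooth (flat_exp P)" for P
    by (rule smooth_coinduct[where F = "range flat_exp"]) (use flat_exp_deriv in blast)+
  from this[of 1] show ?thesis
    by (simp add: flat_def[abs_def] flat_exp_def[abs_def] cong: if_cong)
qed

lemma flat_bounds: "0 \<le> flat x" "flat x \<le> 1"
  by (auto simp: flat_def)

lemma flat_nonpos: "x \<le> 0 \<Longrightarrow> flat x = 0"
  by (simp add: flat_def)

lemma flat_tendsto_1: "(flat \<longlongrightarrow> 1) at_top"
proof -
  have "((\<lambda>x::real. exp (- inverse x)) \<longlongrightarrow> exp (- 0)) at_top"
    by (intro tendsto_intros tendsto_inverse_0_at_top filterlim_ident)
  then have "((\<lambda>x::real. exp (- inverse x)) \<longlongrightarrow> 1) at_top" by simp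
  then show ?thesis
    by (rule Lim_transform_eventually)
       (use eventually_gt_at_top[of 0] in eventually_elim, auto simp: flat_def divide_simps)
qed

text \<open>Smooth cutoff functions with values in \<open>[0, 1]\<close>, which vanish outside of
  \<open>[p + 1/n, q - 1/n]\<close> and converge to the indicator function of \<open>(p, q)\<close>.\<close>

definition cutoff :: "real \<Rightarrow> real \<Rightarrow> nat \<Rightarrow> real \<Rightarrow> real"
  where "cutoff p q n x = flat (real n * (x - p) - 1) * flat (real n * (q - x) - 1)"

lemma smooth_cutoff: "smooth (cutoff p q n)"
proof -
  have "smooth (\<lambda>x. flat (real n * x + (- real n * p - 1)) * flat ((- real n) * x + (real n * q - 1)))"
    by (intro smooth_mult smooth_compose_affine smooth_flat)
  moreover have "cutoff p q n =
      (\<lambda>x. flat (real n * x + (- real n * p - 1)) * flat ((- real n) * x + (real n * q - 1)))"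
    by (auto simp: cutoff_def algebra_simps intro!: arg_cong2[where f = "(*)"] arg_cong[where f = flat])
  ultimately show ?thesis by simp
qed

lemma cutoff_bounds: "0 \<le> cutoff p q n x" "cutoff p q n x \<le> 1"
  by (auto simp: cutoff_def intro!: mult_le_one mult_nonneg_nonneg flat_bounds)

lemma cutoff_eq_0:
  assumes "x \<notin> {p + 1 / real n..q - 1 / real n}"
  shows "cutoff p q n x = 0"
proof (cases "n = 0")
  case True
  then show ?thesis by (simp add: cutoff_def flat_nonpos)
next
  case False
  then have "real n * (x - p) - 1 \<le> 0 \<or> real n * (q - x) - 1 \<le> 0"
    using assms by (auto simp: field_simps)
  then show ?thesis by (auto simp: cutoff_def flat_nonpos)
qed

lemma cutoff_tendsto: "(\<lambda>n. cutoff p q n x) \<longlonglongrightarrow> indicator {p<..<q} x"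
proof (cases "x \<in> {p<..<q}")
  case True
  have lim: "filterlim (\<lambda>n. real n * d - 1) at_top sequentially" if "d > 0" for d
    using filterlim_tendsto_add_at_top[OF tendsto_const[of "-1"]
        filterlim_at_top_mult_tendsto_pos[OF tendsto_const[of d] that filterlim_real_sequentially]]
    by (simp add: mult.commute)
  have "(\<lambda>n. cutoff p q n x) \<longlonglongrightarrow> 1 * 1"
    unfolding cutoff_def
    by (intro tendsto_mult filterlim_compose[OF flat_tendsto_1] lim) (use True in auto)
  then show ?thesis using True by simp
next
  case False
  have "cutoff p q n x = 0" for n
  proof (cases "n = 0")
    case True
    then show ?thesis by (simp add: cutoff_def flat_nonpos)
  next
    case nz: False
    then have "p < p + 1 / real n" "q - 1 / real n < q" by simp_all
    then have "x \<notin> {p + 1 / real n..q - 1 / real n}"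
      using False unfolding atLeastAtMost_iff greaterThanLessThan_iff by linarith
    then show ?thesis by (rule cutoff_eq_0)
  qed
  then show ?thesis using False by simp
qed

subsection \<open>Test functions\<close>

lemma test_functions_iff:
  "\<phi> \<in> test_functions \<longleftrightarrow> smooth \<phi> \<and> (\<exists>p q. 0 < p \<and> p \<le> q \<and> q < 1 \<and> (\<forall>x. x \<notin> {p..q} \<longrightarrow> \<phi> x = 0))"
    (is "_ \<longleftrightarrow> smooth \<phi> \<and> ?R")
proof -
  have "(\<exists>K. compact K \<and> K \<subseteq> Omega \<and> (\<forall>x. x \<notin> K \<longrightarrow> \<phi> x = 0)) \<longleftrightarrow> ?R"
  proof
    assume "\<exists>K. compact K \<and> K \<subseteq> Omega \<and> (\<forall>x. x \<notin> K \<longrightarrow> \<phi> x = 0)"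
    then obtain K where K: "compact K" "K \<subseteq> Omega" "\<And>x. x \<notin> K \<Longrightarrow> \<phi> x = 0" by blast
    show ?R
    proof (cases "K = {}")
      case True
      then show ?thesis using K(3) by (intro exI[of _ "1/2"]) auto
    next
      case False
      obtain p where p: "p \<in> K" "\<And>x. x \<in> K \<Longrightarrow> p \<le> x"
        using compact_attains_inf[OF K(1) False] by blast
      obtain q where q: "q \<in> K" "\<And>x. x \<in> K \<Longrightarrow> x \<le> q"
        using compact_attains_sup[OF K(1) False] by blast
      show ?thesis
      proof (intro exI conjI allI impI)
        show "0 < p" "q < 1" using p q K(2) by auto
        show "p \<le> q" using p q by blast
        show "\<phi> x = 0" if "x \<notin> {p..q}" for x
          using that p q K(3) by (meson atLeastAtMost_iff)
      qed
    qed
  next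
    assume ?R
    then obtain p q where "0 < p" "p \<le> q" "q < 1" "\<And>x. x \<notin> {p..q} \<Longrightarrow> \<phi> x = 0" by blast
    then show "\<exists>K. compact K \<and> K \<subseteq> Omega \<and> (\<forall>x. x \<notin> K \<longrightarrow> \<phi> x = 0)"
      by (intro exI[of _ "{p..q}"]) auto
  qed
  then show ?thesis by (simp add: test_functions_def smooth_def)
qed

lemma test_smooth: "\<phi> \<in> test_functions \<Longrightarrow> smooth \<phi>"
  by (simp add: test_functions_iff)

lemma test_cutoff_mult:
  assumes "smooth f" "0 \<le> p" "q \<le> 1"
  shows "(\<lambda>x. f x * cutoff p q n x) \<in> test_functions"
proof (cases "n > 0 \<and> p + 1 / real n \<le> q - 1 / real n")
  case True
  have d: "1 / real n > 0" using True by simp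
  show ?thesis
    unfolding test_functions_iff
  proof (intro conjI exI allI impI smooth_mult smooth_cutoff assms(1))
    show "0 < p + 1 / real n" "p + 1 / real n \<le> q - 1 / real n" "q - 1 / real n < 1"
      using True assms d by linarith+
    show "f x * cutoff p q n x = 0" if "x \<notin> {p + 1 / real n..q - 1 / real n}" for x
      using cutoff_eq_0[OF that] by simp
  qed
next
  case False
  have "cutoff p q n x = 0" for x
  proof (cases "n = 0")
    case True
    then show ?thesis by (simp add: cutoff_def flat_nonpos)
  next
    case nz: False
    show ?thesis using False nz by (intro cutoff_eq_0) auto
  qed
  then show ?thesis
    unfolding test_functions_iff
    by (intro conjI exI[of _ "1/2"] smooth_mult smooth_cutoff assms) auto
qed

lemma test_diff_cmult:
  assumes "\<phi> \<in> test_functions" "\<psi> \<in> test_functions"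
  shows "(\<lambda>x. \<phi> x - c * \<psi> x) \<in> test_functions"
proof -
  obtain p q where pq: "0 < p" "p \<le> q" "q < 1" "\<And>x. x \<notin> {p..q} \<Longrightarrow> \<phi> x = 0"
    using assms(1) unfolding test_functions_iff by metis
  obtain r s where rs: "0 < r" "r \<le> s" "s < 1" "\<And>x. x \<notin> {r..s} \<Longrightarrow> \<psi> x = 0"
    using assms(2) unfolding test_functions_iff by metis
  have "\<phi> x - c * \<psi> x = 0" if "x \<notin> {min p r..max q s}" for x
    using that by (subst pq(4), force, subst rs(4)) auto
  then show ?thesis
    unfolding test_functions_iff using pq(1-3) rs(1-3) assms
    by (intro conjI smooth_diff smooth_cmult test_smooth exI[of _ "min p r"] exI[of _ "max q s"]) auto
qed

lemma test_deriv:
  assumes "\<phi> \<in> test_functions"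
  shows "deriv \<phi> \<in> test_functions"
proof -
  obtain p q where pq: "0 < p" "p \<le> q" "q < 1" "\<And>x. x \<notin> {p..q} \<Longrightarrow> \<phi> x = 0"
    using assms(1) unfolding test_functions_iff by metis
  have "deriv \<phi> x = 0" if "x \<notin> {p..q}" for x
  proof -
    have "((\<lambda>x. 0) has_real_derivative 0) (at x)" by simp
    then have "(\<phi> has_real_derivative 0) (at x)"
      by (rule has_field_derivative_transform_within_open[where S = "- {p..q}"])
         (use that pq in auto)
    then show ?thesis by (rule DERIV_imp_deriv)
  qed
  then show ?thesis
    unfolding test_functions_iff using pq assms smooth_deriv test_smooth by blast
qed

lemma test_bound:
  assumes "\<phi> \<in> test_functions"
  obtains B where "B > 0" "\<And>x. \<bar>\<phi> x\<bar> \<le> B"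
proof -
  obtain p q where pq: "0 < p" "p \<le> q" "q < 1" "\<And>x. x \<notin> {p..q} \<Longrightarrow> \<phi> x = 0"
    using assms(1) unfolding test_functions_iff by metis
  have "compact (\<phi> ` {p..q})"
    by (intro compact_continuous_image smooth_continuous_on test_smooth assms compact_Icc)
  then obtain B where "B > 0" "\<And>y. y \<in> \<phi> ` {p..q} \<Longrightarrow> norm y \<le> B"
    using compact_imp_bounded bounded_pos by metis
  with pq show ?thesis
    by (intro that[of B]) (auto, metis abs_zero atLeastAtMost_iff imageI less_imp_le)
qed

section \<open>Square integrable functions\<close>

text \<open>The space \<open>L\<^sup>2\<close> of an arbitrary measure, and its norm.\<close>

definition sq_integrable :: "'a measure \<Rightarrow> ('a \<Rightarrow> real) \<Rightarrow> bool"
  where "sq_integrable M f \<longleftrightarrow> f \<in> borel_measurable M \<and> integrable M (\<lambda>x. (f x)\<^sup>2)"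

definition l2norm :: "'a measure \<Rightarrow> ('a \<Rightarrow> real) \<Rightarrow> real"
  where "l2norm M f = sqrt (LINT x|M. (f x)\<^sup>2)"

lemma sq_integrable_measurable: "sq_integrable M f \<Longrightarrow> f \<in> borel_measurable M"
  by (simp add: sq_integrable_def)

lemma l2norm_nonneg [simp]: "0 \<le> l2norm M f"
  by (simp add: l2norm_def)

lemma l2norm_sq: "(l2norm M f)\<^sup>2 = (LINT x|M. (f x)\<^sup>2)"
  by (simp add: l2norm_def)

lemma sq_integrable_mult:
  assumes "sq_integrable M f" "sq_integrable M g"
  shows "integrable M (\<lambda>x. f x * g x)"
proof (rule Bochner_Integration.integrable_bound)
  show "integrable M (\<lambda>x. (f x)\<^sup>2 + (g x)\<^sup>2)"
    using assms by (simp add: sq_integrable_def)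
  show "(\<lambda>x. f x * g x) \<in> borel_measurable M"
    using assms by (auto simp: sq_integrable_def intro!: borel_measurable_times)
  have "\<bar>s * t\<bar> \<le> s\<^sup>2 + t\<^sup>2" for s t :: real
  proof -
    have "2 * (\<bar>s\<bar> * \<bar>t\<bar>) \<le> \<bar>s\<bar>\<^sup>2 + \<bar>t\<bar>\<^sup>2"
      using sum_squares_bound[of "\<bar>s\<bar>" "\<bar>t\<bar>"] by (simp add: mult.assoc)
    moreover have "0 \<le> \<bar>s\<bar> * \<bar>t\<bar>" by simp
    ultimately show ?thesis unfolding abs_mult power2_abs by linarith
  qed
  then show "AE x in M. norm (f x * g x) \<le> norm ((f x)\<^sup>2 + (g x)\<^sup>2)" by simp
qed

lemma sq_integrable_add:
  assumes "sq_integrable M f" "sq_integrable M g"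
  shows "sq_integrable M (\<lambda>x. f x + g x)"
proof -
  have "integrable M (\<lambda>x. (f x)\<^sup>2 + (g x)\<^sup>2 + 2 * (f x * g x))"
    using assms sq_integrable_mult[OF assms] by (simp add: sq_integrable_def)
  then show ?thesis
    using assms by (auto simp: sq_integrable_def power2_sum mult.assoc intro!: borel_measurable_add)
qed

lemma sq_integrable_cmult: "sq_integrable M f \<Longrightarrow> sq_integrable M (\<lambda>x. c * f x)"
  by (auto simp: sq_integrable_def power_mult_distrib intro!: borel_measurable_times)

lemma sq_integrable_diff:
  "sq_integrable M f \<Longrightarrow> sq_integrable M g \<Longrightarrow> sq_integrable M (\<lambda>x. f x - g x)"
  using sq_integrable_add[of M f "\<lambda>x. (-1) * g x"] sq_integrable_cmult[of M g "-1"] by simp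

lemma sq_integrable_mono:
  assumes "sq_integrable M f" "g \<in> borel_measurable M" "AE x in M. \<bar>g x\<bar> \<le> B * \<bar>f x\<bar>"
  shows "sq_integrable M g" "l2norm M g \<le> \<bar>B\<bar> * l2norm M f"
proof -
  have *: "AE x in M. (g x)\<^sup>2 \<le> B\<^sup>2 * (f x)\<^sup>2"
    using assms(3)
  proof eventually_elim
    case (elim x)
    then have "\<bar>g x\<bar>\<^sup>2 \<le> (B * \<bar>f x\<bar>)\<^sup>2" by (intro power_mono) auto
    then show ?case by (simp add: power_mult_distrib)
  qed
  have i: "integrable M (\<lambda>x. B\<^sup>2 * (f x)\<^sup>2)"
    using assms(1) by (simp add: sq_integrable_def)
  have g: "integrable M (\<lambda>x. (g x)\<^sup>2)"
    by (rule Bochner_Integration.integrable_bound[OF i]) (use * assms(2) in auto)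
  then show "sq_integrable M g"
    using assms(2) by (simp add: sq_integrable_def)
  have "(LINT x|M. (g x)\<^sup>2) \<le> (LINT x|M. B\<^sup>2 * (f x)\<^sup>2)"
    by (intro integral_mono_AE g i *)
  then have "(l2norm M g)\<^sup>2 \<le> (\<bar>B\<bar> * l2norm M f)\<^sup>2"
    by (simp add: l2norm_sq power_mult_distrib)
  then show "l2norm M g \<le> \<bar>B\<bar> * l2norm M f"
    by (rule power2_le_imp_le) simp
qed

lemma sq_integrable_bounded_mult:
  assumes "sq_integrable M f" "b \<in> borel_measurable M" "AE x in M. \<bar>b x\<bar> \<le> B"
  shows "sq_integrable M (\<lambda>x. b x * f x)" "l2norm M (\<lambda>x. b x * f x) \<le> \<bar>B\<bar> * l2norm M f"
proof -
  have "AE x in M. \<bar>b x * f x\<bar> \<le> B * \<bar>f x\<bar>"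
    using assms(3) by eventually_elim (simp add: abs_mult mult_right_mono)
  moreover have "(\<lambda>x. b x * f x) \<in> borel_measurable M"
    using assms by (auto simp: sq_integrable_def intro!: borel_measurable_times)
  ultimately show "sq_integrable M (\<lambda>x. b x * f x)" "l2norm M (\<lambda>x. b x * f x) \<le> \<bar>B\<bar> * l2norm M f"
    using sq_integrable_mono[OF assms(1)] by blast+
qed

lemma Cauchy_Schwarz_LINT:
  assumes "sq_integrable M f" "sq_integrable M g"
  shows "\<bar>LINT x|M. f x * g x\<bar> \<le> l2norm M f * l2norm M g"
proof -
  define A B C where "A = (LINT x|M. (f x)\<^sup>2)" and "B = (LINT x|M. f x * g x)" and "C = (LINT x|M. (g x)\<^sup>2)"
  have int: "integrable M (\<lambda>x. (f x)\<^sup>2)" "integrable M (\<lambda>x. (g x)\<^sup>2)" "integrable M (\<lambda>x. f x * g x)"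
    using assms sq_integrable_mult[OF assms] by (simp_all add: sq_integrable_def)
  have "A \<ge> 0" by (simp add: A_def)
  \<comment> \<open>Expand the integral of \<open>(A g - B f)\<^sup>2\<close>.\<close>
  have "B\<^sup>2 \<le> A * C"
  proof (cases "A = 0")
    case True
    then have "AE x in M. (f x)\<^sup>2 = 0"
      using integral_nonneg_eq_0_iff_AE[OF int(1)] by (simp add: A_def)
    then have "B = 0"
      unfolding B_def by (intro integral_eq_zero_AE) auto
    with True show ?thesis by simp
  next
    case False
    have "0 \<le> (LINT x|M. (A * g x - B * f x)\<^sup>2)" by simp
    also have "\<dots> = (LINT x|M. A\<^sup>2 * (g x)\<^sup>2 + B\<^sup>2 * (f x)\<^sup>2 - 2 * A * B * (f x * g x))"
      by (intro Bochner_Integration.integral_cong) (auto simp: power2_eq_square algebra_simps)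
    also have "\<dots> = A\<^sup>2 * C + B\<^sup>2 * A - 2 * A * B * B"
      using int by (simp add: A_def B_def C_def)
    finally have "0 \<le> A * (A * C - B\<^sup>2)" by (simp add: power2_eq_square algebra_simps)
    then show ?thesis using False \<open>A \<ge> 0\<close> by (simp add: zero_le_mult_iff)
  qed
  then have "\<bar>B\<bar> \<le> sqrt (A * C)"
    by (metis real_sqrt_abs real_sqrt_le_iff)
  then show ?thesis by (simp add: A_def B_def C_def l2norm_def real_sqrt_mult)
qed

lemma l2norm_triangle:
  assumes "sq_integrable M f" "sq_integrable M g"
  shows "l2norm M (\<lambda>x. f x + g x) \<le> l2norm M f + l2norm M g"
proof (rule power2_le_imp_le)
  have int: "integrable M (\<lambda>x. (f x)\<^sup>2)" "integrable M (\<lambda>x. (g x)\<^sup>2)" "integrable M (\<lambda>x. f x * g x)"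
    using assms sq_integrable_mult[OF assms] by (simp_all add: sq_integrable_def)
  have "(l2norm M (\<lambda>x. f x + g x))\<^sup>2 = (LINT x|M. (f x)\<^sup>2 + (g x)\<^sup>2 + 2 * (f x * g x))"
    unfolding l2norm_sq by (intro Bochner_Integration.integral_cong) (auto simp: power2_sum)
  also have "\<dots> = (l2norm M f)\<^sup>2 + (l2norm M g)\<^sup>2 + 2 * (LINT x|M. f x * g x)"
    using int by (simp add: l2norm_sq)
  also have "\<dots> \<le> (l2norm M f)\<^sup>2 + (l2norm M g)\<^sup>2 + 2 * (l2norm M f * l2norm M g)"
    using Cauchy_Schwarz_LINT[OF assms] by simp
  finally show "(l2norm M (\<lambda>x. f x + g x))\<^sup>2 \<le> (l2norm M f + l2norm M g)\<^sup>2"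
    by (simp add: power2_sum)
qed simp

lemma l2norm_cmult: "l2norm M (\<lambda>x. c * f x) = \<bar>c\<bar> * l2norm M f"
  by (simp add: l2norm_def power_mult_distrib real_sqrt_mult)

lemma l2norm_minus_commute: "l2norm M (\<lambda>x. f x - g x) = l2norm M (\<lambda>x. g x - f x)"
  by (simp add: l2norm_def power2_commute)

lemma l2norm_cong_AE:
  assumes "AE x in M. f x = g x" "f \<in> borel_measurable M" "g \<in> borel_measurable M"
  shows "l2norm M f = l2norm M g"
  unfolding l2norm_def by (intro arg_cong[where f = sqrt] integral_cong_AE) (use assms in auto)

lemma (in finite_measure) sq_integrable_const: "sq_integrable M (\<lambda>x. c)"
  by (simp add: sq_integrable_def)

lemma (in finite_measure) sq_integrable_imp_integrable: "sq_integrable M f \<Longrightarrow> integrable M f"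
  using sq_integrable_mult[OF _ sq_integrable_const[of 1]] by simp

section \<open>Lebesgue measure on the unit interval and primitives\<close>

abbreviation Om :: "real measure"
  where "Om \<equiv> lebesgue_on Omega"

lemma measurable_id_Om [measurable]: "(\<lambda>x. x) \<in> borel_measurable Om"
  using id_borel_measurable_lebesgue_on[of Omega] by (simp add: id_def)

lemma continuous_measurable_Om: "continuous_on Omega f \<Longrightarrow> f \<in> borel_measurable Om"
  for f :: "real \<Rightarrow> real"
  by (rule continuous_imp_measurable_on_sets_lebesgue) auto

lemma indicator_measurable_Om [measurable]: "A \<in> sets borel \<Longrightarrow> indicator A \<in> borel_measurable Om"
  for A :: "real set"
  using measurable_compose[OF measurable_id_Om, of "indicator A :: real \<Rightarrow> real" borel] by simp

lemma finite_measure_Om: "finite_measure Om"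
  by (rule finite_measure_lebesgue_on) simp

interpretation Om: finite_measure Om
  by (rule finite_measure_Om)

lemma emeasure_Om: "A \<subseteq> Omega \<Longrightarrow> A \<in> sets borel \<Longrightarrow> emeasure Om A = emeasure lborel A"
  by (subst emeasure_restrict_space) (auto simp: emeasure_completion)

text \<open>Since Lebesgue measure is complete, changing a function on a null set preserves measurability, so
  that integrability passes to almost everywhere equal functions without further assumptions.\<close>

lemma measurable_AE_Om:
  fixes f g :: "real \<Rightarrow> real"
  assumes "f \<in> borel_measurable Om" "AE x in Om. f x = g x"
  shows "g \<in> borel_measurable Om"
proof -
  have "(\<lambda>x. if x \<in> Omega then f x else 0) \<in> borel_measurable lebesgue"
    by (rule borel_measurable_if_I[OF assms(1)]) simp
  moreover have "AE x in lebesgue. (if x \<in> Omega then f x else 0) = (if x \<in> Omega then g x else 0)"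
    using assms(2) by (subst (asm) AE_restrict_space_iff) auto
  ultimately have "(\<lambda>x. if x \<in> Omega then g x else 0) \<in> borel_measurable lebesgue"
    by (rule borel_measurable_AE)
  then show ?thesis by (rule borel_measurable_if_D)
qed

lemma integrable_AE_Om:
  fixes f g :: "real \<Rightarrow> real"
  assumes "integrable Om f" "AE x in Om. f x = g x"
  shows "integrable Om g" "integral\<^sup>L Om g = integral\<^sup>L Om f"
proof -
  have g: "g \<in> borel_measurable Om"
    using measurable_AE_Om[OF _ assms(2)] assms(1) by blast
  show "integrable Om g"
    by (rule integrable_cong_AE_imp[OF assms(1) g]) (use assms(2) in auto)
  show "integral\<^sup>L Om g = integral\<^sup>L Om f"
    by (rule integral_cong_AE) (use g assms in auto)
qed

lemma sq_integrable_AE_Om: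
  assumes "sq_integrable Om f" "AE x in Om. f x = g x"
  shows "sq_integrable Om g" "l2norm Om g = l2norm Om f"
proof -
  have g: "g \<in> borel_measurable Om"
    using measurable_AE_Om[OF _ assms(2)] assms(1) by (simp add: sq_integrable_def)
  moreover have "AE x in Om. (f x)\<^sup>2 = (g x)\<^sup>2" using assms(2) by eventually_elim simp
  ultimately show "sq_integrable Om g"
    using integrable_AE_Om(1)[of "\<lambda>x. (f x)\<^sup>2" "\<lambda>x. (g x)\<^sup>2"] assms(1)
    unfolding sq_integrable_def by blast
  show "l2norm Om g = l2norm Om f"
  proof (rule l2norm_cong_AE)
    show "AE x in Om. g x = f x" using assms(2) by eventually_elim simp
    show "f \<in> borel_measurable Om" using assms(1) by (rule sq_integrable_measurable)
  qed (rule g)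
qed

lemma AE_Om_neq: "AE x in Om. x \<noteq> s"
proof -
  have "AE x in lebesgue. x \<noteq> s"
    using AE_completion[OF AE_lborel_singleton[of s]] .
  then show ?thesis by (subst AE_restrict_space_iff) auto
qed

lemma integral_Om_indicator:
  assumes "0 \<le> s" "s \<le> t" "t \<le> 1"
  shows "(LINT x|Om. indicator {s<..<t} x) = t - s"
proof -
  have "emeasure Om {s<..<t} = ennreal (t - s)"
    using assms by (subst emeasure_Om) auto
  moreover have "{s<..<t} \<in> sets Om"
    using assms by (auto simp: sets_restrict_space_iff)
  moreover have "integral\<^sup>L Om (indicator {s<..<t}) = measure Om ({s<..<t} \<inter> space Om)"
    by (rule Bochner_Integration.integral_indicator)
  moreover have "{s<..<t} \<inter> space Om = {s<..<t}" using assms by auto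
  ultimately show ?thesis using assms by (simp add: measure_def)
qed

lemma measure_Om: "measure Om Omega = 1"
proof -
  have "emeasure Om Omega = ennreal 1" by (subst emeasure_Om) auto
  then show ?thesis by (simp add: measure_def)
qed

lemma integral_Om_const [simp]: "(LINT x|Om. c) = (c::real)"
  using measure_Om by simp

lemma integrable_indicator_mult_Om:
  assumes "integrable Om g" "A \<in> sets borel"
  shows "integrable Om (\<lambda>x. indicator A x * g x :: real)"
proof (rule Bochner_Integration.integrable_bound[OF assms(1)])
  show "(\<lambda>x. indicator A x * g x) \<in> borel_measurable Om"
    using assms by measurable
qed (auto simp: indicator_def)

lemma sq_integrable_indicator_mult_Om:
  assumes "sq_integrable Om g" "A \<in> sets borel"
  shows "sq_integrable Om (\<lambda>x. indicator A x * g x :: real)"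
  by (rule sq_integrable_bounded_mult(1)[where B = 1]) (use assms in \<open>auto simp: indicator_def\<close>)

lemma l2norm_Om_const: "l2norm Om (\<lambda>x. c) = \<bar>c\<bar>"
  unfolding l2norm_def integral_Om_const by simp

lemma abs_integral_le_l2norm_Om:
  assumes "sq_integrable Om g"
  shows "(LINT x|Om. \<bar>g x\<bar>) \<le> l2norm Om g"
proof -
  have "sq_integrable Om (\<lambda>x. \<bar>g x\<bar>)"
    using assms by (auto simp: sq_integrable_def intro!: borel_measurable_abs)
  from Cauchy_Schwarz_LINT[OF this Om.sq_integrable_const[of 1]]
  show ?thesis by (simp add: l2norm_Om_const del: integral_Om_const) (simp add: l2norm_def)
qed

text \<open>The primitive of an integrable function on \<open>(0, 1)\<close> that vanishes at \<open>0\<close>. For arguments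
  beyond \<open>1\<close> it is constant.\<close>

definition Prim :: "(real \<Rightarrow> real) \<Rightarrow> real \<Rightarrow> real"
  where "Prim g x = (LINT t|Om. indicator {..x} t * g t)"

lemma Prim_eq_integral:
  assumes "integrable Om g" "0 \<le> x" "x \<le> 1"
  shows "Prim g x = integral {0..x} g"
proof -
  have "Prim g x = integral Omega (\<lambda>t. indicator {..x} t * g t)"
    unfolding Prim_def by (intro lebesgue_integral_eq_integral integrable_indicator_mult_Om assms) auto
  also have "\<dots> = integral UNIV (\<lambda>t. if t \<in> Omega then indicator {..x} t * g t else 0)"
    by (rule integral_restrict_UNIV[symmetric])
  also have "\<dots> = integral UNIV (\<lambda>t. if t \<in> {0..x} then g t else 0)"
    by (rule integral_spike[of "{0, 1}"]) (use assms in \<open>auto simp: indicator_def\<close>)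
  also have "\<dots> = integral {0..x} g"
    by (rule integral_restrict_UNIV)
  finally show ?thesis .
qed

lemma Prim_diff_eq:
  assumes "integrable Om g" "s \<le> t"
  shows "Prim g t - Prim g s = (LINT x|Om. indicator {s<..t} x * g x)"
proof -
  have "Prim g t - Prim g s = (LINT x|Om. indicator {..t} x * g x - indicator {..s} x * g x)"
    unfolding Prim_def
    by (intro Bochner_Integration.integral_diff[symmetric] integrable_indicator_mult_Om assms) auto
  also have "\<dots> = (LINT x|Om. indicator {s<..t} x * g x)"
    by (intro Bochner_Integration.integral_cong) (use assms in \<open>auto simp: indicator_def\<close>)
  finally show ?thesis .
qed

lemma Prim_diff_eq_open:
  assumes "integrable Om g" "s \<le> t"
  shows "Prim g t - Prim g s = (LINT x|Om. indicator {s<..<t} x * g x)"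
  unfolding Prim_diff_eq[OF assms]
proof (rule integral_cong_AE)
  show "AE x in Om. indicator {s<..t} x * g x = indicator {s<..<t} x * g x"
    using AE_Om_neq[of t] by eventually_elim (auto simp: indicator_def)
qed (use assms(1) in measurable)

lemma Prim_0 [simp]: "Prim g 0 = 0"
  unfolding Prim_def by (subst Bochner_Integration.integral_cong[OF refl, of _ _ "\<lambda>x. 0"]) auto

lemma Prim_1: "Prim g 1 = integral\<^sup>L Om g"
  unfolding Prim_def by (intro Bochner_Integration.integral_cong) auto

lemma abs_Prim_le:
  assumes "integrable Om g"
  shows "\<bar>Prim g x\<bar> \<le> (LINT t|Om. \<bar>g t\<bar>)"
proof -
  have "\<bar>Prim g x\<bar> \<le> (LINT t|Om. \<bar>indicator {..x} t * g t\<bar>)"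
    unfolding Prim_def by (rule integral_abs_bound)
  also have "\<dots> \<le> (LINT t|Om. \<bar>g t\<bar>)"
    by (intro integral_mono integrable_abs integrable_indicator_mult_Om assms) (auto simp: indicator_def)
  finally show ?thesis .
qed

lemma Prim_add:
  assumes "integrable Om f" "integrable Om g"
  shows "Prim (\<lambda>x. f x + g x) x = Prim f x + Prim g x"
  unfolding Prim_def using integrable_indicator_mult_Om[OF assms(1)] integrable_indicator_mult_Om[OF assms(2)]
  by (simp add: distrib_left)

lemma Prim_cmult: "Prim (\<lambda>x. c * f x) x = c * Prim f x"
  unfolding Prim_def by (simp add: mult.left_commute)

lemma Prim_diff:
  assumes "integrable Om f" "integrable Om g"
  shows "Prim (\<lambda>x. f x - g x) x = Prim f x - Prim g x"
  using Prim_add[of f "\<lambda>x. (-1) * g x" x] Prim_cmult[of "-1" g x] assms by simp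

lemma continuous_Prim:
  assumes "integrable Om g"
  shows "continuous_on S (Prim g)"
proof (rule continuous_at_imp_continuous_on, rule ballI)
  fix x
  show "isCont (Prim g) x"
    unfolding continuous_at_sequentially comp_def
  proof (intro allI impI)
    fix X assume X: "X \<longlonglongrightarrow> x"
    show "(\<lambda>n. Prim g (X n)) \<longlonglongrightarrow> Prim g x"
      unfolding Prim_def
    proof (rule integral_dominated_convergence)
      show "integrable Om (\<lambda>t. \<bar>g t\<bar>)" using assms by simp
      show "AE t in Om. (\<lambda>n. indicator {..X n} t * g t) \<longlonglongrightarrow> indicator {..x} t * g t"
        using AE_Om_neq[of x]
      proof eventually_elim
        case (elim t)
        have "\<forall>\<^sub>F n in sequentially. indicator {..x} t * g t = indicator {..X n} t * g t"
        proof (cases "t < x")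
          case True
          show ?thesis
            using order_tendstoD(1)[OF X True] by eventually_elim (use True in \<open>auto simp: indicator_def\<close>)
        next
          case False
          with elim have less: "x < t" by simp
          show ?thesis
            using order_tendstoD(2)[OF X less] by eventually_elim (use less in \<open>auto simp: indicator_def\<close>)
        qed
        then show ?case by (rule Lim_transform_eventually[OF tendsto_const])
      qed
      show "(\<lambda>t. indicator {..x} t * g t) \<in> borel_measurable Om"
        "(\<lambda>t. indicator {..X n} t * g t) \<in> borel_measurable Om" for n
        using integrable_indicator_mult_Om[OF assms] by auto
    qed (auto simp: indicator_def)
  qed
qed

lemma measurable_Prim: "integrable Om g \<Longrightarrow> Prim g \<in> borel_measurable Om"
  by (intro continuous_measurable_Om continuous_Prim)

text \<open>Integration by parts, by Fubini's theorem.\<close>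

lemma integration_by_parts_Prim:
  assumes g: "integrable Om g" and h: "integrable Om h"
  shows "integrable Om (\<lambda>x. g x * Prim h x)" "integrable Om (\<lambda>x. Prim g x * h x)"
    "(LINT x|Om. g x * Prim h x) + (LINT x|Om. Prim g x * h x) = integral\<^sup>L Om g * integral\<^sup>L Om h"
proof -
  have 1: "integrable Om (\<lambda>x. g x * Prim h x)" if "integrable Om g" "integrable Om h" for g h
  proof (rule Bochner_Integration.integrable_bound)
    show "integrable Om (\<lambda>x. (LINT t|Om. \<bar>h t\<bar>) * g x)" using that by simp
    show "(\<lambda>x. g x * Prim h x) \<in> borel_measurable Om" using that measurable_Prim[of h] by measurable
    show "AE x in Om. norm (g x * Prim h x) \<le> norm ((LINT t|Om. \<bar>h t\<bar>) * g x)"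
      using abs_Prim_le[OF that(2)] by (auto simp: abs_mult mult.commute intro!: mult_left_mono)
  qed
  show gh: "integrable Om (\<lambda>x. g x * Prim h x)" by (rule 1[OF g h])
  show hg: "integrable Om (\<lambda>x. Prim g x * h x)" using 1[OF h g] by (simp add: mult.commute)
  interpret P: pair_sigma_finite Om Om ..
  have [measurable]: "g \<in> borel_measurable Om" "h \<in> borel_measurable Om" using g h by auto
  \<comment> \<open>The part of \<open>g(x) h(t)\<close> above the diagonal, integrated in both orders.\<close>
  define k where "k x t = indicator {x<..} t * g x * h t" for x t :: real
  have k_meas: "case_prod k \<in> borel_measurable (Om \<Otimes>\<^sub>M Om)"
  proof -
    have "case_prod k = (\<lambda>z. (if fst z < snd z then 1 else 0) * g (fst z) * h (snd z))"
      by (auto simp: k_def indicator_def)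
    also have "\<dots> \<in> borel_measurable (Om \<Otimes>\<^sub>M Om)" by measurable
    finally show ?thesis .
  qed
  have k_int: "integrable (Om \<Otimes>\<^sub>M Om) (case_prod k)"
  proof (rule Bochner_Integration.integrable_bound[OF _ k_meas])
    show "integrable (Om \<Otimes>\<^sub>M Om) (\<lambda>z. g (fst z) * h (snd z))"
    proof (rule P.Fubini_integrable)
      have "integrable Om (\<lambda>x. \<bar>g x\<bar> * (LINT t|Om. \<bar>h t\<bar>))" using g by simp
      then show "integrable Om (\<lambda>x. LINT y|Om. norm (g (fst (x, y)) * h (snd (x, y))))"
        by (simp add: abs_mult)
    qed (use h in auto)
    show "AE z in Om \<Otimes>\<^sub>M Om. norm (case_prod k z) \<le> norm (g (fst z) * h (snd z))"
      by (auto simp: k_def indicator_def)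
  qed
  have fub: "(LINT t|Om. LINT x|Om. k x t) = (LINT x|Om. LINT t|Om. k x t)"
    by (rule P.Fubini_integral[OF k_int])
  have "(LINT x|Om. k x t) = Prim g t * h t" if "t \<in> Omega" for t
  proof -
    have "(LINT x|Om. k x t) = (LINT x|Om. (indicator {..t} x * g x) * h t)"
    proof (rule integral_cong_AE)
      show "AE x in Om. k x t = (indicator {..t} x * g x) * h t"
        using AE_Om_neq[of t] by eventually_elim (auto simp: k_def indicator_def)
      show "(\<lambda>x. k x t) \<in> borel_measurable Om"
      proof -
        have "(\<lambda>x. k x t) = (\<lambda>x. (if x < t then 1 else 0) * g x * h t)"
          by (auto simp: k_def indicator_def)
        also have "\<dots> \<in> borel_measurable Om" by measurable
        finally show ?thesis .
      qed
    qed measurable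
    also have "\<dots> = Prim g t * h t"
      using integrable_indicator_mult_Om[OF g] by (simp add: Prim_def)
    finally show ?thesis .
  qed
  then have L: "(LINT t|Om. LINT x|Om. k x t) = (LINT x|Om. Prim g x * h x)"
    by (intro Bochner_Integration.integral_cong) auto
  have "(LINT t|Om. k x t) = g x * integral\<^sup>L Om h - g x * Prim h x" for x
  proof -
    have "(LINT t|Om. k x t) = (LINT t|Om. g x * h t - g x * (indicator {..x} t * h t))"
      by (intro Bochner_Integration.integral_cong) (auto simp: k_def indicator_def)
    also have "\<dots> = g x * integral\<^sup>L Om h - g x * Prim h x"
      using integrable_indicator_mult_Om[OF h, of "{..x}"] h by (simp add: Prim_def)
    finally show ?thesis .
  qed
  then have "(LINT x|Om. LINT t|Om. k x t) = integral\<^sup>L Om g * integral\<^sup>L Om h - (LINT x|Om. g x * Prim h x)"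
    using g gh by simp
  with L fub show "(LINT x|Om. g x * Prim h x) + (LINT x|Om. Prim g x * h x) = integral\<^sup>L Om g * integral\<^sup>L Om h"
    by simp
qed

text \<open>Applied to \<open>g\<close> and \<open>h\<close> cut off at \<open>x\<close>, integration by parts is the product rule.\<close>

lemma Prim_mult_Prim:
  assumes g: "integrable Om g" and h: "integrable Om h"
  shows "Prim (\<lambda>t. g t * Prim h t + Prim g t * h t) x = Prim g x * Prim h x"
proof -
  define gx hx where "gx t = indicator {..x} t * g t" and "hx t = indicator {..x} t * h t" for t
  have i: "integrable Om gx" "integrable Om hx"
    unfolding gx_def hx_def by (intro integrable_indicator_mult_Om g h; simp)+
  have eq: "Prim gx t = Prim g t" "Prim hx t = Prim h t" if "t \<le> x" for t
    unfolding Prim_def gx_def hx_def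
    by (intro Bochner_Integration.integral_cong; use that in \<open>auto simp: indicator_def\<close>)+
  have "Prim (\<lambda>t. g t * Prim h t + Prim g t * h t) x = (LINT t|Om. gx t * Prim hx t + Prim gx t * hx t)"
    unfolding Prim_def[of _ x]
    by (intro Bochner_Integration.integral_cong) (auto simp: gx_def hx_def eq indicator_def)
  also have "\<dots> = integral\<^sup>L Om gx * integral\<^sup>L Om hx"
    using integration_by_parts_Prim[OF i] by simp
  finally show ?thesis unfolding gx_def hx_def Prim_def .
qed

text \<open>The Poincare inequality.\<close>

lemma Prim_sq_integrable:
  assumes "sq_integrable Om g"
  shows "\<bar>Prim g x\<bar> \<le> l2norm Om g" "sq_integrable Om (Prim g)" "l2norm Om (Prim g) \<le> l2norm Om g"
proof -
  have i: "integrable Om g" by (rule Om.sq_integrable_imp_integrable[OF assms])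
  show *: "\<bar>Prim g x\<bar> \<le> l2norm Om g" for x
    using abs_Prim_le[OF i] abs_integral_le_l2norm_Om[OF assms] by (rule order_trans)
  have "AE x in Om. \<bar>Prim g x\<bar> \<le> 1 * \<bar>l2norm Om g\<bar>" using * by simp
  from sq_integrable_mono[OF Om.sq_integrable_const measurable_Prim[OF i] this]
  show "sq_integrable Om (Prim g)" "l2norm Om (Prim g) \<le> l2norm Om g"
    by (simp_all add: l2norm_Om_const)
qed

section \<open>Weak derivatives and primitives\<close>

lemma integrable_lebesgue_on_iff:
  "S \<in> sets lebesgue \<Longrightarrow> integrable (lebesgue_on S) f \<longleftrightarrow> integrable lebesgue (\<lambda>x. indicator S x *\<^sub>R f x)"
  for f :: "real \<Rightarrow> real"
  by (rule integrable_restrict_space) simp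

lemma integrable_imp_locally_integrable:
  assumes "integrable Om v"
  shows "locally_integrable v"
  unfolding locally_integrable_def
proof (intro allI impI)
  fix K :: "real set" assume K: "compact K" "K \<subseteq> Omega"
  then have KS: "K \<in> sets borel" by (simp add: borel_compact)
  have "integrable lebesgue (\<lambda>x. indicator Omega x *\<^sub>R v x)"
    using assms by (subst (asm) integrable_lebesgue_on_iff) auto
  then have "integrable lebesgue (\<lambda>x. indicator K x *\<^sub>R (indicator Omega x *\<^sub>R v x))"
    by (rule integrable_mult_indicator[rotated]) (use KS in auto)
  also have "(\<lambda>x. indicator K x *\<^sub>R (indicator Omega x *\<^sub>R v x)) = (\<lambda>x. indicator K x *\<^sub>R v x)"
    using K(2) by (auto simp: indicator_def fun_eq_iff)
  finally show "integrable (lebesgue_on K) v"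
    by (subst integrable_lebesgue_on_iff) (use KS in auto)
qed

lemma locally_integrable_indicator:
  assumes "locally_integrable v" "0 < p" "q < 1"
  shows "integrable Om (\<lambda>x. indicator {p..q} x * v x)"
proof -
  have "integrable (lebesgue_on {p..q}) v"
    using assms unfolding locally_integrable_def by (auto simp: subset_eq)
  then have "integrable lebesgue (\<lambda>x. indicator {p..q} x *\<^sub>R v x)"
    by (subst (asm) integrable_lebesgue_on_iff) auto
  also have "(\<lambda>x. indicator {p..q} x *\<^sub>R v x) = (\<lambda>x. indicator Omega x *\<^sub>R (indicator {p..q} x * v x))"
    using assms by (auto simp: indicator_def fun_eq_iff)
  finally show ?thesis
    by (subst integrable_lebesgue_on_iff) auto
qed

lemma locally_integrable_test:
  assumes "locally_integrable v" "\<phi> \<in> test_functions"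
  shows "integrable Om (\<lambda>x. v x * \<phi> x)"
proof -
  obtain p q where pq: "0 < p" "q < 1" "\<And>x. x \<notin> {p..q} \<Longrightarrow> \<phi> x = 0"
    using assms(2) unfolding test_functions_iff by metis
  obtain B where B: "B > 0" "\<And>x. \<bar>\<phi> x\<bar> \<le> B" using test_bound[OF assms(2)] by blast
  have i: "integrable Om (\<lambda>x. indicator {p..q} x * v x)"
    by (rule locally_integrable_indicator[OF assms(1) pq(1,2)])
  have \<phi>: "\<phi> \<in> borel_measurable Om"
    by (intro continuous_measurable_Om smooth_continuous_on test_smooth assms)
  have eq: "v x * \<phi> x = (indicator {p..q} x * v x) * \<phi> x" for x
    using pq(3)[of x] by (auto simp: indicator_def)
  show ?thesis
  proof (rule Bochner_Integration.integrable_bound)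
    show "integrable Om (\<lambda>x. B * (indicator {p..q} x * v x))" using i by simp
    show "(\<lambda>x. v x * \<phi> x) \<in> borel_measurable Om"
      unfolding eq using borel_measurable_times[OF borel_measurable_integrable[OF i] \<phi>] .
    show "AE x in Om. norm (v x * \<phi> x) \<le> norm (B * (indicator {p..q} x * v x))"
      unfolding eq using B by (auto simp: abs_mult mult.commute intro!: mult_right_mono)
  qed
qed

lemma locally_integrable_measurable:
  assumes "locally_integrable v"
  shows "v \<in> borel_measurable Om"
proof (rule borel_measurable_LIMSEQ_real)
  fix x assume "x \<in> space Om"
  then have x: "0 < x" "x < 1" by auto
  have "(\<lambda>n. inverse (real (Suc n))) \<longlonglongrightarrow> 0" by (rule LIMSEQ_inverse_real_of_nat)
  then have "\<forall>\<^sub>F n in sequentially. inverse (real (Suc n)) < min x (1 - x)"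
    using x by (intro order_tendstoD) auto
  then have "\<forall>\<^sub>F n in sequentially.
      v x = indicator {inverse (real (Suc n))..1 - inverse (real (Suc n))} x * v x"
    by eventually_elim (auto simp: indicator_def)
  then show "(\<lambda>n. indicator {inverse (real (Suc n))..1 - inverse (real (Suc n))} x * v x) \<longlonglongrightarrow> v x"
    by (rule Lim_transform_eventually[OF tendsto_const])
next
  fix n
  have "integrable Om (\<lambda>x. indicator {inverse (real (Suc n))..1 - inverse (real (Suc n))} x * v x)"
    by (rule locally_integrable_indicator[OF assms]) auto
  then show "(\<lambda>x. indicator {inverse (real (Suc n))..1 - inverse (real (Suc n))} x * v x) \<in> borel_measurable Om"
    by auto
qed

lemma locally_integrable_diff:
  assumes "locally_integrable f" "locally_integrable g"
  shows "locally_integrable (\<lambda>x. f x - g x)"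
  using assms unfolding locally_integrable_def by auto

subsection \<open>The fundamental lemma of the calculus of variations\<close>

lemma integral_cutoff_tendsto:
  assumes i: "integrable Om (\<lambda>x. indicator {p..q} x * f x)" and f: "f \<in> borel_measurable Om"
  shows "(\<lambda>n. LINT x|Om. f x * cutoff p q n x) \<longlonglongrightarrow> (LINT x|Om. indicator {p<..<q} x * f x)"
proof (rule integral_dominated_convergence)
  show "integrable Om (\<lambda>x. \<bar>indicator {p..q} x * f x\<bar>)" using i by (rule integrable_abs)
  show "(\<lambda>x. indicator {p<..<q} x * f x) \<in> borel_measurable Om" using f by measurable
  show "(\<lambda>x. f x * cutoff p q n x) \<in> borel_measurable Om" for n
    using f continuous_measurable_Om[OF smooth_continuous_on[OF smooth_cutoff]] by measurable
  show "AE x in Om. (\<lambda>n. f x * cutoff p q n x) \<longlonglongrightarrow> indicator {p<..<q} x * f x"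
    using tendsto_mult[OF tendsto_const cutoff_tendsto] by (simp add: mult.commute)
  show "AE x in Om. norm (f x * cutoff p q n x) \<le> \<bar>indicator {p..q} x * f x\<bar>" for n
  proof (rule AE_I2)
    fix x
    show "norm (f x * cutoff p q n x) \<le> \<bar>indicator {p..q} x * f x\<bar>"
    proof (cases "x \<in> {p..q}")
      case True
      then show ?thesis
        using cutoff_bounds[of p q n x] by (auto simp: abs_mult intro!: mult_left_le)
    next
      case False
      have "p \<le> p + 1 / real n" "q - 1 / real n \<le> q" by simp_all
      with False have "x \<notin> {p + 1 / real n..q - 1 / real n}"
        unfolding atLeastAtMost_iff by linarith
      then show ?thesis using cutoff_eq_0 by simp
    qed
  qed
qed

text \<open>The Borel sets over which \<open>g\<close> integrates to zero form a Dynkin system that contains the half lines;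
  a Lebesgue measurable set differs from a Borel set by a null set.\<close>

lemma Prim_eq_0_imp_AE:
  assumes g: "integrable Om g" and 0: "\<And>x. Prim g x = 0"
  shows "AE x in Om. g x = 0"
proof -
  have borel: "(LINT x|Om. indicator A x * g x) = 0" if "A \<in> sets borel" for A
  proof -
    let ?E = "range (\<lambda>a::real. {..a})"
    have "Int_stable ?E" by (auto simp: Int_stable_def)
    moreover have "?E \<subseteq> Pow UNIV" by simp
    moreover have "A \<in> sigma_sets UNIV ?E"
      using that by (simp add: borel_eq_atMost)
    ultimately show ?thesis
    proof (induction rule: sigma_sets_induct_disjoint)
      case (basic A)
      then show ?case using 0 by (auto simp: Prim_def)
    next
      case (compl A)
      then have A: "A \<in> sets borel" by (simp add: borel_eq_atMost)
      have "(LINT x|Om. indicator (UNIV - A) x * g x) = (LINT x|Om. g x - indicator A x * g x)"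
        by (intro Bochner_Integration.integral_cong) (auto simp: indicator_def)
      also have "\<dots> = 0"
        using compl(2) 0[of 1] integrable_indicator_mult_Om[OF g A] g by (simp add: Prim_1)
      finally show ?case .
    next
      case (union A)
      then have A: "range A \<subseteq> sets borel" by (auto simp: borel_eq_atMost)
      have Am: "A i \<inter> Omega \<in> sets Om" for i
        using A by (auto simp: sets_restrict_space_iff)
      have eq: "set_lebesgue_integral Om (B \<inter> Omega) g = (LINT x|Om. indicator B x * g x)" for B
        unfolding set_lebesgue_integral_def
        by (intro Bochner_Integration.integral_cong) (auto simp: indicator_def)
      have "set_lebesgue_integral Om (\<Union>i. A i \<inter> Omega) g = (\<Sum>i. set_lebesgue_integral Om (A i \<inter> Omega) g)"
      proof (rule lebesgue_integral_countable_add)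
        show "A i \<inter> Omega \<inter> (A j \<inter> Omega) = {}" if "i \<noteq> j" for i j
          using union(1) that by (auto simp: disjoint_family_on_def)
        show "set_integrable Om (\<Union>i. A i \<inter> Omega) g"
          unfolding set_integrable_def
          by (intro integrable_mult_indicator sets.countable_UN g) (use Am in blast)
      qed (rule Am)
      then have "(LINT x|Om. indicator (\<Union>i. A i) x * g x) = (\<Sum>i. LINT x|Om. indicator (A i) x * g x)"
        by (simp add: eq flip: Int_UN_distrib2 UN_extend_simps(4))
      also have "\<dots> = 0" using union(3) by simp
      finally show ?case by simp
    qed simp
  qed
  show ?thesis
  proof (rule Om.density_zero[OF g])
    fix A assume "A \<in> sets Om"
    then have "A \<in> sets lebesgue" by (auto simp: sets_restrict_space_iff)
    then obtain S N N' where S: "A = S \<union> N" "N \<subseteq> N'" "N' \<in> null_sets lborel" "S \<in> sets lborel"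
      by (elim sets_completionE)
    have "AE x in lebesgue. x \<notin> N'" using S(3) by (intro AE_completion AE_not_in)
    then have "AE x in Om. x \<notin> N'" by (subst AE_restrict_space_iff) auto
    then have "AE x in Om. indicator S x * g x = indicator A x *\<^sub>R g x"
      by eventually_elim (use S in \<open>auto simp: indicator_def\<close>)
    then have "(LINT x|Om. indicator A x *\<^sub>R g x) = (LINT x|Om. indicator S x * g x)"
      by (intro integrable_AE_Om(2) integrable_indicator_mult_Om g) (use S in auto)
    also have "\<dots> = 0" using S borel by simp
    finally show "set_lebesgue_integral Om A g = 0" by (simp add: set_lebesgue_integral_def)
  qed
qed

text \<open>Testing with cutoff functions shows that the integrals of \<open>g\<close> over all intervals vanish.\<close>

lemma fundamental_lemma:
  assumes g: "locally_integrable g" and 0: "\<And>\<phi>. \<phi> \<in> test_functions \<Longrightarrow> (LINT x|Om. g x * \<phi> x) = 0"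
  shows "AE x in Om. g x = 0"
proof -
  have *: "(LINT x|Om. indicator {p<..<q} x * g x) = 0" if "0 < p" "q < 1" for p q
  proof -
    have "(\<lambda>x. g x * cutoff p q n x) = (\<lambda>x. g x * (1 * cutoff p q n x))" for n by simp
    then have "(LINT x|Om. g x * cutoff p q n x) = 0" for n
      using 0[OF test_cutoff_mult[OF smooth_const[of 1], of p q n]] that by simp
    moreover have "(\<lambda>n. LINT x|Om. g x * cutoff p q n x) \<longlonglongrightarrow> (LINT x|Om. indicator {p<..<q} x * g x)"
      using that by (intro integral_cutoff_tendsto locally_integrable_indicator
          locally_integrable_measurable g)
    ultimately show ?thesis by (simp add: LIMSEQ_const_iff)
  qed
  have "AE x in Om. indicator {p<..<q} x * g x = 0" if pq: "0 < p" "q < 1" for p q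
  proof (rule Prim_eq_0_imp_AE)
    have "integrable Om (\<lambda>x. indicator {p<..<q} x * (indicator {p..q} x * g x))"
      by (intro integrable_indicator_mult_Om locally_integrable_indicator pq g) auto
    also have "(\<lambda>x. indicator {p<..<q} x * (indicator {p..q} x * g x)) = (\<lambda>x. indicator {p<..<q} x * g x)"
      by (auto simp: indicator_def)
    finally show i: "integrable Om (\<lambda>x. indicator {p<..<q} x * g x)" .
    fix x
    have "Prim (\<lambda>x. indicator {p<..<q} x * g x) x = (LINT t|Om. indicator {p<..<min q x} t * g t)"
      unfolding Prim_def
    proof (rule integrable_AE_Om(2)[symmetric])
      show "integrable Om (\<lambda>t. indicator {..x} t * (indicator {p<..<q} t * g t))"
        by (intro integrable_indicator_mult_Om i) auto
      show "AE t in Om. indicator {..x} t * (indicator {p<..<q} t * g t) = indicator {p<..<min q x} t * g t"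
        using AE_Om_neq[of x] by eventually_elim (auto simp: indicator_def)
    qed
    also have "\<dots> = 0" using * pq by simp
    finally show "Prim (\<lambda>x. indicator {p<..<q} x * g x) x = 0" .
  qed
  then have "AE x in Om. \<forall>n. indicator {inverse (real (Suc n))<..<1 - inverse (real (Suc n))} x * g x = 0"
    unfolding AE_all_countable by simp
  with AE_space[of Om] show ?thesis
  proof eventually_elim
    case (elim x)
    then have x: "0 < x" "x < 1" by auto
    obtain n where "inverse (real (Suc n)) < min x (1 - x)"
      using reals_Archimedean[of "min x (1 - x)"] x by auto
    then have "x \<in> {inverse (real (Suc n))<..<1 - inverse (real (Suc n))}" by auto
    with elim show ?case by (metis indicator_simps(1) mult_1)
  qed
qed

subsection \<open>Test functions and their primitives\<close>

lemma test_sq_integrable: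
  assumes "\<phi> \<in> test_functions"
  shows "sq_integrable Om \<phi>"
proof -
  obtain B where B: "\<And>x. \<bar>\<phi> x\<bar> \<le> B" using test_bound[OF assms] by blast
  have "\<phi> \<in> borel_measurable Om"
    by (intro continuous_measurable_Om smooth_continuous_on test_smooth assms)
  then show ?thesis
    using B by (intro sq_integrable_mono(1)[OF Om.sq_integrable_const[of 1], where B = B]) auto
qed

lemma test_integrable: "\<phi> \<in> test_functions \<Longrightarrow> integrable Om \<phi>"
  by (intro Om.sq_integrable_imp_integrable test_sq_integrable)

lemma Prim_deriv_test:
  assumes "\<phi> \<in> test_functions" "x \<in> {0..1}"
  shows "Prim (deriv \<phi>) x = \<phi> x"
proof -
  have 0: "\<phi> 0 = 0" using assms(1) unfolding test_functions_iff by force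
  have "(deriv \<phi> has_integral (\<phi> x - \<phi> 0)) {0..x}"
    using assms by (intro fundamental_theorem_of_calculus)
      (auto intro!: has_field_derivative_at_within smooth_has_deriv test_smooth
        simp flip: has_real_derivative_iff_has_vector_derivative)
  then show ?thesis
    using assms 0 by (subst Prim_eq_integral) (auto intro: test_integrable test_deriv)
qed

lemma integral_deriv_test:
  assumes "\<phi> \<in> test_functions"
  shows "integral\<^sup>L Om (deriv \<phi>) = 0"
proof -
  have "\<phi> 1 = 0" using assms unfolding test_functions_iff by force
  then show ?thesis using Prim_deriv_test[OF assms, of 1] by (simp add: Prim_1)
qed

lemma test_primitive:
  assumes \<psi>: "\<psi> \<in> test_functions" and 0: "integral\<^sup>L Om \<psi> = 0"
  shows "Prim \<psi> \<in> test_functions" "deriv (Prim \<psi>) = \<psi>"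
proof -
  obtain p q where pq: "0 < p" "p \<le> q" "q < 1" "\<And>x. x \<notin> {p..q} \<Longrightarrow> \<psi> x = 0"
    using \<psi> unfolding test_functions_iff by metis
  have l: "Prim \<psi> x = 0" if "x < p" for x
    unfolding Prim_def using that pq(4)
    by (subst Bochner_Integration.integral_cong[OF refl, of _ _ "\<lambda>x. 0"]) (auto simp: indicator_def)
  have r: "Prim \<psi> x = 0" if "x > q" for x
  proof -
    have "Prim \<psi> x = integral\<^sup>L Om \<psi>"
      unfolding Prim_def using that pq(4) by (intro Bochner_Integration.integral_cong) (auto simp: indicator_def)
    then show ?thesis using 0 by simp
  qed
  have D: "(Prim \<psi> has_real_derivative \<psi> x) (at x)" for x
  proof -
    consider "x < p" | "x > q" | "0 < x" "x < 1" using pq by linarith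
    then show ?thesis
    proof cases
      case 1
      show ?thesis
        by (rule has_field_derivative_transform_within_open[where S = "{..<p}" and f = "\<lambda>x. 0"])
           (use 1 pq l in auto)
    next
      case 2
      show ?thesis
        by (rule has_field_derivative_transform_within_open[where S = "{q<..}" and f = "\<lambda>x. 0"])
           (use 2 pq r in auto)
    next
      case 3
      have "((\<lambda>x. integral {0..x} \<psi>) has_real_derivative \<psi> x) (at x within {0..1})"
        using 3 by (intro integral_has_real_derivative smooth_continuous_on test_smooth \<psi>) auto
      then have "((\<lambda>x. integral {0..x} \<psi>) has_real_derivative \<psi> x) (at x)"
        using 3 by (simp add: at_within_Icc_at)
      then show ?thesis
        by (rule has_field_derivative_transform_within_open[where S = "{0<..<1}"])
           (use 3 in \<open>auto simp: Prim_eq_integral test_integrable \<psi>\<close>)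
    qed
  qed
  then show "deriv (Prim \<psi>) = \<psi>" by (auto intro: DERIV_imp_deriv)
  have "smooth (Prim \<psi>)" by (rule smooth_antiderivative[OF D test_smooth[OF \<psi>]])
  then show "Prim \<psi> \<in> test_functions"
    unfolding test_functions_iff using pq l r by (metis atLeastAtMost_iff linorder_not_less)
qed

lemma test_unit_mass: "\<exists>\<beta>\<in>test_functions. integral\<^sup>L Om \<beta> = 1"
proof -
  have "(\<lambda>n. LINT x|Om. 1 * cutoff 0 1 n x) \<longlonglongrightarrow> (LINT x|Om. indicator {0<..<1} x * 1)"
    by (intro integral_cutoff_tendsto integrable_indicator_mult_Om) auto
  also have "(LINT x|Om. indicator {0<..<1} x * 1) = (1::real)"
    using integral_Om_indicator[of 0 1] by simp
  finally have "\<forall>\<^sub>F n in sequentially. (LINT x|Om. 1 * cutoff 0 1 n x) > 0"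
    by (rule order_tendstoD) simp
  then obtain n where n: "(LINT x|Om. cutoff 0 1 n x) > 0"
    by (auto dest: eventually_happens)
  define m where "m = (LINT x|Om. cutoff 0 1 n x)"
  have "(\<lambda>x. (1 / m) * cutoff 0 1 n x) \<in> test_functions"
    by (intro test_cutoff_mult smooth_const) auto
  moreover have "(LINT x|Om. (1 / m) * cutoff 0 1 n x) = 1"
    using n by (simp add: m_def)
  ultimately show ?thesis by blast
qed

subsection \<open>Functions with integrable weak derivative\<close>

lemma weak_deriv_unique:
  assumes "has_weak_deriv v g" "has_weak_deriv v h"
  shows "AE x in Om. g x = h x"
proof -
  have l: "locally_integrable g" "locally_integrable h"
    using assms by (auto simp: has_weak_deriv_def)
  have "AE x in Om. g x - h x = 0"
  proof (rule fundamental_lemma)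
    fix \<phi> assume \<phi>: "\<phi> \<in> test_functions"
    have "(LINT x|Om. (g x - h x) * \<phi> x) = (LINT x|Om. g x * \<phi> x - h x * \<phi> x)"
      by (simp add: left_diff_distrib)
    also have "\<dots> = 0"
      using assms \<phi> locally_integrable_test[OF l(1) \<phi>] locally_integrable_test[OF l(2) \<phi>]
      by (auto simp: has_weak_deriv_def)
    finally show "(LINT x|Om. (g x - h x) * \<phi> x) = 0" .
  qed (intro locally_integrable_diff l)
  then show ?thesis by eventually_elim simp
qed

lemma wderiv_has_weak_deriv: "weakly_differentiable v \<Longrightarrow> has_weak_deriv v (wderiv v)"
  unfolding weakly_differentiable_def wderiv_def
  by (erule exE) (rule someI[where P = "has_weak_deriv v"])

lemma has_weak_deriv_wderiv_AE: "has_weak_deriv v g \<Longrightarrow> AE x in Om. wderiv v x = g x"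
  by (rule weak_deriv_unique[OF wderiv_has_weak_deriv]) (auto simp: weakly_differentiable_def)

text \<open>Primitives of integrable functions are weakly differentiable.\<close>

lemma has_weak_deriv_Prim:
  assumes g: "integrable Om g" and v: "AE x in Om. v x = K + Prim g x"
  shows "has_weak_deriv v g"
  unfolding has_weak_deriv_def
proof (intro conjI ballI)
  have P: "integrable Om (Prim g)"
    using integration_by_parts_Prim(2)[OF g, of "\<lambda>x. 1"] by simp
  have i: "integrable Om (\<lambda>x. K + Prim g x)" using P by simp
  have v': "AE x in Om. K + Prim g x = v x" using v by eventually_elim simp
  show "locally_integrable v"
    by (rule integrable_imp_locally_integrable[OF integrable_AE_Om(1)[OF i v']])
  show "locally_integrable g" by (rule integrable_imp_locally_integrable[OF g])
  fix \<phi> assume \<phi>: "\<phi> \<in> test_functions"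
  have d: "integrable Om (deriv \<phi>)" by (intro test_integrable test_deriv \<phi>)
  have Pd: "integrable Om (\<lambda>x. Prim g x * deriv \<phi> x)"
    using integration_by_parts_Prim(2)[OF g d] .
  have "(LINT x|Om. v x * deriv \<phi> x) = (LINT x|Om. K * deriv \<phi> x + Prim g x * deriv \<phi> x)"
  proof (rule integrable_AE_Om(2))
    show "AE x in Om. K * deriv \<phi> x + Prim g x * deriv \<phi> x = v x * deriv \<phi> x"
      using v by eventually_elim (simp add: distrib_right)
  qed (use d Pd in simp)
  also have "\<dots> = (LINT x|Om. Prim g x * deriv \<phi> x)"
    using d Pd integral_deriv_test[OF \<phi>] by simp
  also have "\<dots> = - (LINT x|Om. g x * Prim (deriv \<phi>) x)"
    using integration_by_parts_Prim(3)[OF g d] integral_deriv_test[OF \<phi>] by simp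
  also have "(LINT x|Om. g x * Prim (deriv \<phi>) x) = (LINT x|Om. g x * \<phi> x)"
    by (intro Bochner_Integration.integral_cong) (auto simp: Prim_deriv_test \<phi>)
  finally show "(LINT x|Om. v x * deriv \<phi> x) = - (LINT x|Om. g x * \<phi> x)" .
qed

lemma has_weak_deriv_diff:
  assumes f: "has_weak_deriv v f" and g: "has_weak_deriv w g"
  shows "has_weak_deriv (\<lambda>x. v x - w x) (\<lambda>x. f x - g x)"
  unfolding has_weak_deriv_def
proof (intro conjI ballI)
  have l: "locally_integrable v" "locally_integrable f" "locally_integrable w" "locally_integrable g"
    using f g by (auto simp: has_weak_deriv_def)
  then show "locally_integrable (\<lambda>x. v x - w x)" "locally_integrable (\<lambda>x. f x - g x)"
    by (intro locally_integrable_diff; simp)+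
  fix \<phi> assume \<phi>: "\<phi> \<in> test_functions"
  note \<phi>' = test_deriv[OF \<phi>]
  show "(LINT x|Om. (v x - w x) * deriv \<phi> x) = - (LINT x|Om. (f x - g x) * \<phi> x)"
    using f g \<phi> l[THEN locally_integrable_test[OF _ \<phi>]] l[THEN locally_integrable_test[OF _ \<phi>']]
    by (simp add: left_diff_distrib has_weak_deriv_def)
qed

text \<open>The lemma of du Bois-Reymond: a test function \<open>\<phi>\<close> becomes the derivative of a test function after
  subtracting a multiple of a fixed \<open>\<beta>\<close> with integral \<open>1\<close>.\<close>

lemma du_Bois_Reymond:
  assumes D: "locally_integrable D"
    and 0: "\<And>\<phi>. \<phi> \<in> test_functions \<Longrightarrow> (LINT x|Om. D x * deriv \<phi> x) = 0"
  shows "\<exists>K. AE x in Om. D x = K"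
proof -
  obtain \<beta> where \<beta>: "\<beta> \<in> test_functions" "integral\<^sup>L Om \<beta> = 1" using test_unit_mass by blast
  define K where "K = (LINT x|Om. D x * \<beta> x)"
  have "AE x in Om. D x - K = 0"
  proof (rule fundamental_lemma)
    show "locally_integrable (\<lambda>x. D x - K)"
      by (intro locally_integrable_diff D integrable_imp_locally_integrable) auto
    fix \<phi> assume \<phi>: "\<phi> \<in> test_functions"
    define m where "m = integral\<^sup>L Om \<phi>"
    have t: "(\<lambda>x. \<phi> x - m * \<beta> x) \<in> test_functions" by (intro test_diff_cmult \<phi> \<beta>)
    have "integral\<^sup>L Om (\<lambda>x. \<phi> x - m * \<beta> x) = 0"
      using test_integrable[OF \<phi>] test_integrable[OF \<beta>(1)] \<beta>(2) by (simp add: m_def)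
    from test_primitive[OF t this] 0 have "(LINT x|Om. D x * (\<phi> x - m * \<beta> x)) = 0" by metis
    also have "(LINT x|Om. D x * (\<phi> x - m * \<beta> x)) = (LINT x|Om. D x * \<phi> x - m * (D x * \<beta> x))"
      by (simp add: right_diff_distrib mult.left_commute)
    also have "\<dots> = (LINT x|Om. D x * \<phi> x) - m * K"
      using locally_integrable_test[OF D \<phi>] locally_integrable_test[OF D \<beta>(1)] by (simp add: K_def)
    also have "\<dots> = (LINT x|Om. D x * \<phi> x - K * \<phi> x)"
      using locally_integrable_test[OF D \<phi>] test_integrable[OF \<phi>] by (simp add: m_def mult.commute)
    finally show "(LINT x|Om. (D x - K) * \<phi> x) = 0" by (simp add: left_diff_distrib)
  qed
  then show ?thesis by (intro exI[of _ K]) simp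
qed

text \<open>An integrable weak derivative provides an absolutely continuous representative.\<close>

lemma has_weak_deriv_imp_Prim:
  assumes v: "has_weak_deriv v g" and g: "integrable Om g"
  shows "\<exists>K. AE x in Om. v x = K + Prim g x"
proof -
  have "has_weak_deriv (Prim g) g"
    by (rule has_weak_deriv_Prim[OF g, of _ 0]) simp
  from has_weak_deriv_diff[OF v this]
  have "\<exists>K. AE x in Om. v x - Prim g x = K"
    by (intro du_Bois_Reymond) (auto simp: has_weak_deriv_def)
  then obtain K where "AE x in Om. v x - Prim g x = K" by blast
  then have "AE x in Om. v x = K + Prim g x" by eventually_elim simp
  then show ?thesis by blast
qed

lemma has_weak_deriv_test: "\<phi> \<in> test_functions \<Longrightarrow> has_weak_deriv \<phi> (deriv \<phi>)"
  by (rule has_weak_deriv_Prim[where K = 0])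
     (auto intro!: test_integrable test_deriv simp: Prim_deriv_test)

section \<open>Density of the test functions and the space \<open>H10_space\<close>\<close>

lemma powr_2_abs: "\<bar>y\<bar> powr 2 = y\<^sup>2" for y :: real
  by (cases "y = 0") auto

lemma Lp_space_2: "v \<in> Lp_space 2 \<longleftrightarrow> sq_integrable Om v"
  by (simp add: Lp_space_def sq_integrable_def powr_2_abs)

lemma Lp_norm_2: "Lp_norm 2 v = l2norm Om v"
  by (simp add: Lp_norm_def l2norm_def powr_2_abs powr_half_sqrt)

lemma l2norm_dominated_convergence:
  assumes w: "sq_integrable M w" and d: "\<And>n. d n \<in> borel_measurable M"
    and lim: "AE x in M. (\<lambda>n. d n x) \<longlonglongrightarrow> 0" and bd: "\<And>n. AE x in M. \<bar>d n x\<bar> \<le> w x"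
  shows "(\<lambda>n. l2norm M (d n)) \<longlonglongrightarrow> 0"
proof -
  have "(\<lambda>n. LINT x|M. (d n x)\<^sup>2) \<longlonglongrightarrow> (LINT x|M. 0)"
  proof (rule integral_dominated_convergence)
    show "integrable M (\<lambda>x. (w x)\<^sup>2)" using w by (simp add: sq_integrable_def)
    show "AE x in M. (\<lambda>n. (d n x)\<^sup>2) \<longlonglongrightarrow> 0"
      using lim by eventually_elim (use tendsto_power[of _ 0 sequentially 2] in simp)
    show "AE x in M. norm ((d n x)\<^sup>2) \<le> (w x)\<^sup>2" for n
      using bd[of n] by eventually_elim (auto simp: abs_le_square_iff[symmetric])
  qed (use d in \<open>auto intro: borel_measurable_power\<close>)
  then have "(\<lambda>n. sqrt (LINT x|M. (d n x)\<^sup>2)) \<longlonglongrightarrow> sqrt 0"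
    by (intro tendsto_real_sqrt) simp
  then show ?thesis by (simp add: l2norm_def)
qed

lemma l2norm_triangle_diff:
  assumes "sq_integrable M f" "sq_integrable M g" "sq_integrable M h"
  shows "l2norm M (\<lambda>x. f x - h x) \<le> l2norm M (\<lambda>x. f x - g x) + l2norm M (\<lambda>x. g x - h x)"
  using l2norm_triangle[OF sq_integrable_diff[OF assms(1,2)] sq_integrable_diff[OF assms(2,3)]] by simp

text \<open>Truncation of values to the interval \<open>[-k, k]\<close>.\<close>

definition clip :: "real \<Rightarrow> real \<Rightarrow> real"
  where "clip k y = max (- k) (min k y)"

lemma clip_bound: "0 \<le> k \<Longrightarrow> \<bar>clip k y\<bar> \<le> k"
  by (auto simp: clip_def)

lemma clip_id: "\<bar>y\<bar> \<le> k \<Longrightarrow> clip k y = y"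
  by (auto simp: clip_def)

lemma abs_diff_clip: "0 \<le> k \<Longrightarrow> \<bar>y - clip k y\<bar> \<le> \<bar>y\<bar>"
  by (auto simp: clip_def)

lemma continuous_on_clip: "continuous_on S f \<Longrightarrow> continuous_on S (\<lambda>x. clip k (f x))"
  for f :: "real \<Rightarrow> real"
  unfolding clip_def by (intro continuous_intros)

lemma measurable_clip [measurable]: "clip k \<in> borel_measurable borel"
  by (intro borel_measurable_continuous_onI continuous_on_clip continuous_on_id)

lemma continuous_sq_integrable_Om:
  assumes "continuous_on {0..1} f"
  shows "sq_integrable Om f"
proof -
  obtain B where B: "\<And>x. x \<in> {0..1} \<Longrightarrow> \<bar>f x\<bar> \<le> B"
    using compact_imp_bounded[OF compact_continuous_image[OF assms compact_Icc]]
    unfolding bounded_iff by (metis imageI real_norm_def)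
  have "f \<in> borel_measurable Om"
    by (intro continuous_measurable_Om continuous_on_subset[OF assms]) auto
  then show ?thesis
    using B by (intro sq_integrable_mono(1)[OF Om.sq_integrable_const[of 1], where B = B]) auto
qed

text \<open>After truncation, the function is bounded and almost everywhere the limit of continuous functions,
  which can be truncated to the same bound; dominated convergence applies.\<close>

lemma continuous_dense_L2:
  assumes g: "sq_integrable Om g" and e: "e > 0"
  shows "\<exists>f. continuous_on UNIV f \<and> l2norm Om (\<lambda>x. g x - f x) < e"
proof -
  have [measurable]: "g \<in> borel_measurable Om" using g by (rule sq_integrable_measurable)
  have "(\<lambda>n. l2norm Om (\<lambda>x. g x - clip (real n) (g x))) \<longlonglongrightarrow> 0"
  proof (rule l2norm_dominated_convergence)
    show "sq_integrable Om (\<lambda>x. \<bar>g x\<bar>)"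
      using g by (auto simp: sq_integrable_def intro!: borel_measurable_abs)
    show "AE x in Om. (\<lambda>n. g x - clip (real n) (g x)) \<longlonglongrightarrow> 0"
    proof (rule AE_I2)
      fix x
      have "\<forall>\<^sub>F n in sequentially. 0 = g x - clip (real n) (g x)"
        using eventually_ge_at_top[of "nat \<lceil>\<bar>g x\<bar>\<rceil>"]
        by eventually_elim (simp add: clip_id nat_le_iff ceiling_le_iff)
      then show "(\<lambda>n. g x - clip (real n) (g x)) \<longlonglongrightarrow> 0"
        by (rule Lim_transform_eventually[OF tendsto_const])
    qed
  qed (auto simp: abs_diff_clip)
  then have "\<forall>\<^sub>F n in sequentially. l2norm Om (\<lambda>x. g x - clip (real n) (g x)) < e / 2"
    using e by (intro order_tendstoD) auto
  then obtain k :: nat where k: "l2norm Om (\<lambda>x. g x - clip (real k) (g x)) < e / 2"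
    by (auto dest: eventually_happens)
  define h where "h x = clip (real k) (g x)" for x
  have hm [measurable]: "h \<in> borel_measurable Om" unfolding h_def by measurable
  have hb: "\<bar>h x\<bar> \<le> real k" for x unfolding h_def by (rule clip_bound) simp
  have h: "sq_integrable Om h"
    using hb by (intro sq_integrable_mono(1)[OF Om.sq_integrable_const[of 1], where B = "real k"]) auto
  have "h measurable_on Omega"
    using hm by (subst measurable_on_iff_borel_measurable) auto
  then obtain N c where N: "negligible N" and c: "\<And>n. continuous_on UNIV (c n)"
    and cl: "\<And>x. x \<notin> N \<Longrightarrow> (\<lambda>n::nat. c n x) \<longlonglongrightarrow> (if x \<in> Omega then h x else 0)"
    unfolding measurable_on_def by blast
  have AN: "AE x in Om. x \<notin> N"
  proof -
    have "AE x in lebesgue. x \<notin> N"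
      using N by (intro AE_not_in) (simp add: negligible_iff_null_sets)
    then show ?thesis by (subst AE_restrict_space_iff) auto
  qed
  have cm: "(\<lambda>x. clip (real k) (c n x)) \<in> borel_measurable Om" for n
    by (intro continuous_measurable_Om continuous_on_clip continuous_on_subset[OF c]) auto
  have "(\<lambda>n. l2norm Om (\<lambda>x. h x - clip (real k) (c n x))) \<longlonglongrightarrow> 0"
  proof (rule l2norm_dominated_convergence[where w = "\<lambda>x. 2 * real k"])
    show "AE x in Om. (\<lambda>n. h x - clip (real k) (c n x)) \<longlonglongrightarrow> 0"
      using AN AE_space
    proof eventually_elim
      case (elim x)
      then have "(\<lambda>n. c n x) \<longlonglongrightarrow> h x" using cl[of x] by auto
      then have "(\<lambda>n. h x - clip (real k) (c n x)) \<longlonglongrightarrow> h x - clip (real k) (h x)"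
        unfolding clip_def by (intro tendsto_intros)
      then show ?case using hb[of x] by (simp add: clip_id)
    qed
    show "AE x in Om. \<bar>h x - clip (real k) (c n x)\<bar> \<le> 2 * real k" for n
    proof (rule AE_I2)
      fix x show "\<bar>h x - clip (real k) (c n x)\<bar> \<le> 2 * real k"
        using hb[of x] clip_bound[of "real k" "c n x"] by linarith
    qed
  qed (use cm in \<open>auto intro: Om.sq_integrable_const\<close>)
  then have "\<forall>\<^sub>F n in sequentially. l2norm Om (\<lambda>x. h x - clip (real k) (c n x)) < e / 2"
    using e by (intro order_tendstoD) auto
  then obtain n where n: "l2norm Om (\<lambda>x. h x - clip (real k) (c n x)) < e / 2"
    by (auto dest: eventually_happens)
  have cc: "continuous_on UNIV (\<lambda>x. clip (real k) (c n x))"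
    by (intro continuous_on_clip c)
  have "l2norm Om (\<lambda>x. g x - clip (real k) (c n x)) < e"
    using l2norm_triangle_diff[OF g h continuous_sq_integrable_Om[OF continuous_on_subset[OF cc]]] n k
    by (auto simp: h_def)
  with cc show ?thesis by blast
qed

text \<open>A continuous function is uniformly close to a polynomial on \<open>[0, 1]\<close>, and a polynomial times a
  cutoff function is a test function.\<close>

lemma test_functions_dense_L2:
  assumes g: "sq_integrable Om g" and e: "e > 0"
  shows "\<exists>\<psi>\<in>test_functions. l2norm Om (\<lambda>x. g x - \<psi> x) < e"
proof -
  obtain f where f: "continuous_on UNIV f" "l2norm Om (\<lambda>x. g x - f x) < e / 3"
    using continuous_dense_L2[OF g, of "e / 3"] e by auto
  have fs: "sq_integrable Om f" by (intro continuous_sq_integrable_Om continuous_on_subset[OF f(1)]) simp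
  obtain p where p: "real_polynomial_function p" "\<And>x. x \<in> {0..1} \<Longrightarrow> \<bar>f x - p x\<bar> < e / 6"
    using Stone_Weierstrass_real_polynomial_function[OF compact_Icc continuous_on_subset[OF f(1) subset_UNIV],
        where e = "e / 6"] e by (metis zero_less_divide_iff zero_less_numeral)
  have ps: "smooth p" by (rule smooth_real_polynomial_function[OF p(1)])
  have psq: "sq_integrable Om p" by (intro continuous_sq_integrable_Om smooth_continuous_on ps)
  have "l2norm Om (\<lambda>x. f x - p x) \<le> \<bar>e / 6\<bar> * l2norm Om (\<lambda>x. 1)"
  proof (rule sq_integrable_mono(2)[OF Om.sq_integrable_const])
    show "AE x in Om. \<bar>f x - p x\<bar> \<le> e / 6 * \<bar>1\<bar>"
    proof (rule AE_I2)
      fix x assume "x \<in> space Om"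
      then show "\<bar>f x - p x\<bar> \<le> e / 6 * \<bar>1\<bar>" using p(2)[of x] by simp
    qed
  qed (intro sq_integrable_measurable sq_integrable_diff fs psq)
  then have fp: "l2norm Om (\<lambda>x. f x - p x) < e / 3" using e by (simp add: l2norm_Om_const del: integral_Om_const)
  have t: "(\<lambda>x. p x * cutoff 0 1 n x) \<in> test_functions" for n
    by (intro test_cutoff_mult ps) auto
  have "(\<lambda>n. l2norm Om (\<lambda>x. p x - p x * cutoff 0 1 n x)) \<longlonglongrightarrow> 0"
  proof (rule l2norm_dominated_convergence)
    show "sq_integrable Om (\<lambda>x. \<bar>p x\<bar>)"
      using psq by (auto simp: sq_integrable_def intro!: borel_measurable_abs)
    show "(\<lambda>x. p x - p x * cutoff 0 1 n x) \<in> borel_measurable Om" for n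
      by (intro sq_integrable_measurable sq_integrable_diff psq test_sq_integrable t)
    show "AE x in Om. (\<lambda>n. p x - p x * cutoff 0 1 n x) \<longlonglongrightarrow> 0"
    proof (rule AE_I2)
      fix x assume "x \<in> space Om"
      then have "(\<lambda>n. p x - p x * cutoff 0 1 n x) \<longlonglongrightarrow> p x - p x * 1"
        using cutoff_tendsto[of 0 1 x] by (intro tendsto_intros) auto
      then show "(\<lambda>n. p x - p x * cutoff 0 1 n x) \<longlonglongrightarrow> 0" by simp
    qed
    show "AE x in Om. \<bar>p x - p x * cutoff 0 1 n x\<bar> \<le> \<bar>p x\<bar>" for n
    proof (rule AE_I2)
      fix x
      have "\<bar>p x - p x * cutoff 0 1 n x\<bar> = \<bar>p x\<bar> * (1 - cutoff 0 1 n x)"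
        using cutoff_bounds(2)[of 0 1 n x] abs_mult[of "p x" "1 - cutoff 0 1 n x"]
        by (simp add: right_diff_distrib)
      also have "\<dots> \<le> \<bar>p x\<bar>"
        using cutoff_bounds[of 0 1 n x] by (intro mult_left_le) auto
      finally show "\<bar>p x - p x * cutoff 0 1 n x\<bar> \<le> \<bar>p x\<bar>" .
    qed
  qed
  then have "\<forall>\<^sub>F n in sequentially. l2norm Om (\<lambda>x. p x - p x * cutoff 0 1 n x) < e / 3"
    using e by (intro order_tendstoD) auto
  then obtain n where n: "l2norm Om (\<lambda>x. p x - p x * cutoff 0 1 n x) < e / 3"
    by (auto dest: eventually_happens)
  have "l2norm Om (\<lambda>x. g x - p x * cutoff 0 1 n x) < e"
    using l2norm_triangle_diff[OF g fs test_sq_integrable[OF t[of n]]]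
      l2norm_triangle_diff[OF fs psq test_sq_integrable[OF t[of n]]] f(2) fp n by linarith
  then show ?thesis by (rule bexI[OF _ t])
qed

text \<open>The next two lemmas identify \<open>H10_space\<close>, up to null sets, with the primitives of square
  integrable functions with mean zero. Mean zero and the value zero at \<open>0\<close> are inherited from the
  test functions, as the norm in \<open>H1_space\<close> controls both.\<close>

lemma H10_imp_Prim:
  assumes v: "v \<in> H10_space"
  shows "sq_integrable Om (wderiv v)" "integral\<^sup>L Om (wderiv v) = 0" "AE x in Om. v x = Prim (wderiv v) x"
proof -
  obtain \<phi> where \<phi>: "\<And>n::nat. \<phi> n \<in> test_functions" and lim: "(\<lambda>n. H1_norm (\<lambda>x. v x - \<phi> n x)) \<longlonglongrightarrow> 0"
    using v by (auto simp: H10_space_def)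
  have vs: "sq_integrable Om v" and gs: "sq_integrable Om (wderiv v)" and wv: "has_weak_deriv v (wderiv v)"
    using v by (auto simp: H10_space_def H1_space_def Lp_space_2 wderiv_has_weak_deriv)
  define g where "g = wderiv v"
  have gs: "sq_integrable Om g" and wv: "has_weak_deriv v g" using gs wv by (auto simp: g_def)
  have gi: "integrable Om g" by (rule Om.sq_integrable_imp_integrable[OF gs])
  have ds: "sq_integrable Om (\<lambda>x. g x - deriv (\<phi> n) x)" for n
    by (intro sq_integrable_diff gs test_sq_integrable test_deriv \<phi>)
  define r s where "r n = l2norm Om (\<lambda>x. v x - \<phi> n x)" and "s n = l2norm Om (\<lambda>x. g x - deriv (\<phi> n) x)" for n
  have H: "H1_norm (\<lambda>x. v x - \<phi> n x) = sqrt ((r n)\<^sup>2 + (s n)\<^sup>2)" for n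
  proof -
    have "AE x in Om. g x - deriv (\<phi> n) x = wderiv (\<lambda>x. v x - \<phi> n x) x"
      using has_weak_deriv_wderiv_AE[OF has_weak_deriv_diff[OF wv has_weak_deriv_test[OF \<phi>[of n]]]]
      by eventually_elim simp
    from sq_integrable_AE_Om(2)[OF ds this] show ?thesis
      by (simp add: H1_norm_def Lp_norm_2 r_def s_def)
  qed
  have r: "r \<longlonglongrightarrow> 0" and s: "s \<longlonglongrightarrow> 0"
    by (rule Lim_null_comparison[OF always_eventually lim], simp add: H r_def s_def real_le_rsqrt)+
  have "\<bar>integral\<^sup>L Om g\<bar> \<le> s n" for n
  proof -
    have "integral\<^sup>L Om g = (LINT x|Om. g x - deriv (\<phi> n) x)"
      using integral_deriv_test[OF \<phi>[of n]] gi test_integrable[OF test_deriv[OF \<phi>[of n]]] by simp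
    then have "\<bar>integral\<^sup>L Om g\<bar> \<le> (LINT x|Om. \<bar>g x - deriv (\<phi> n) x\<bar>)"
      by (simp del: Bochner_Integration.integral_diff)
    also have "\<dots> \<le> s n" unfolding s_def by (rule abs_integral_le_l2norm_Om[OF ds])
    finally show ?thesis .
  qed
  then have "\<bar>integral\<^sup>L Om g\<bar> \<le> 0"
    by (intro LIMSEQ_le_const[OF s]) auto
  then show "integral\<^sup>L Om (wderiv v) = 0" by (simp add: g_def)
  obtain K where K: "AE x in Om. v x = K + Prim g x"
    using has_weak_deriv_imp_Prim[OF wv gi] by blast
  have "\<bar>K\<bar> \<le> r n + s n" for n
  proof -
    have "\<bar>K\<bar> = l2norm Om (\<lambda>x. (v x - \<phi> n x) - Prim (\<lambda>x. g x - deriv (\<phi> n) x) x)"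
    proof -
      have "AE x in Om. K = (v x - \<phi> n x) - Prim (\<lambda>x. g x - deriv (\<phi> n) x) x"
        using K AE_space
        by eventually_elim (auto simp: Prim_diff gi test_integrable test_deriv \<phi> Prim_deriv_test)
      from sq_integrable_AE_Om(2)[OF Om.sq_integrable_const this]
      show ?thesis by (simp add: l2norm_Om_const del: integral_Om_const)
    qed
    also have "\<dots> \<le> r n + l2norm Om (\<lambda>x. (- 1) * Prim (\<lambda>x. g x - deriv (\<phi> n) x) x)"
      unfolding r_def
      using l2norm_triangle[OF sq_integrable_diff[OF vs test_sq_integrable[OF \<phi>[of n]]]
          sq_integrable_cmult[OF Prim_sq_integrable(2)[OF ds[of n]], of "- 1"]] by simp
    also have "\<dots> \<le> r n + s n"
      unfolding l2norm_cmult s_def using Prim_sq_integrable(3)[OF ds[of n]] by simp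
    finally show ?thesis .
  qed
  then have "\<bar>K\<bar> \<le> 0 + 0"
    by (intro LIMSEQ_le_const[OF tendsto_add[OF r s]]) auto
  then show "AE x in Om. v x = Prim (wderiv v) x" using K by (simp add: g_def)
  show "sq_integrable Om (wderiv v)" using gs by (simp add: g_def)
qed

text \<open>Conversely, the derivative is approximated by test functions, whose mean is corrected by a multiple
  of a fixed test function \<open>\<beta>\<close>, and the primitives of these are test functions again.\<close>

lemma Prim_imp_H10:
  assumes g: "sq_integrable Om g" and 0: "integral\<^sup>L Om g = 0" and v: "AE x in Om. v x = Prim g x"
  shows "v \<in> H10_space" "AE x in Om. wderiv v x = g x"
proof -
  have gi: "integrable Om g" by (rule Om.sq_integrable_imp_integrable[OF g])
  have wv: "has_weak_deriv v g"
    by (rule has_weak_deriv_Prim[OF gi, of _ 0]) (use v in simp)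
  show *: "AE x in Om. wderiv v x = g x" by (rule has_weak_deriv_wderiv_AE[OF wv])
  have v': "AE x in Om. Prim g x = v x" "AE x in Om. g x = wderiv v x"
    using v * by (eventually_elim, simp)+
  have H1: "v \<in> H1_space"
    using sq_integrable_AE_Om(1)[OF Prim_sq_integrable(2)[OF g] v'(1)] sq_integrable_AE_Om(1)[OF g v'(2)] wv
    by (auto simp: H1_space_def Lp_space_2 weakly_differentiable_def)
  obtain \<beta> where \<beta>: "\<beta> \<in> test_functions" "integral\<^sup>L Om \<beta> = 1" using test_unit_mass by blast
  have "\<exists>\<phi>\<in>test_functions. H1_norm (\<lambda>x. v x - \<phi> x) \<le> sqrt 2 * (1 + l2norm Om \<beta>) * inverse (real (Suc n))" for n
  proof -
    obtain \<psi> where \<psi>: "\<psi> \<in> test_functions" "l2norm Om (\<lambda>x. g x - \<psi> x) < inverse (real (Suc n))"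
      using test_functions_dense_L2[OF g, of "inverse (real (Suc n))"] by auto
    define m where "m = integral\<^sup>L Om \<psi>"
    define \<theta> where "\<theta> x = \<psi> x - m * \<beta> x" for x
    have \<theta>: "\<theta> \<in> test_functions" unfolding \<theta>_def by (intro test_diff_cmult \<psi> \<beta>)
    have \<theta>0: "integral\<^sup>L Om \<theta> = 0"
      using test_integrable[OF \<psi>(1)] test_integrable[OF \<beta>(1)] \<beta>(2) unfolding \<theta>_def by (simp add: m_def)
    have gp: "sq_integrable Om (\<lambda>x. g x - \<psi> x)" by (intro sq_integrable_diff g test_sq_integrable \<psi>)
    have gc: "sq_integrable Om (\<lambda>x. g x - \<theta> x)" by (intro sq_integrable_diff g test_sq_integrable \<theta>)
    have "\<bar>m\<bar> = \<bar>LINT x|Om. g x - \<psi> x\<bar>"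
      using gi test_integrable[OF \<psi>(1)] 0 by (simp add: m_def)
    also have "\<dots> \<le> (LINT x|Om. \<bar>g x - \<psi> x\<bar>)" by (rule integral_abs_bound)
    also have "\<dots> \<le> l2norm Om (\<lambda>x. g x - \<psi> x)" by (rule abs_integral_le_l2norm_Om[OF gp])
    finally have m: "\<bar>m\<bar> \<le> l2norm Om (\<lambda>x. g x - \<psi> x)" .
    have "l2norm Om (\<lambda>x. g x - \<theta> x) = l2norm Om (\<lambda>x. (g x - \<psi> x) + m * \<beta> x)"
      by (simp add: \<theta>_def algebra_simps)
    also have "\<dots> \<le> l2norm Om (\<lambda>x. g x - \<psi> x) + \<bar>m\<bar> * l2norm Om \<beta>"
      using l2norm_triangle[OF gp sq_integrable_cmult[OF test_sq_integrable[OF \<beta>(1)], of m]]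
      by (simp add: l2norm_cmult)
    also have "\<dots> \<le> l2norm Om (\<lambda>x. g x - \<psi> x) + l2norm Om (\<lambda>x. g x - \<psi> x) * l2norm Om \<beta>"
      using m by (intro add_left_mono mult_right_mono) auto
    also have "\<dots> = (1 + l2norm Om \<beta>) * l2norm Om (\<lambda>x. g x - \<psi> x)" by (simp add: algebra_simps)
    also have "\<dots> \<le> (1 + l2norm Om \<beta>) * inverse (real (Suc n))"
      using \<psi>(2) by (intro mult_left_mono) auto
    finally have s: "l2norm Om (\<lambda>x. g x - \<theta> x) \<le> (1 + l2norm Om \<beta>) * inverse (real (Suc n))" .
    define \<phi> where "\<phi> = Prim \<theta>"
    have \<phi>: "\<phi> \<in> test_functions" "deriv \<phi> = \<theta>"
      using test_primitive[OF \<theta> \<theta>0] by (auto simp: \<phi>_def)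
    have e1: "AE x in Om. Prim (\<lambda>x. g x - \<theta> x) x = v x - \<phi> x"
      using v by eventually_elim (simp add: Prim_diff gi test_integrable \<theta> \<phi>_def)
    have e2: "AE x in Om. g x - \<theta> x = wderiv (\<lambda>x. v x - \<phi> x) x"
      using has_weak_deriv_wderiv_AE[OF has_weak_deriv_diff[OF wv has_weak_deriv_test[OF \<phi>(1)]]]
      by eventually_elim (simp add: \<phi>(2))
    have "H1_norm (\<lambda>x. v x - \<phi> x)
        = sqrt ((l2norm Om (Prim (\<lambda>x. g x - \<theta> x)))\<^sup>2 + (l2norm Om (\<lambda>x. g x - \<theta> x))\<^sup>2)"
      unfolding H1_norm_def Lp_norm_2
      using sq_integrable_AE_Om(2)[OF Prim_sq_integrable(2)[OF gc] e1] sq_integrable_AE_Om(2)[OF gc e2] by simp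
    also have "\<dots> \<le> sqrt (2 * (l2norm Om (\<lambda>x. g x - \<theta> x))\<^sup>2)"
      using Prim_sq_integrable(3)[OF gc] by (intro real_sqrt_le_mono) (auto intro!: power_mono)
    also have "\<dots> = sqrt 2 * l2norm Om (\<lambda>x. g x - \<theta> x)" by (simp add: real_sqrt_mult)
    also have "\<dots> \<le> sqrt 2 * ((1 + l2norm Om \<beta>) * inverse (real (Suc n)))"
      using s by (intro mult_left_mono) auto
    finally show ?thesis using \<phi> by (auto simp: mult.assoc)
  qed
  then obtain \<phi> where \<phi>: "\<And>n::nat. \<phi> n \<in> test_functions"
    "\<And>n. H1_norm (\<lambda>x. v x - \<phi> n x) \<le> sqrt 2 * (1 + l2norm Om \<beta>) * inverse (real (Suc n))"
    by metis
  have "(\<lambda>n. H1_norm (\<lambda>x. v x - \<phi> n x)) \<longlonglongrightarrow> 0"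
  proof (rule Lim_null_comparison)
    show "\<forall>\<^sub>F n in sequentially. norm (H1_norm (\<lambda>x. v x - \<phi> n x))
        \<le> sqrt 2 * (1 + l2norm Om \<beta>) * inverse (real (Suc n))"
      using \<phi>(2) by (intro always_eventually allI) (simp add: H1_norm_def)
    show "(\<lambda>n. sqrt 2 * (1 + l2norm Om \<beta>) * inverse (real (Suc n))) \<longlonglongrightarrow> 0"
      using tendsto_mult[OF tendsto_const LIMSEQ_inverse_real_of_nat] by simp
  qed
  with H1 \<phi>(1) show "v \<in> H10_space" by (auto simp: H10_space_def)
qed

section \<open>Coercivity of the bilinear form\<close>

lemma Linf_spaceD:
  assumes "v \<in> Linf_space"
  shows "v \<in> borel_measurable Om" "\<exists>M. AE x in Om. \<bar>v x\<bar> \<le> M"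
  using assms by (auto simp: Linf_space_def)

lemma bounded_integrable_Om:
  assumes "v \<in> borel_measurable Om" "AE x in Om. \<bar>v x\<bar> \<le> M"
  shows "sq_integrable Om v" "integrable Om v"
proof -
  show "sq_integrable Om v"
    by (rule sq_integrable_mono(1)[OF Om.sq_integrable_const[of 1], where B = M]) (use assms in auto)
  then show "integrable Om v" by (rule Om.sq_integrable_imp_integrable)
qed

text \<open>The admissible coefficients with explicit constants: a lower bound \<open>a0\<close> of \<open>a\<close>, a common bound \<open>M\<close>
  of \<open>a\<close>, \<open>b\<close>, \<open>c\<close> and the derivatives of \<open>a\<close> and \<open>b\<close>, and the values \<open>ca\<close>, \<open>cb\<close> at \<open>0\<close> of the
  continuous representatives of \<open>a\<close> and \<open>b\<close>.\<close>

locale bvp =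
  fixes a b c :: "real \<Rightarrow> real" and a0 M ca cb :: real
  assumes a0: "0 < a0" and M: "0 \<le> M"
    and meas: "a \<in> borel_measurable Om" "b \<in> borel_measurable Om" "c \<in> borel_measurable Om"
      "wderiv a \<in> borel_measurable Om" "wderiv b \<in> borel_measurable Om"
    and bd: "AE x in Om. \<bar>a x\<bar> \<le> M" "AE x in Om. \<bar>b x\<bar> \<le> M" "AE x in Om. \<bar>c x\<bar> \<le> M"
      "AE x in Om. \<bar>wderiv a x\<bar> \<le> M" "AE x in Om. \<bar>wderiv b x\<bar> \<le> M"
    and a_eq: "AE x in Om. a x = ca + Prim (wderiv a) x"
    and b_eq: "AE x in Om. b x = cb + Prim (wderiv b) x"
    and a_ge: "AE x in Om. a0 \<le> a x"
    and c_ge: "AE x in Om. 0 \<le> c x - 1 / 2 * wderiv b x"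

lemma W1inf_Prim:
  assumes "v \<in> W1inf_space"
  shows "\<exists>K. AE x in Om. v x = K + Prim (wderiv v) x"
proof (rule has_weak_deriv_imp_Prim)
  show "has_weak_deriv v (wderiv v)" using assms by (simp add: W1inf_space_def wderiv_has_weak_deriv)
  have *: "wderiv v \<in> Linf_space" using assms by (simp add: W1inf_space_def)
  then obtain M where "AE x in Om. \<bar>wderiv v x\<bar> \<le> M" using Linf_spaceD(2) by blast
  then show "integrable Om (wderiv v)" using Linf_spaceD(1)[OF *] by (rule bounded_integrable_Om(2)[rotated])
qed

lemma admissible_coeffs_bvp:
  assumes "admissible_coeffs a b c"
  shows "\<exists>a0 M ca cb. bvp a b c a0 M ca cb"
proof -
  have W: "a \<in> W1inf_space" "b \<in> W1inf_space" "c \<in> Linf_space"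
    using assms by (auto simp: admissible_coeffs_def)
  then have L: "a \<in> Linf_space" "b \<in> Linf_space" "wderiv a \<in> Linf_space" "wderiv b \<in> Linf_space"
    by (auto simp: W1inf_space_def)
  obtain M1 M2 M3 M4 M5 where *: "AE x in Om. \<bar>a x\<bar> \<le> M1" "AE x in Om. \<bar>b x\<bar> \<le> M2" "AE x in Om. \<bar>c x\<bar> \<le> M3"
      "AE x in Om. \<bar>wderiv a x\<bar> \<le> M4" "AE x in Om. \<bar>wderiv b x\<bar> \<le> M5"
    using L W Linf_spaceD(2) by metis
  define M where "M = Max {0, M1, M2, M3, M4, M5}"
  have M: "0 \<le> M" "M1 \<le> M" "M2 \<le> M" "M3 \<le> M" "M4 \<le> M" "M5 \<le> M" by (auto simp: M_def)
  obtain a0 where a0: "a0 > 0" "AE x in Om. a x \<ge> a0"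
    using assms by (auto simp: admissible_coeffs_def)
  obtain ca cb where "AE x in Om. a x = ca + Prim (wderiv a) x" "AE x in Om. b x = cb + Prim (wderiv b) x"
    using W1inf_Prim W by metis
  then have "bvp a b c a0 M ca cb"
  proof unfold_locales
    show "AE x in Om. \<bar>a x\<bar> \<le> M" using *(1) by eventually_elim (use M in linarith)
    show "AE x in Om. \<bar>b x\<bar> \<le> M" using *(2) by eventually_elim (use M in linarith)
    show "AE x in Om. \<bar>c x\<bar> \<le> M" using *(3) by eventually_elim (use M in linarith)
    show "AE x in Om. \<bar>wderiv a x\<bar> \<le> M" using *(4) by eventually_elim (use M in linarith)
    show "AE x in Om. \<bar>wderiv b x\<bar> \<le> M" using *(5) by eventually_elim (use M in linarith)
    show "AE x in Om. 0 \<le> c x - 1 / 2 * wderiv b x" using assms by (simp add: admissible_coeffs_def)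
  qed (use L W a0 M Linf_spaceD(1) in auto)
  then show ?thesis by blast
qed

context bvp
begin

text \<open>The bilinear form as a function of the derivatives \<open>p\<close> and \<open>g\<close> of its arguments, which are taken
  to be the primitives that vanish at \<open>0\<close>.\<close>

definition form :: "(real \<Rightarrow> real) \<Rightarrow> (real \<Rightarrow> real) \<Rightarrow> real"
  where "form p g = (LINT x|Om. a x * p x * g x + b x * p x * Prim g x + c x * Prim p x * Prim g x)"

lemma form_terms_integrable:
  assumes "sq_integrable Om p" "sq_integrable Om g"
  shows "integrable Om (\<lambda>x. a x * p x * g x)" "integrable Om (\<lambda>x. b x * p x * Prim g x)"
    "integrable Om (\<lambda>x. c x * Prim p x * Prim g x)"
proof -
  note P = Prim_sq_integrable(2)
  show "integrable Om (\<lambda>x. a x * p x * g x)"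
    by (rule sq_integrable_mult[OF sq_integrable_bounded_mult(1)[OF assms(1) meas(1) bd(1)] assms(2)])
  show "integrable Om (\<lambda>x. b x * p x * Prim g x)"
    by (rule sq_integrable_mult[OF sq_integrable_bounded_mult(1)[OF assms(1) meas(2) bd(2)] P[OF assms(2)]])
  show "integrable Om (\<lambda>x. c x * Prim p x * Prim g x)"
    by (rule sq_integrable_mult[OF sq_integrable_bounded_mult(1)[OF P[OF assms(1)] meas(3) bd(3)] P[OF assms(2)]])
qed

lemma form_integrable:
  assumes "sq_integrable Om p" "sq_integrable Om g"
  shows "integrable Om (\<lambda>x. a x * p x * g x + b x * p x * Prim g x + c x * Prim p x * Prim g x)"
  using form_terms_integrable[OF assms] by simp

lemma form_eq:
  assumes "sq_integrable Om p" "sq_integrable Om g"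
  shows "form p g = (LINT x|Om. a x * p x * g x) + (LINT x|Om. b x * p x * Prim g x)
      + (LINT x|Om. c x * Prim p x * Prim g x)"
  using form_terms_integrable[OF assms] by (simp add: form_def)

lemma form_diff_left:
  assumes p: "sq_integrable Om p" and q: "sq_integrable Om q" and g: "sq_integrable Om g"
  shows "form (\<lambda>x. p x - q x) g = form p g - form q g"
proof -
  have P: "Prim (\<lambda>x. p x - q x) x = Prim p x - Prim q x" for x
    by (intro Prim_diff Om.sq_integrable_imp_integrable p q)
  have "form (\<lambda>x. p x - q x) g = (LINT x|Om.
      (a x * p x * g x + b x * p x * Prim g x + c x * Prim p x * Prim g x) -
      (a x * q x * g x + b x * q x * Prim g x + c x * Prim q x * Prim g x))"
    unfolding form_def P by (intro Bochner_Integration.integral_cong refl) (simp add: algebra_simps)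
  also have "\<dots> = form p g - form q g"
    unfolding form_def by (intro Bochner_Integration.integral_diff form_integrable p q g)
  finally show ?thesis .
qed

lemma form_diff_right:
  assumes p: "sq_integrable Om p" and q: "sq_integrable Om q" and g: "sq_integrable Om g"
  shows "form g (\<lambda>x. p x - q x) = form g p - form g q"
proof -
  have P: "Prim (\<lambda>x. p x - q x) x = Prim p x - Prim q x" for x
    by (intro Prim_diff Om.sq_integrable_imp_integrable p q)
  have "form g (\<lambda>x. p x - q x) = (LINT x|Om.
      (a x * g x * p x + b x * g x * Prim p x + c x * Prim g x * Prim p x) -
      (a x * g x * q x + b x * g x * Prim q x + c x * Prim g x * Prim q x))"
    unfolding form_def P by (intro Bochner_Integration.integral_cong refl) (simp add: algebra_simps)
  also have "\<dots> = form g p - form g q"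
    unfolding form_def by (intro Bochner_Integration.integral_diff form_integrable p q g)
  finally show ?thesis .
qed

lemma bilin_eq_form:
  assumes "sq_integrable Om p" "sq_integrable Om g"
    and "AE x in Om. w x = Prim p x" "AE x in Om. wderiv w x = p x"
    and "AE x in Om. v x = Prim g x" "AE x in Om. wderiv v x = g x"
  shows "bilin a b c w v = form p g"
  unfolding bilin_def form_def
proof (rule integrable_AE_Om(2)[OF form_integrable[OF assms(1,2)]])
  show "AE x in Om. a x * p x * g x + b x * p x * Prim g x + c x * Prim p x * Prim g x
      = a x * wderiv w x * wderiv v x + b x * wderiv w x * v x + c x * w x * v x"
    using assms(3-6) by eventually_elim simp
qed

text \<open>Since the primitive of \<open>g\<close> vanishes at \<open>0\<close> and \<open>1\<close>, integration by parts turns the convection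
  term into \<open>- b' / 2\<close> times the square of the primitive.\<close>

lemma form_coercive:
  assumes g: "sq_integrable Om g" and 0: "integral\<^sup>L Om g = 0"
  shows "a0 * (l2norm Om g)\<^sup>2 \<le> form g g"
proof -
  define V where "V = Prim g"
  define k where "k x = g x * V x + V x * g x" for x
  have gi: "integrable Om g" by (rule Om.sq_integrable_imp_integrable[OF g])
  have V: "sq_integrable Om V" unfolding V_def by (rule Prim_sq_integrable(2)[OF g])
  have ki: "integrable Om k"
    unfolding k_def using sq_integrable_mult[OF g V] sq_integrable_mult[OF V g] by simp
  have Pk: "Prim k x = (V x)\<^sup>2" for x
    unfolding k_def V_def Prim_mult_Prim[OF gi gi] by (simp add: power2_eq_square)
  have k0: "integral\<^sup>L Om k = 0"
    using Pk[of 1] 0 by (simp add: V_def Prim_1)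
  have bi: "integrable Om (wderiv b)" by (rule bounded_integrable_Om(2)[OF meas(5) bd(5)])
  note parts = integration_by_parts_Prim[OF bi ki]
  have "(LINT x|Om. b x * k x) = (LINT x|Om. cb * k x + Prim (wderiv b) x * k x)"
  proof (rule integrable_AE_Om(2))
    show "AE x in Om. cb * k x + Prim (wderiv b) x * k x = b x * k x"
      using b_eq by eventually_elim (simp add: distrib_right)
  qed (use ki parts(2) in simp)
  also have "\<dots> = - (LINT x|Om. wderiv b x * (V x)\<^sup>2)"
    using ki parts k0 by (simp add: Pk)
  finally have bk: "(LINT x|Om. b x * k x) = - (LINT x|Om. wderiv b x * (V x)\<^sup>2)" .
  have "(LINT x|Om. b x * k x) = (LINT x|Om. 2 * (b x * g x * V x))"
    by (intro Bochner_Integration.integral_cong) (auto simp: k_def algebra_simps)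
  then have conv: "(LINT x|Om. b x * g x * V x) = - (1 / 2) * (LINT x|Om. wderiv b x * (V x)\<^sup>2)"
    using bk by simp
  have i1: "integrable Om (\<lambda>x. a x * g x * g x)" and i3: "integrable Om (\<lambda>x. c x * V x * V x)"
    using form_terms_integrable[OF g g] by (simp_all add: V_def)
  have i4: "integrable Om (\<lambda>x. wderiv b x * (V x)\<^sup>2)" using parts(1) by (simp add: Pk)
  have i5: "integrable Om (\<lambda>x. c x * V x * V x - 1 / 2 * (wderiv b x * (V x)\<^sup>2))" using i3 i4 by simp
  have i6: "integrable Om (\<lambda>x. a0 * (g x)\<^sup>2)" using g by (simp add: sq_integrable_def)
  have "0 \<le> (LINT x|Om. c x * V x * V x - 1 / 2 * (wderiv b x * (V x)\<^sup>2))"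
  proof (rule integral_nonneg_AE)
    show "AE x in Om. 0 \<le> c x * V x * V x - 1 / 2 * (wderiv b x * (V x)\<^sup>2)"
      using c_ge
    proof eventually_elim
      case (elim x)
      then have "0 \<le> (c x - 1 / 2 * wderiv b x) * (V x)\<^sup>2" by (intro mult_nonneg_nonneg) auto
      then show ?case by (simp add: algebra_simps power2_eq_square)
    qed
  qed
  then have A: "0 \<le> (LINT x|Om. c x * V x * V x) - 1 / 2 * (LINT x|Om. wderiv b x * (V x)\<^sup>2)"
    using i3 i4 by simp
  have "AE x in Om. a0 * (g x)\<^sup>2 \<le> a x * g x * g x"
    using a_ge
  proof eventually_elim
    case (elim x)
    then have "a0 * (g x)\<^sup>2 \<le> a x * (g x)\<^sup>2" by (intro mult_right_mono) auto
    then show ?case by (simp add: power2_eq_square mult.assoc)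
  qed
  then have "(LINT x|Om. a0 * (g x)\<^sup>2) \<le> (LINT x|Om. a x * g x * g x)"
    by (intro integral_mono_AE i6 i1)
  then have B: "a0 * (l2norm Om g)\<^sup>2 \<le> (LINT x|Om. a x * g x * g x)"
    using g by (simp add: l2norm_sq)
  show ?thesis
    unfolding form_eq[OF g g] using A B conv unfolding V_def by linarith
qed

end

section \<open>Meshes and piecewise linear functions\<close>

text \<open>The elements \<open>K 1, \<dots>, K N\<close> are open intervals; they cover \<open>Omega\<close> except for the nodes, which form
  a null set.\<close>

locale mesh =
  fixes N :: nat and X :: "nat \<Rightarrow> real"
  assumes mesh: "is_mesh N X"
begin

abbreviation K :: "nat \<Rightarrow> real set" where "K \<equiv> mesh_elem X"
abbreviation h :: "nat \<Rightarrow> real" where "h \<equiv> mesh_width X"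

lemma X_ends: "X 0 = 0" "X N = 1"
  using mesh by (auto simp: is_mesh_def)

lemma N_pos: "0 < N"
  using X_ends by (cases "N = 0") auto

lemma h_pos: "i \<in> {1..N} \<Longrightarrow> 0 < h i"
  using mesh by (auto simp: is_mesh_def mesh_width_def)

lemma X_mono: "i \<le> j \<Longrightarrow> j \<le> N \<Longrightarrow> X i \<le> X j"
proof (induction j rule: dec_induct)
  case (step n)
  then show ?case using h_pos[of "Suc n"] by (simp add: mesh_width_def)
qed simp

lemma X_range: "i \<le> N \<Longrightarrow> 0 \<le> X i \<and> X i \<le> 1"
  using X_mono[of 0 i] X_mono[of i N] X_ends by simp

lemma elem_range:
  assumes "i \<in> {1..N}"
  shows "0 \<le> X (i - 1)" "X (i - 1) < X i" "X i \<le> 1"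
proof -
  have "i - 1 \<le> N" "i \<le> N" using assms by auto
  then show "0 \<le> X (i - 1)" "X i \<le> 1" using X_range by auto
  show "X (i - 1) < X i" using h_pos[OF assms] by (simp add: mesh_width_def)
qed

lemma elem_Suc: "K (Suc i) = {X i<..<X (Suc i)}"
  by (simp add: mesh_elem_def)

lemma elem_subset: "i \<in> {1..N} \<Longrightarrow> K i \<subseteq> Omega"
  using elem_range[of i] by (auto simp: mesh_elem_def)

lemma elem_borel [simp]: "K i \<in> sets borel"
  by (simp add: mesh_elem_def)

lemma elem_unique:
  assumes "i \<in> {1..N}" "j \<in> {1..N}" "x \<in> K i" "x \<in> K j"
  shows "i = j"
proof -
  have "\<not> i < j" if "i \<in> {1..N}" "j \<in> {1..N}" "x \<in> K i" "x \<in> K j" for i j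
  proof
    assume "i < j"
    then have "X i \<le> X (j - 1)" using that by (intro X_mono) auto
    then show False using that by (auto simp: mesh_elem_def)
  qed
  then show ?thesis using assms by (meson linorder_neqE_nat)
qed

lemma elem_cover:
  assumes "x \<in> Omega" "\<And>i. i \<le> N \<Longrightarrow> x \<noteq> X i"
  shows "\<exists>i\<in>{1..N}. x \<in> K i"
proof -
  define i where "i = (LEAST i. x < X i)"
  have "x < X N" using assms(1) X_ends by simp
  then have i: "x < X i" "i \<le> N" unfolding i_def by (auto intro: LeastI Least_le)
  have "i \<noteq> 0" using i(1) assms(1) X_ends by (cases i) auto
  then have "\<not> x < X (i - 1)" unfolding i_def by (intro not_less_Least) simp
  then have "X (i - 1) < x" using assms(2)[of "i - 1"] i by force
  then show ?thesis using i \<open>i \<noteq> 0\<close> by (intro bexI[of _ i]) (auto simp: mesh_elem_def)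
qed

lemma AE_elem: "AE x in Om. \<exists>i\<in>{1..N}. x \<in> K i"
proof -
  have "AE x in Om. \<forall>i\<in>{..N}. x \<noteq> X i"
    by (rule AE_finite_allI) (auto intro: AE_Om_neq)
  with AE_space show ?thesis by eventually_elim (use elem_cover in auto)
qed

lemma sum_elem:
  assumes "i \<in> {1..N}" "x \<in> K i"
  shows "(\<Sum>j=1..N. indicator (K j) x * F j) = (F i :: real)"
proof -
  have "(\<Sum>j=1..N. indicator (K j) x * F j) = (\<Sum>j=1..N. if j = i then F i else 0)"
    using assms elem_unique by (intro sum.cong) (auto simp: indicator_def)
  then show ?thesis using assms by simp
qed

lemma integral_elem_sum:
  fixes F :: "real \<Rightarrow> real"
  assumes "integrable Om F"
  shows "integral\<^sup>L Om F = (\<Sum>i=1..N. LINT x|Om. indicator (K i) x * F x)"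
proof -
  have i: "integrable Om (\<lambda>x. indicator (K i) x * F x)" for i
    by (intro integrable_indicator_mult_Om assms) simp
  have "(\<Sum>i=1..N. LINT x|Om. indicator (K i) x * F x) = (LINT x|Om. (\<Sum>i=1..N. indicator (K i) x * F x))"
    by (rule Bochner_Integration.integral_sum[symmetric]) (rule i)
  also have "\<dots> = integral\<^sup>L Om F"
  proof (rule integrable_AE_Om(2)[OF assms])
    show "AE x in Om. F x = (\<Sum>i=1..N. indicator (K i) x * F x)"
      using AE_elem
    proof eventually_elim
      case (elim x)
      then obtain i where "i \<in> {1..N}" "x \<in> K i" by blast
      then show ?case using sum_elem[of i x "\<lambda>j. F x"] by (simp only:)
    qed
  qed
  finally show ?thesis ..
qed

lemma integral_elem:
  assumes "i \<in> {1..N}"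
  shows "(LINT x|Om. indicator (K i) x) = h i"
  using elem_range[OF assms]
  unfolding mesh_elem_def mesh_width_def by (intro integral_Om_indicator) auto

lemma sum_h: "(\<Sum>i=1..N. h i) = 1"
proof -
  have "(\<Sum>i=1..N. h i) = (\<Sum>i=1..N. LINT x|Om. indicator (K i) x * 1)"
    by (intro sum.cong refl) (simp only: mult_1_right integral_elem)
  also have "\<dots> = (LINT x|Om. (1::real))" by (rule integral_elem_sum[symmetric]) simp
  finally show ?thesis by (simp only: integral_Om_const)
qed

text \<open>The function with the value \<open>m i\<close> on the \<open>i\<close>-th element, and zero at the nodes.\<close>

definition stepf :: "(nat \<Rightarrow> real) \<Rightarrow> real \<Rightarrow> real"
  where "stepf m x = (\<Sum>i=1..N. indicator (K i) x * m i)"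

lemma stepf_elem: "i \<in> {1..N} \<Longrightarrow> x \<in> K i \<Longrightarrow> stepf m x = m i"
  unfolding stepf_def by (rule sum_elem)

lemma indicator_stepf: "i \<in> {1..N} \<Longrightarrow> indicator (K i) x * stepf m x = indicator (K i) x * m i"
  by (cases "x \<in> K i") (auto simp: stepf_elem)

lemma sq_integrable_stepf: "sq_integrable Om (stepf m)"
proof -
  have "sq_integrable Om (\<lambda>x. \<Sum>i\<in>I. indicator (K i) x * m i)" if "finite I" for I
    using that
  proof (induction I)
    case empty
    then show ?case using Om.sq_integrable_const[of 0] by simp
  next
    case (insert j I)
    show ?case
      unfolding sum.insert[OF insert.hyps]
      by (intro sq_integrable_add insert.IH sq_integrable_indicator_mult_Om Om.sq_integrable_const elem_borel)
  qed
  from this[OF finite_atLeastAtMost] show ?thesis unfolding stepf_def[abs_def] .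
qed

lemma integrable_stepf: "integrable Om (stepf m)"
  by (intro Om.sq_integrable_imp_integrable sq_integrable_stepf)

lemma integral_stepf: "integral\<^sup>L Om (stepf m) = (\<Sum>i=1..N. m i * h i)"
proof -
  have "(LINT x|Om. indicator (K i) x * stepf m x) = m i * h i" if "i \<in> {1..N}" for i
    unfolding indicator_stepf[OF that] integral_mult_left_zero integral_elem[OF that] by simp
  then show ?thesis by (simp add: integral_elem_sum[OF integrable_stepf])
qed

lemma Prim_stepf_elem:
  assumes i: "i \<in> {1..N}" and x: "x \<in> K i"
  shows "Prim (stepf m) x = Prim (stepf m) (X (i - 1)) + m i * (x - X (i - 1))"
proof -
  have x': "X (i - 1) < x" "x < X i" using x by (auto simp: mesh_elem_def)
  have "Prim (stepf m) x - Prim (stepf m) (X (i - 1)) = (LINT t|Om. indicator {X (i - 1)<..<x} t * stepf m t)"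
    using x' by (intro Prim_diff_eq_open integrable_stepf) simp
  also have "\<dots> = (LINT t|Om. m i * indicator {X (i - 1)<..<x} t)"
    using x' by (intro Bochner_Integration.integral_cong)
      (auto simp: indicator_def mesh_elem_def intro!: stepf_elem[OF i])
  also have "\<dots> = m i * (LINT t|Om. indicator {X (i - 1)<..<x} t)"
    by (rule integral_mult_right_zero)
  also have "(LINT t|Om. indicator {X (i - 1)<..<x} t) = x - X (i - 1)"
    using x' elem_range[OF i] by (intro integral_Om_indicator) auto
  finally show ?thesis by simp
qed

lemma Prim_stepf_fe:
  assumes "integral\<^sup>L Om (stepf m) = 0"
  shows "Prim (stepf m) \<in> fe_space N X"
  unfolding fe_space_def
proof (intro CollectI conjI ballI)
  show "continuous_on {0..1} (Prim (stepf m))" by (rule continuous_Prim[OF integrable_stepf])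
  show "Prim (stepf m) 1 = 0" using assms by (simp add: Prim_1)
  fix i assume i: "i \<in> {1..N}"
  show "\<exists>n q. \<forall>x\<in>K i. Prim (stepf m) x = n * x + q"
    using Prim_stepf_elem[OF i]
    by (intro exI[of _ "m i"] exI[of _ "Prim (stepf m) (X (i - 1)) - m i * X (i - 1)"])
       (auto simp: algebra_simps)
qed simp

text \<open>Conversely, a finite element function is the primitive of its elementwise derivative.\<close>

lemma fe_Prim_stepf:
  assumes v: "v \<in> fe_space N X"
  obtains m where "\<And>x. x \<in> {0..1} \<Longrightarrow> v x = Prim (stepf m) x" "integral\<^sup>L Om (stepf m) = 0"
    "\<And>i x. i \<in> {1..N} \<Longrightarrow> x \<in> K i \<Longrightarrow> deriv v x = m i"
proof -
  have "\<forall>i\<in>{1..N}. \<exists>m q. \<forall>x\<in>K i. v x = m * x + q" using v by (simp add: fe_space_def)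
  then obtain m q where mq: "\<And>i x. i \<in> {1..N} \<Longrightarrow> x \<in> K i \<Longrightarrow> v x = m i * x + q i" by metis
  have D: "(v has_real_derivative m i) (at x)" if "i \<in> {1..N}" "x \<in> K i" for i x
  proof -
    have "((\<lambda>x. m i * x + q i) has_real_derivative m i) (at x)"
      by (auto intro!: derivative_eq_intros)
    then show ?thesis
      by (rule has_field_derivative_transform_within_open[where S = "K i"])
         (use that mq in \<open>auto simp: mesh_elem_def\<close>)
  qed
  have c: "continuous_on {0..1} v" and v0: "v 0 = 0" "v 1 = 0" using v by (auto simp: fe_space_def)
  have P: "v x = Prim (stepf m) x" if x: "x \<in> {0..1}" for x
  proof -
    have "(stepf m has_integral (v x - v 0)) {0..x}"
    proof (rule fundamental_theorem_of_calculus_interior_strong[where S = "X ` {..N}"])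
      fix y assume "y \<in> {0<..<x} - X ` {..N}"
      then have "y \<in> Omega" "\<And>i. i \<le> N \<Longrightarrow> y \<noteq> X i" using x by auto
      then obtain i where i: "i \<in> {1..N}" "y \<in> K i" using elem_cover by blast
      then show "(v has_vector_derivative stepf m y) (at y)"
        using D stepf_elem by (simp flip: has_real_derivative_iff_has_vector_derivative)
    qed (use x continuous_on_subset[OF c] in auto)
    then show ?thesis using x v0 by (simp add: Prim_eq_integral integrable_stepf integral_unique)
  qed
  show thesis
  proof (rule that[of m, OF P])
    show "integral\<^sup>L Om (stepf m) = 0" using P[of 1] v0 by (simp add: Prim_1)
  qed (use D in \<open>auto intro: DERIV_imp_deriv\<close>)
qed

subsection \<open>The elementwise interpolation error\<close>

text \<open>The mean value of \<open>g\<close> on the \<open>i\<close>-th element and the \<open>L\<^sup>2\<close> norm of its restriction to it. Taking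
  elementwise means of a derivative corresponds to nodal interpolation of the primitive.\<close>

definition emean :: "(real \<Rightarrow> real) \<Rightarrow> nat \<Rightarrow> real"
  where "emean g i = (LINT x|Om. indicator (K i) x * g x) / h i"

definition enorm :: "(real \<Rightarrow> real) \<Rightarrow> nat \<Rightarrow> real"
  where "enorm g i = l2norm Om (\<lambda>x. indicator (K i) x * g x)"

lemma enorm_nonneg: "0 \<le> enorm g i"
  by (simp add: enorm_def)

lemma enorm_sq_sum:
  assumes "sq_integrable Om g"
  shows "(\<Sum>i=1..N. (enorm g i)\<^sup>2) = (l2norm Om g)\<^sup>2"
proof -
  have "(\<lambda>x. (indicator (K i) x * g x)\<^sup>2) = (\<lambda>x. indicator (K i) x * (g x)\<^sup>2)" for i
    by (auto simp: indicator_def)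
  then show ?thesis
    using integral_elem_sum[of "\<lambda>x. (g x)\<^sup>2"] assms by (simp add: enorm_def l2norm_sq sq_integrable_def)
qed

lemma sq_integrable_elem: "sq_integrable Om (indicator (K i))"
  using sq_integrable_indicator_mult_Om[OF Om.sq_integrable_const[of 1], of "K i"] by simp

lemma l2norm_elem:
  assumes "i \<in> {1..N}"
  shows "l2norm Om (indicator (K i)) = sqrt (h i)"
proof -
  have "(\<lambda>x. (indicator (K i) x)\<^sup>2) = (indicator (K i) :: real \<Rightarrow> real)" by (auto simp: indicator_def)
  then show ?thesis using integral_elem[OF assms] by (simp add: l2norm_def)
qed

lemma integral_elem_le_enorm:
  assumes "sq_integrable Om g" "i \<in> {1..N}"
  shows "(LINT x|Om. indicator (K i) x * \<bar>g x\<bar>) \<le> sqrt (h i) * enorm g i"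
proof -
  have "l2norm Om (\<lambda>x. indicator (K i) x * \<bar>g x\<bar>) = enorm g i"
    by (simp add: enorm_def l2norm_def power_mult_distrib)
  moreover have "sq_integrable Om (\<lambda>x. indicator (K i) x * \<bar>g x\<bar>)"
    using assms by (intro sq_integrable_indicator_mult_Om) (auto simp: sq_integrable_def intro!: borel_measurable_abs)
  moreover have "(\<lambda>x. indicator (K i) x * (indicator (K i) x * \<bar>g x\<bar>)) = (\<lambda>x. indicator (K i) x * \<bar>g x\<bar>)"
    by (auto simp: indicator_def)
  ultimately show ?thesis
    using Cauchy_Schwarz_LINT[OF sq_integrable_elem, of "\<lambda>x. indicator (K i) x * \<bar>g x\<bar>" i]
    by (simp add: l2norm_elem[OF assms(2)])
qed

lemma enorm_triangle:
  assumes "sq_integrable Om f" "sq_integrable Om g"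
  shows "enorm (\<lambda>x. f x + g x) i \<le> enorm f i + enorm g i"
  unfolding enorm_def distrib_left
  by (intro l2norm_triangle sq_integrable_indicator_mult_Om assms elem_borel)

lemma enorm_minus: "enorm (\<lambda>x. - g x) i = enorm g i"
  by (simp add: enorm_def l2norm_def)

lemma enorm_const_on:
  assumes "i \<in> {1..N}" "\<And>x. x \<in> K i \<Longrightarrow> \<bar>g x\<bar> \<le> B" "0 \<le> B" "g \<in> borel_measurable Om"
  shows "enorm g i \<le> sqrt (h i) * B"
proof -
  have "enorm g i \<le> \<bar>B\<bar> * l2norm Om (indicator (K i))"
    unfolding enorm_def
  proof (rule sq_integrable_mono(2)[OF sq_integrable_elem])
    show "(\<lambda>x. indicator (K i) x * g x) \<in> borel_measurable Om"
      by (intro borel_measurable_times indicator_measurable_Om assms(4) elem_borel)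
  qed (use assms in \<open>auto simp: indicator_def\<close>)
  then show ?thesis using assms(3) by (simp add: l2norm_elem[OF assms(1)] mult.commute)
qed

lemma enorm_emean:
  assumes g: "sq_integrable Om g" and i: "i \<in> {1..N}"
  shows "enorm (\<lambda>x. g x - stepf (emean g) x) i \<le> 2 * enorm g i"
proof -
  have "\<bar>LINT x|Om. indicator (K i) x * g x\<bar> \<le> (LINT x|Om. \<bar>indicator (K i) x * g x\<bar>)"
    by (rule integral_abs_bound)
  also have "\<dots> = (LINT x|Om. indicator (K i) x * \<bar>g x\<bar>)" by (simp add: abs_mult)
  also have "\<dots> \<le> sqrt (h i) * enorm g i" by (rule integral_elem_le_enorm[OF g i])
  finally have "\<bar>emean g i\<bar> * h i \<le> sqrt (h i) * enorm g i"
    using h_pos[OF i] by (simp add: emean_def)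
  then have "sqrt (h i) * (sqrt (h i) * \<bar>emean g i\<bar>) \<le> sqrt (h i) * enorm g i"
    using h_pos[OF i] by (simp add: mult.assoc[symmetric] mult.commute)
  then have le: "sqrt (h i) * \<bar>emean g i\<bar> \<le> enorm g i"
    using h_pos[OF i] by simp
  have "enorm (\<lambda>x. g x + - stepf (emean g) x) i \<le> enorm g i + enorm (\<lambda>x. - stepf (emean g) x) i"
    using sq_integrable_cmult[OF sq_integrable_stepf, of "- 1"] by (intro enorm_triangle g) simp
  also have "enorm (\<lambda>x. - stepf (emean g) x) i \<le> sqrt (h i) * \<bar>emean g i\<bar>"
    unfolding enorm_minus
    by (rule enorm_const_on[OF i]) (auto simp: stepf_elem[OF i] sq_integrable_measurable sq_integrable_stepf)
  finally show ?thesis using le by simp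
qed

text \<open>If \<open>q\<close> has mean zero on each element, then its primitive vanishes at the nodes.\<close>

lemma Prim_node:
  assumes q: "integrable Om q" and 0: "\<And>i. i \<in> {1..N} \<Longrightarrow> (LINT x|Om. indicator (K i) x * q x) = 0"
    and j: "j \<le> N"
  shows "Prim q (X j) = 0"
  using j
proof (induction j)
  case 0
  then show ?case by (simp add: X_ends)
next
  case (Suc j)
  have "Prim q (X (Suc j)) - Prim q (X j) = (LINT x|Om. indicator {X j<..<X (Suc j)} x * q x)"
    using Suc.prems by (intro Prim_diff_eq_open q X_mono) auto
  also have "\<dots> = 0" using 0[of "Suc j"] Suc.prems by (simp add: elem_Suc)
  finally show ?case using Suc by simp
qed

text \<open>The primitive of the restriction of \<open>q\<close> to an element is then the restriction of the primitive.\<close>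

lemma Prim_elem_restrict:
  assumes q: "integrable Om q" and 0: "\<And>i. i \<in> {1..N} \<Longrightarrow> (LINT x|Om. indicator (K i) x * q x) = 0"
    and i: "i \<in> {1..N}" and j: "j \<in> {1..N}" and x: "x \<in> K j"
  shows "Prim (\<lambda>t. indicator (K i) t * q t) x = indicator (K i) x * Prim q x"
proof -
  have x': "X (j - 1) < x" "x < X j" using x by (auto simp: mesh_elem_def)
  consider "i < j" | "i = j" | "j < i" by linarith
  then show ?thesis
  proof cases
    case 1
    then have "X i \<le> X (j - 1)" using j by (intro X_mono) auto
    then have "Prim (\<lambda>t. indicator (K i) t * q t) x = (LINT t|Om. indicator (K i) t * q t)"
      unfolding Prim_def using x' by (intro Bochner_Integration.integral_cong) (auto simp: mesh_elem_def indicator_def)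
    moreover have "x \<notin> K i" using elem_unique[OF i j] x 1 by auto
    ultimately show ?thesis using 0[OF i] by simp
  next
    case 2
    have "i - 1 \<le> N" using i by auto
    then have "Prim q x = Prim q x - Prim q (X (i - 1))" using Prim_node[OF q 0] by simp
    also have "\<dots> = (LINT t|Om. indicator {X (i - 1)<..x} t * q t)"
      using x' 2 by (intro Prim_diff_eq q) auto
    also have "\<dots> = Prim (\<lambda>t. indicator (K i) t * q t) x"
      unfolding Prim_def using x' 2 by (intro Bochner_Integration.integral_cong) (auto simp: mesh_elem_def indicator_def)
    finally show ?thesis using x 2 by simp
  next
    case 3
    then have "X j \<le> X (i - 1)" using i by (intro X_mono) auto
    then have "Prim (\<lambda>t. indicator (K i) t * q t) x = (LINT t|Om. 0)"
      unfolding Prim_def using x' by (intro Bochner_Integration.integral_cong) (auto simp: mesh_elem_def indicator_def)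
    moreover have "x \<notin> K i" using elem_unique[OF i j] x 3 by auto
    ultimately show ?thesis by simp
  qed
qed

lemma enorm_Prim:
  assumes q: "sq_integrable Om q" and 0: "\<And>i. i \<in> {1..N} \<Longrightarrow> (LINT x|Om. indicator (K i) x * q x) = 0"
    and i: "i \<in> {1..N}"
  shows "enorm (Prim q) i \<le> h i * enorm q i"
proof -
  have qi: "integrable Om q" by (rule Om.sq_integrable_imp_integrable[OF q])
  have "\<bar>Prim q x\<bar> \<le> sqrt (h i) * enorm q i" if x: "x \<in> K i" for x
  proof -
    have "Prim q x = Prim (\<lambda>t. indicator (K i) t * q t) x"
      using Prim_elem_restrict[OF qi 0 i i x] x by simp
    also have "\<bar>\<dots>\<bar> \<le> (LINT t|Om. \<bar>indicator (K i) t * q t\<bar>)"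
      by (intro abs_Prim_le integrable_indicator_mult_Om qi) simp
    also have "\<dots> = (LINT t|Om. indicator (K i) t * \<bar>q t\<bar>)" by (simp add: abs_mult)
    also have "\<dots> \<le> sqrt (h i) * enorm q i" by (rule integral_elem_le_enorm[OF q i])
    finally show ?thesis .
  qed
  then have "enorm (Prim q) i \<le> sqrt (h i) * (sqrt (h i) * enorm q i)"
    using h_pos[OF i] by (intro enorm_const_on i measurable_Prim qi) (auto simp: enorm_nonneg)
  also have "\<dots> = h i * enorm q i" using h_pos[OF i] by (simp add: mult.assoc[symmetric])
  finally show ?thesis .
qed

end

section \<open>The residual based error estimate\<close>

context mesh
begin

lemma integral_lebesgue_on_elem:
  fixes F :: "real \<Rightarrow> real"
  assumes "i \<in> {1..N}"
  shows "(LINT x|lebesgue_on (K i). F x) = (LINT x|Om. indicator (K i) x * F x)"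
proof -
  have "(LINT x|lebesgue_on (K i). F x) = (LINT x|lebesgue. indicator (K i) x *\<^sub>R F x)"
    by (rule integral_restrict_space) simp
  also have "\<dots> = (LINT x|lebesgue. indicator Omega x *\<^sub>R (indicator (K i) x * F x))"
    using elem_subset[OF assms] by (intro Bochner_Integration.integral_cong) (auto simp: indicator_def)
  also have "\<dots> = (LINT x|Om. indicator (K i) x * F x)"
    by (rule integral_restrict_space[symmetric]) simp
  finally show ?thesis .
qed

lemma elem_mean_eq:
  assumes "i \<in> {1..N}"
  shows "elem_mean X g i = enorm g i / sqrt (h i)"
proof -
  have "(LINT x|lebesgue_on (K i). \<bar>g x\<bar>\<^sup>2) = (LINT x|Om. (indicator (K i) x * g x)\<^sup>2)"
    unfolding integral_lebesgue_on_elem[OF assms]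
    by (intro Bochner_Integration.integral_cong) (auto simp: indicator_def)
  then show ?thesis
    by (simp add: elem_mean_def enorm_def l2norm_def real_sqrt_mult real_sqrt_divide)
qed

lemma elem_mean_nonneg: "i \<in> {1..N} \<Longrightarrow> 0 \<le> elem_mean X g i"
  using enorm_nonneg[of g i] h_pos[of i] by (simp add: elem_mean_eq)

lemma h_elem_mean_sq: "i \<in> {1..N} \<Longrightarrow> h i * (elem_mean X g i)\<^sup>2 = (enorm g i)\<^sup>2"
  using h_pos[of i] by (simp add: elem_mean_eq power_divide)

end

context bvp
begin

lemma weak_solution_form:
  assumes u: "weak_solution a b c f u" and f: "sq_integrable Om f"
    and g: "sq_integrable Om g" and 0: "integral\<^sup>L Om g = 0"
  shows "form (wderiv u) g = (LINT x|Om. f x * Prim g x)"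
proof -
  have uH: "u \<in> H10_space" using u by (simp add: weak_solution_def)
  have vH: "Prim g \<in> H10_space" and vw: "AE x in Om. wderiv (Prim g) x = g x"
    using Prim_imp_H10[OF g 0] by auto
  have "bilin a b c u (Prim g) = form (wderiv u) g"
    using H10_imp_Prim[OF uH] g vw by (intro bilin_eq_form) auto
  then show ?thesis using u vH by (simp add: weak_solution_def L2_inner_def)
qed

text \<open>The residuals are square integrable, their difference is bounded by the error, and the error is
  bounded by the discrete residual. The test function behind the last estimate is the interpolation
  error of \<open>u - u\<^sub>h\<close>, the primitive of the deviation \<open>q\<close> of the error derivative \<open>e\<close> from its
  elementwise means.\<close>

lemma fe_error:
  assumes f: "sq_integrable Om f" and u: "weak_solution a b c f u"
    and X: "is_mesh N X" and uh: "fe_solution a b c f N X u\<^sub>h"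
  shows "sq_integrable Om (residual a b c f u)" "sq_integrable Om (fe_residual a b c f u\<^sub>h)"
    "l2norm Om (\<lambda>x. residual a b c f u x - fe_residual a b c f u\<^sub>h x)
      \<le> 3 * M * Lp_norm 2 (wderiv (\<lambda>x. u x - u\<^sub>h x))"
    "a0 * Lp_norm 2 (wderiv (\<lambda>x. u x - u\<^sub>h x))
      \<le> 2 * sqrt (\<Sum>i=1..N. mesh_width X i ^ 3 * (elem_mean X (fe_residual a b c f u\<^sub>h) i)\<^sup>2)"
proof -
  interpret mesh N X by unfold_locales (rule X)
  have uH: "u \<in> H10_space" using u by (simp add: weak_solution_def)
  define U where "U = wderiv u"
  have U: "sq_integrable Om U" "integral\<^sup>L Om U = 0" "AE x in Om. u x = Prim U x"
    using H10_imp_Prim[OF uH] by (auto simp: U_def)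
  have uf: "u\<^sub>h \<in> fe_space N X" using uh by (simp add: fe_solution_def)
  obtain m where m: "\<And>x. x \<in> {0..1} \<Longrightarrow> u\<^sub>h x = Prim (stepf m) x" "integral\<^sup>L Om (stepf m) = 0"
    "\<And>i x. i \<in> {1..N} \<Longrightarrow> x \<in> K i \<Longrightarrow> deriv u\<^sub>h x = m i"
    using fe_Prim_stepf[OF uf] by blast
  define P where "P = stepf m"
  have P: "sq_integrable Om P" "integral\<^sup>L Om P = 0" using m(2) by (auto simp: P_def sq_integrable_stepf)
  have uh_eq: "AE x in Om. u\<^sub>h x = Prim P x" by (rule AE_I2) (use m(1) in \<open>auto simp: P_def\<close>)
  have uh_d: "AE x in Om. deriv u\<^sub>h x = P x"
    using AE_elem by eventually_elim (use m(3) stepf_elem in \<open>auto simp: P_def\<close>)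
  have uh_w: "AE x in Om. wderiv u\<^sub>h x = P x"
    by (rule Prim_imp_H10(2)[OF P uh_eq])
  define e where "e x = U x - P x" for x
  have e: "sq_integrable Om e" unfolding e_def by (intro sq_integrable_diff U P)
  have Ui: "integrable Om U" and Pi: "integrable Om P" and ei: "integrable Om e"
    using U P e by (auto intro: Om.sq_integrable_imp_integrable)
  have e0: "integral\<^sup>L Om e = 0" unfolding e_def using Ui Pi U P by simp
  have e_eq: "AE x in Om. u x - u\<^sub>h x = Prim e x"
    using U(3) uh_eq by eventually_elim (simp add: e_def[abs_def] Prim_diff Ui Pi)
  have e_w: "AE x in Om. e x = wderiv (\<lambda>x. u x - u\<^sub>h x) x"
    using Prim_imp_H10(2)[OF e e0 e_eq] by eventually_elim simp
  have norm_e: "Lp_norm 2 (wderiv (\<lambda>x. u x - u\<^sub>h x)) = l2norm Om e"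
    unfolding Lp_norm_2 by (rule sq_integrable_AE_Om(2)[OF e e_w])

  define r where "r x = f x + wderiv a x * P x - b x * P x - c x * Prim P x" for x
  define rr where "rr x = f x + wderiv a x * U x - b x * U x - c x * Prim U x" for x
  note PP = Prim_sq_integrable(2)[OF P(1)] and PU = Prim_sq_integrable(2)[OF U(1)]
    and Pe = Prim_sq_integrable(2)[OF e]
  have r: "sq_integrable Om r" and rr: "sq_integrable Om rr"
    unfolding r_def rr_def
    by (intro sq_integrable_diff sq_integrable_add f
        sq_integrable_bounded_mult(1)[OF P(1) meas(4) bd(4)] sq_integrable_bounded_mult(1)[OF U(1) meas(4) bd(4)]
        sq_integrable_bounded_mult(1)[OF P(1) meas(2) bd(2)] sq_integrable_bounded_mult(1)[OF U(1) meas(2) bd(2)]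
        sq_integrable_bounded_mult(1)[OF PP meas(3) bd(3)] sq_integrable_bounded_mult(1)[OF PU meas(3) bd(3)])+
  have r_AE: "AE x in Om. r x = fe_residual a b c f u\<^sub>h x"
    using uh_eq uh_d by eventually_elim (simp add: r_def fe_residual_def)
  have rr_AE: "AE x in Om. rr x = residual a b c f u x"
    using U(3) by eventually_elim (simp add: rr_def residual_def U_def)
  show S1: "sq_integrable Om (residual a b c f u)" by (rule sq_integrable_AE_Om(1)[OF rr rr_AE])
  show S2: "sq_integrable Om (fe_residual a b c f u\<^sub>h)" by (rule sq_integrable_AE_Om(1)[OF r r_AE])

  show "l2norm Om (\<lambda>x. residual a b c f u x - fe_residual a b c f u\<^sub>h x)
      \<le> 3 * M * Lp_norm 2 (wderiv (\<lambda>x. u x - u\<^sub>h x))"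
  proof -
    define d1 d2 d3 where "d1 x = wderiv a x * e x" and "d2 x = b x * e x" and "d3 x = c x * Prim e x" for x
    have d1: "sq_integrable Om d1" "l2norm Om d1 \<le> M * l2norm Om e"
      using sq_integrable_bounded_mult[OF e meas(4) bd(4)] M by (auto simp: d1_def[abs_def])
    have d2: "sq_integrable Om d2" "l2norm Om d2 \<le> M * l2norm Om e"
      using sq_integrable_bounded_mult[OF e meas(2) bd(2)] M by (auto simp: d2_def[abs_def])
    have d3: "sq_integrable Om d3" "l2norm Om d3 \<le> M * l2norm Om (Prim e)"
      using sq_integrable_bounded_mult[OF Pe meas(3) bd(3)] M by (auto simp: d3_def[abs_def])
    have "M * l2norm Om (Prim e) \<le> M * l2norm Om e"
      using M Prim_sq_integrable(3)[OF e] by (rule mult_left_mono[rotated])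
    with d3 have d3': "l2norm Om d3 \<le> M * l2norm Om e" by simp
    have "AE x in Om. residual a b c f u x - fe_residual a b c f u\<^sub>h x = d1 x + ((- 1) * d2 x + (- 1) * d3 x)"
      using r_AE rr_AE
    proof eventually_elim
      case (elim x)
      show ?case
        unfolding elim(1)[symmetric] elim(2)[symmetric]
        by (simp add: r_def rr_def d1_def d2_def d3_def e_def[abs_def] Prim_diff Ui Pi algebra_simps)
    qed
    then have "l2norm Om (\<lambda>x. residual a b c f u x - fe_residual a b c f u\<^sub>h x)
        = l2norm Om (\<lambda>x. d1 x + ((- 1) * d2 x + (- 1) * d3 x))"
      using S1 S2 d1(1) d2(1) d3(1)
      by (intro l2norm_cong_AE sq_integrable_measurable sq_integrable_diff sq_integrable_add sq_integrable_cmult)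
    also have "\<dots> \<le> l2norm Om d1 + l2norm Om (\<lambda>x. (- 1) * d2 x + (- 1) * d3 x)"
      by (intro l2norm_triangle sq_integrable_add sq_integrable_cmult d1(1) d2(1) d3(1))
    also have "l2norm Om (\<lambda>x. (- 1) * d2 x + (- 1) * d3 x) \<le> l2norm Om (\<lambda>x. (- 1) * d2 x) + l2norm Om (\<lambda>x. (- 1) * d3 x)"
      by (intro l2norm_triangle sq_integrable_cmult d2(1) d3(1))
    also have "\<dots> = l2norm Om d2 + l2norm Om d3" by (simp only: l2norm_cmult abs_minus_cancel abs_one mult_1)
    finally show ?thesis unfolding norm_e using d1(2) d2(2) d3' by simp
  qed

  define q where "q x = e x - stepf (emean e) x" for x
  have q: "sq_integrable Om q" unfolding q_def by (intro sq_integrable_diff e sq_integrable_stepf)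
  have qi: "integrable Om q" by (rule Om.sq_integrable_imp_integrable[OF q])
  have q0: "(LINT x|Om. indicator (K i) x * q x) = 0" if i: "i \<in> {1..N}" for i
  proof -
    have "(LINT x|Om. indicator (K i) x * q x)
        = (LINT x|Om. indicator (K i) x * e x - indicator (K i) x * stepf (emean e) x)"
      by (simp add: q_def right_diff_distrib)
    also have "\<dots> = (LINT x|Om. indicator (K i) x * e x) - (LINT x|Om. indicator (K i) x * stepf (emean e) x)"
      by (intro Bochner_Integration.integral_diff integrable_indicator_mult_Om ei integrable_stepf elem_borel)
    also have "\<dots> = 0"
      using h_pos[OF i] unfolding indicator_stepf[OF i] integral_mult_left_zero integral_elem[OF i]
      by (simp add: emean_def)
    finally show ?thesis .
  qed
  have q_mean: "integral\<^sup>L Om q = 0"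
    using integral_elem_sum[OF qi] q0 by simp
  have step_mean: "integral\<^sup>L Om (stepf (emean e)) = 0"
    using q_mean e0 ei integrable_stepf[of "emean e"] unfolding q_def by simp

  \<comment> \<open>Galerkin orthogonality: the error form vanishes on the elementwise mean of the error derivative.\<close>
  have fe_form: "form P (stepf n) = (LINT x|Om. f x * Prim (stepf n) x)" if n: "integral\<^sup>L Om (stepf n) = 0" for n
  proof -
    have v: "Prim (stepf n) \<in> fe_space N X" by (rule Prim_stepf_fe[OF n])
    have "bilin a b c u\<^sub>h (Prim (stepf n)) = form P (stepf n)"
      by (intro bilin_eq_form P(1) sq_integrable_stepf uh_eq uh_w AE_I2 refl
          Prim_imp_H10(2)[OF sq_integrable_stepf n])
    then show ?thesis using uh v by (simp add: fe_solution_def L2_inner_def)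
  qed
  have "form e e = form e q + form e (stepf (emean e))"
    using form_diff_right[OF e sq_integrable_stepf[of "emean e"] e] by (simp add: q_def[abs_def])
  also have "form e (stepf (emean e)) = 0"
    using form_diff_left[OF U(1) P(1) sq_integrable_stepf[of "emean e"]]
      weak_solution_form[OF u f sq_integrable_stepf step_mean] fe_form[OF step_mean]
    by (simp add: e_def[abs_def] U_def)
  also have "form e q + 0 = (LINT x|Om. f x * Prim q x) - form P q"
    using form_diff_left[OF U(1) P(1) q] weak_solution_form[OF u f q q_mean]
    by (simp add: e_def[abs_def] U_def)
  finally have form_e: "form e e = (LINT x|Om. f x * Prim q x) - form P q" .

  \<comment> \<open>On each element \<open>P\<close> is constant, and integration by parts produces no boundary terms.\<close>
  have by_parts: "(LINT x|Om. a x * P x * q x) = - (LINT x|Om. wderiv a x * P x * Prim q x)"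
  proof -
    have ai: "integrable Om (wderiv a)" by (rule bounded_integrable_Om(2)[OF meas(4) bd(4)])
    have i1: "integrable Om (\<lambda>x. a x * P x * q x)"
      by (rule form_terms_integrable(1)[OF P(1) q])
    have i2: "integrable Om (\<lambda>x. wderiv a x * P x * Prim q x)"
      by (rule sq_integrable_mult[OF sq_integrable_bounded_mult(1)[OF P(1) meas(4) bd(4)] Prim_sq_integrable(2)[OF q]])
    have elem: "(LINT x|Om. indicator (K i) x * (a x * P x * q x))
        = - (LINT x|Om. indicator (K i) x * (wderiv a x * P x * Prim q x))" if i: "i \<in> {1..N}" for i
    proof -
      define k where "k x = indicator (K i) x * q x" for x
      have ki: "integrable Om k" unfolding k_def by (intro integrable_indicator_mult_Om qi elem_borel)
      have k0: "integral\<^sup>L Om k = 0" unfolding k_def by (rule q0[OF i])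
      note parts = integration_by_parts_Prim[OF ai ki]
      have "(LINT x|Om. indicator (K i) x * (a x * P x * q x))
          = (LINT x|Om. m i * (ca * k x + Prim (wderiv a) x * k x))"
      proof (rule integrable_AE_Om(2))
        show "AE x in Om. m i * (ca * k x + Prim (wderiv a) x * k x) = indicator (K i) x * (a x * P x * q x)"
          using a_eq
        proof eventually_elim
          case (elim x)
          show ?case
            by (cases "x \<in> K i") (use elim in \<open>auto simp: k_def P_def stepf_elem[OF i] algebra_simps\<close>)
        qed
      qed (use ki parts in simp)
      also have "\<dots> = m i * (ca * integral\<^sup>L Om k + (LINT x|Om. Prim (wderiv a) x * k x))"
        using ki parts(2) by simp
      also have "\<dots> = - (m i * (LINT x|Om. wderiv a x * Prim k x))"
        using parts(3) k0 by (simp add: eq_neg_iff_add_eq_0 flip: distrib_left)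
      also have "m i * (LINT x|Om. wderiv a x * Prim k x) = (LINT x|Om. m i * (wderiv a x * Prim k x))"
        by simp
      also have "\<dots> = (LINT x|Om. indicator (K i) x * (wderiv a x * P x * Prim q x))"
      proof (rule integrable_AE_Om(2)[symmetric])
        show "integrable Om (\<lambda>x. m i * (wderiv a x * Prim k x))" using parts(1) by simp
        show "AE x in Om. m i * (wderiv a x * Prim k x) = indicator (K i) x * (wderiv a x * P x * Prim q x)"
          using AE_elem
        proof eventually_elim
          case (elim x)
          then obtain j where j: "j \<in> {1..N}" "x \<in> K j" by blast
          have "Prim k x = indicator (K i) x * Prim q x"
            unfolding k_def by (rule Prim_elem_restrict[OF qi q0 i j])
          then show ?case
            by (cases "x \<in> K i") (auto simp: P_def stepf_elem[OF i])
        qed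
      qed
      finally show ?thesis .
    qed
    show ?thesis
      unfolding integral_elem_sum[OF i1] integral_elem_sum[OF i2] by (simp add: elem sum_negf)
  qed
  have Pq: "sq_integrable Om (Prim q)" by (rule Prim_sq_integrable(2)[OF q])
  have rW: "form e e = (LINT x|Om. r x * Prim q x)"
  proof -
    have i: "integrable Om (\<lambda>x. f x * Prim q x)" "integrable Om (\<lambda>x. wderiv a x * P x * Prim q x)"
      "integrable Om (\<lambda>x. b x * P x * Prim q x)" "integrable Om (\<lambda>x. c x * Prim P x * Prim q x)"
      by (rule sq_integrable_mult[OF f Pq],
          rule sq_integrable_mult[OF sq_integrable_bounded_mult(1)[OF P(1) meas(4) bd(4)] Pq],
          rule form_terms_integrable(2)[OF P(1) q], rule form_terms_integrable(3)[OF P(1) q])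
    have "(LINT x|Om. r x * Prim q x) = (LINT x|Om. f x * Prim q x + wderiv a x * P x * Prim q x
        - b x * P x * Prim q x - c x * Prim P x * Prim q x)"
      by (intro Bochner_Integration.integral_cong) (auto simp: r_def algebra_simps)
    also have "\<dots> = (LINT x|Om. f x * Prim q x) + (LINT x|Om. wderiv a x * P x * Prim q x)
        - (LINT x|Om. b x * P x * Prim q x) - (LINT x|Om. c x * Prim P x * Prim q x)"
      using i by simp
    finally show ?thesis unfolding form_e form_eq[OF P(1) q] by_parts by simp
  qed
  have elem_bound: "(LINT x|Om. indicator (K i) x * (r x * Prim q x)) \<le> (h i * enorm r i) * (2 * enorm e i)"
    if i: "i \<in> {1..N}" for i
  proof -
    have eq: "(\<lambda>x. indicator (K i) x * (r x * Prim q x)) =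
        (\<lambda>x. (indicator (K i) x * r x) * (indicator (K i) x * Prim q x))"
      by (auto simp: indicator_def)
    have "(LINT x|Om. indicator (K i) x * (r x * Prim q x)) \<le> enorm r i * enorm (Prim q) i"
      using Cauchy_Schwarz_LINT[OF sq_integrable_indicator_mult_Om[OF r elem_borel[of i]]
          sq_integrable_indicator_mult_Om[OF Pq elem_borel[of i]]]
      unfolding eq enorm_def by linarith
    also have "\<dots> \<le> enorm r i * (h i * (2 * enorm e i))"
    proof (intro mult_left_mono enorm_nonneg)
      have "enorm (Prim q) i \<le> h i * enorm q i" by (rule enorm_Prim[OF q q0 i])
      also have "\<dots> \<le> h i * (2 * enorm e i)"
        using enorm_emean[OF e i] h_pos[OF i] unfolding q_def[abs_def] by (intro mult_left_mono) auto
      finally show "enorm (Prim q) i \<le> h i * (2 * enorm e i)" .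
    qed
    finally show ?thesis by (simp add: mult_ac)
  qed
  define A where "A = (\<Sum>i=1..N. (h i * enorm r i)\<^sup>2)"
  have "a0 * (l2norm Om e)\<^sup>2 \<le> form e e" by (rule form_coercive[OF e e0])
  also have "\<dots> = (\<Sum>i=1..N. LINT x|Om. indicator (K i) x * (r x * Prim q x))"
    unfolding rW by (rule integral_elem_sum[OF sq_integrable_mult[OF r Pq]])
  also have "\<dots> \<le> (\<Sum>i=1..N. (h i * enorm r i) * (2 * enorm e i))"
    by (intro sum_mono elem_bound)
  also have "\<dots> \<le> sqrt (A * (\<Sum>i=1..N. (2 * enorm e i)\<^sup>2))"
    unfolding A_def by (rule real_le_rsqrt, rule Cauchy_Schwarz_ineq_sum)
  also have "(\<Sum>i=1..N. (2 * enorm e i)\<^sup>2) = 4 * (l2norm Om e)\<^sup>2"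
    unfolding power_mult_distrib enorm_sq_sum[OF e, symmetric] sum_distrib_left by simp
  also have "sqrt (A * (4 * (l2norm Om e)\<^sup>2)) = 2 * sqrt A * l2norm Om e"
    by (simp add: real_sqrt_mult)
  finally have fin: "a0 * (l2norm Om e)\<^sup>2 \<le> 2 * sqrt A * l2norm Om e" .
  have A0: "0 \<le> A" unfolding A_def by (intro sum_nonneg) auto
  have le: "a0 * l2norm Om e \<le> 2 * sqrt A"
  proof (cases "l2norm Om e = 0")
    case True
    then show ?thesis using A0 by simp
  next
    case False
    then have "0 < l2norm Om e" using l2norm_nonneg[of Om e] by linarith
    then show ?thesis
      using fin by (simp add: power2_eq_square mult.assoc[symmetric])
  qed
  have en: "enorm (fe_residual a b c f u\<^sub>h) i = enorm r i" for i
    unfolding enorm_def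
  proof (rule sq_integrable_AE_Om(2)[OF sq_integrable_indicator_mult_Om[OF r elem_borel]])
    show "AE x in Om. indicator (K i) x * r x = indicator (K i) x * fe_residual a b c f u\<^sub>h x"
      using r_AE by eventually_elim simp
  qed
  have "A = (\<Sum>i=1..N. h i ^ 3 * (elem_mean X (fe_residual a b c f u\<^sub>h) i)\<^sup>2)"
    unfolding A_def
  proof (rule sum.cong[OF refl])
    fix i assume i: "i \<in> {1..N}"
    show "(h i * enorm r i)\<^sup>2 = h i ^ 3 * (elem_mean X (fe_residual a b c f u\<^sub>h) i)\<^sup>2"
      using h_elem_mean_sq[OF i, of "fe_residual a b c f u\<^sub>h"]
      by (simp add: en power_mult_distrib power3_eq_cube power2_eq_square mult.assoc)
  qed
  with le show "a0 * Lp_norm 2 (wderiv (\<lambda>x. u x - u\<^sub>h x))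
      \<le> 2 * sqrt (\<Sum>i=1..N. h i ^ 3 * (elem_mean X (fe_residual a b c f u\<^sub>h) i)\<^sup>2)"
    unfolding norm_e by simp
qed

end

section \<open>Concave powers and equidistributing meshes\<close>

text \<open>A concave power lies below its tangent at \<open>m\<close>.\<close>

lemma powr_le_tangent:
  fixes y m p :: real
  assumes y: "0 \<le> y" and m: "0 < m" and p: "0 < p" "p < 1"
  shows "y powr p \<le> (1 - p) * m powr p + p * m powr (p - 1) * y"
proof (cases "y = 0")
  case True
  then show ?thesis using m p by simp
next
  case False
  have "y powr p * m powr (1 - p) \<le> p * y + (1 - p) * m"
    by (rule Youngs_inequality_0) (use False y m p in auto)
  then have "m powr (p - 1) * (y powr p * m powr (1 - p)) \<le> m powr (p - 1) * (p * y + (1 - p) * m)"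
    by (intro mult_left_mono) auto
  also have "m powr (p - 1) * (y powr p * m powr (1 - p)) = y powr p * (m powr (p - 1) * m powr (1 - p))"
    by (simp only: mult_ac)
  also have "m powr (p - 1) * m powr (1 - p) = 1"
    using m by (simp add: powr_add[symmetric])
  also have "m powr (p - 1) * (p * y + (1 - p) * m) = (1 - p) * (m powr (p - 1) * m) + p * m powr (p - 1) * y"
    by (simp add: algebra_simps)
  also have "m powr (p - 1) * m = m powr p"
    using m by (simp add: powr_mult_base mult.commute)
  finally show ?thesis by simp
qed

lemma powr_add_le:
  fixes y z p :: real
  assumes "0 \<le> y" "0 \<le> z" "0 < p" "p \<le> 1"
  shows "(y + z) powr p \<le> y powr p + z powr p"
proof (cases "y + z = 0")
  case True
  then show ?thesis by simp
next
  case False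
  then have s: "0 < y + z" using assms by linarith
  have le: "t \<le> t powr p" if "0 \<le> t" "t \<le> 1" for t :: real
    using powr_mono'[of p 1 t] that assms by (cases "t = 0") auto
  have "(y + z) powr p = (y + z) powr p * (y / (y + z) + z / (y + z))"
    using s by (simp flip: add_divide_distrib)
  also have "\<dots> \<le> (y + z) powr p * ((y / (y + z)) powr p + (z / (y + z)) powr p)"
    using assms s by (intro mult_left_mono add_mono le) auto
  also have "\<dots> = y powr p + z powr p"
    using assms s by (simp add: distrib_left powr_divide)
  finally show ?thesis .
qed

lemma integrable_powr_Om:
  fixes f :: "real \<Rightarrow> real"
  assumes f: "integrable Om f" and nn: "\<And>x. 0 \<le> f x" and p: "0 < p" "p < 1"
  shows "integrable Om (\<lambda>x. f x powr p)"
proof (rule Bochner_Integration.integrable_bound)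
  show "integrable Om (\<lambda>x. (1 - p) + p * f x)" using f by simp
  show "(\<lambda>x. f x powr p) \<in> borel_measurable Om"
    using borel_measurable_integrable[OF f] by measurable
  have "f x powr p \<le> (1 - p) + p * f x" for x
    using powr_le_tangent[OF nn, of 1 p x] p by simp
  moreover have "0 \<le> (1 - p) + p * f x" for x
    using nn[of x] p by simp
  ultimately show "AE x in Om. norm (f x powr p) \<le> norm ((1 - p) + p * f x)" by simp
qed

text \<open>Jensen's inequality for the mean value over \<open>A\<close>: integrate the tangent inequality at this mean value.\<close>

lemma Jensen_powr_Om:
  fixes f :: "real \<Rightarrow> real"
  assumes f: "integrable Om f" and nn: "\<And>x. 0 \<le> f x" and p: "0 < p" "p < 1"
    and A: "A \<in> sets borel" and h: "(LINT x|Om. indicator A x) = h" "0 < h"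
  shows "(LINT x|Om. indicator A x * f x powr p) \<le> h * ((LINT x|Om. indicator A x * f x) / h) powr p"
proof -
  define m where "m = (LINT x|Om. indicator A x * f x) / h"
  have Af: "integrable Om (\<lambda>x. indicator A x * f x)" by (rule integrable_indicator_mult_Om[OF f A])
  have A1: "integrable Om (indicator A :: real \<Rightarrow> real)"
    using integrable_indicator_mult_Om[of "\<lambda>x. 1" A] A by simp
  have "0 \<le> m" unfolding m_def using h nn by (intro divide_nonneg_pos Bochner_Integration.integral_nonneg) auto
  show ?thesis
  proof (cases "m = 0")
    case True
    then have "(LINT x|Om. indicator A x * f x) = 0" using h by (simp add: m_def)
    then have "AE x in Om. indicator A x * f x = 0"
      using integral_nonneg_eq_0_iff_AE[OF Af] nn by simp
    then have "AE x in Om. indicator A x * f x powr p = 0"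
      by eventually_elim (auto simp: indicator_def)
    then have "(LINT x|Om. indicator A x * f x powr p) = 0" by (rule integral_eq_zero_AE)
    then show ?thesis using h by simp
  next
    case False
    with \<open>0 \<le> m\<close> have m: "0 < m" by simp
    have "(LINT x|Om. indicator A x * f x powr p)
        \<le> (LINT x|Om. (1 - p) * m powr p * indicator A x + p * m powr (p - 1) * (indicator A x * f x))"
    proof (rule integral_mono)
      show "integrable Om (\<lambda>x. indicator A x * f x powr p)"
        by (intro integrable_indicator_mult_Om integrable_powr_Om f nn p A)
      show "integrable Om (\<lambda>x. (1 - p) * m powr p * indicator A x + p * m powr (p - 1) * (indicator A x * f x))"
        using Af A1 by simp
      show "indicator A x * f x powr p
          \<le> (1 - p) * m powr p * indicator A x + p * m powr (p - 1) * (indicator A x * f x)" for x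
        using powr_le_tangent[OF nn m p, of x] by (cases "x \<in> A") auto
    qed
    also have "\<dots> = (1 - p) * m powr p * (LINT x|Om. indicator A x)
        + p * m powr (p - 1) * (LINT x|Om. indicator A x * f x)"
      using Af A1 by (simp del: Bochner_Integration.integral_indicator)
    also have "\<dots> = (1 - p) * m powr p * h + p * (m powr (p - 1) * m) * h"
      using h by (simp add: m_def)
    also have "m powr (p - 1) * m = m powr p"
      using m by (simp add: powr_mult_base mult.commute)
    finally show ?thesis by (simp add: m_def algebra_simps)
  qed
qed

context mesh
begin

text \<open>The discrete counterpart of the integral of the power \<open>2/3\<close> of \<open>\<bar>g\<bar>\<close>; \<open>mesh_alpha\<close> is its third power.\<close>

definition S :: "(real \<Rightarrow> real) \<Rightarrow> real"
  where "S g = (\<Sum>i=1..N. h i * elem_mean X g i powr (2/3))"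

lemma S_nonneg: "0 \<le> S g"
  unfolding S_def using h_pos by (intro sum_nonneg mult_nonneg_nonneg) (auto intro: less_imp_le)

lemma mesh_alpha_S: "mesh_alpha N X g = S g ^ 3"
  by (simp add: mesh_alpha_def S_def)

lemma sqrt_mesh_alpha: "sqrt (mesh_alpha N X g) = S g powr (3/2)"
proof (cases "S g = 0")
  case True
  then show ?thesis by (simp add: mesh_alpha_S)
next
  case False
  then have "0 < S g" using S_nonneg[of g] by simp
  then show ?thesis
    by (simp add: mesh_alpha_S powr_powr flip: powr_half_sqrt powr_numeral)
qed

lemma Jensen_powr_sum:
  assumes y: "\<And>i. 0 \<le> y i" and p: "0 < p" "p < 1"
  shows "(\<Sum>i=1..N. h i * y i powr p) \<le> (\<Sum>i=1..N. h i * y i) powr p"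
proof -
  have nn: "0 \<le> stepf y x" for x
    unfolding stepf_def using y by (intro sum_nonneg) auto
  have "(LINT x|Om. indicator UNIV x * stepf y x powr p) \<le> 1 * ((LINT x|Om. indicator UNIV x * stepf y x) / 1) powr p"
    by (rule Jensen_powr_Om[OF integrable_stepf nn p]) (use measure_Om in simp_all)
  moreover have "(LINT x|Om. stepf y x powr p) = (\<Sum>i=1..N. h i * y i powr p)"
  proof -
    have "(LINT x|Om. stepf y x powr p) = integral\<^sup>L Om (stepf (\<lambda>i. y i powr p))"
    proof (rule integrable_AE_Om(2)[OF integrable_stepf])
      show "AE x in Om. stepf (\<lambda>i. y i powr p) x = stepf y x powr p"
        using AE_elem by eventually_elim (auto simp: stepf_elem)
    qed
    then show ?thesis by (simp add: integral_stepf mult.commute)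
  qed
  ultimately show ?thesis by (simp add: integral_stepf mult.commute)
qed

lemma S_triangle:
  assumes f: "sq_integrable Om f" and g: "sq_integrable Om g"
  shows "S f \<le> S g + l2norm Om (\<lambda>x. f x - g x) powr (2/3)"
proof -
  define d where "d x = f x - g x" for x
  have d: "sq_integrable Om d" unfolding d_def by (intro sq_integrable_diff f g)
  have "h i * elem_mean X f i powr (2/3)
      \<le> h i * elem_mean X g i powr (2/3) + h i * elem_mean X d i powr (2/3)" if i: "i \<in> {1..N}" for i
  proof -
    have "enorm f i \<le> enorm g i + enorm d i"
      using enorm_triangle[OF g d, of i] by (simp add: d_def)
    then have "elem_mean X f i \<le> elem_mean X g i + elem_mean X d i"
      using h_pos[OF i] by (simp add: elem_mean_eq[OF i] divide_right_mono flip: add_divide_distrib)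
    then have "elem_mean X f i powr (2/3) \<le> (elem_mean X g i + elem_mean X d i) powr (2/3)"
      using elem_mean_nonneg[OF i] by (intro powr_mono2) auto
    also have "\<dots> \<le> elem_mean X g i powr (2/3) + elem_mean X d i powr (2/3)"
      by (rule powr_add_le) (use elem_mean_nonneg[OF i] in auto)
    finally show ?thesis
      using h_pos[OF i] by (simp flip: distrib_left)
  qed
  then have "S f \<le> S g + S d"
    unfolding S_def sum.distrib[symmetric] by (rule sum_mono)
  moreover have "S d \<le> l2norm Om d powr (2/3)"
  proof -
    have "S d = (\<Sum>i=1..N. h i * ((elem_mean X d i)\<^sup>2) powr (1/3))"
    proof -
      have "elem_mean X d i powr (2/3) = ((elem_mean X d i)\<^sup>2) powr (1/3)" if "i \<in> {1..N}" for i
        using elem_mean_nonneg[OF that, of d]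
        by (cases "elem_mean X d i = 0") (simp_all add: powr_powr flip: powr_numeral)
      then show ?thesis by (simp add: S_def)
    qed
    also have "\<dots> \<le> (\<Sum>i=1..N. h i * (elem_mean X d i)\<^sup>2) powr (1/3)"
      by (rule Jensen_powr_sum) auto
    also have "(\<Sum>i=1..N. h i * (elem_mean X d i)\<^sup>2) = (l2norm Om d)\<^sup>2"
      unfolding enorm_sq_sum[OF d, symmetric] by (intro sum.cong refl h_elem_mean_sq)
    also have "((l2norm Om d)\<^sup>2) powr (1/3) = l2norm Om d powr (2/3)"
      using l2norm_nonneg[of Om d]
      by (cases "l2norm Om d = 0") (simp_all add: powr_powr flip: powr_numeral)
    finally show ?thesis .
  qed
  ultimately show ?thesis unfolding d_def by simp
qed

text \<open>By concavity, \<open>S\<close> is at least its continuous counterpart.\<close>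

lemma integral_powr_le_S:
  assumes f: "sq_integrable Om f"
  shows "(LINT x|Om. \<bar>f x\<bar> powr (2/3)) \<le> S f"
proof -
  have f2: "integrable Om (\<lambda>x. (f x)\<^sup>2)" using f by (simp add: sq_integrable_def)
  have eq: "\<bar>y\<bar> powr (2/3) = (y\<^sup>2) powr (1/3)" for y :: real
  proof (cases "y = 0")
    case False
    then have "(y\<^sup>2) powr (1/3) = (\<bar>y\<bar> powr 2) powr (1/3)" by (simp add: powr_2_abs)
    also have "\<dots> = \<bar>y\<bar> powr (2/3)" by (simp only: powr_powr) simp
    finally show ?thesis ..
  qed simp
  have i: "integrable Om (\<lambda>x. \<bar>f x\<bar> powr (2/3))"
    unfolding eq by (rule integrable_powr_Om[OF f2]) auto
  have "(LINT x|Om. indicator (K i) x * \<bar>f x\<bar> powr (2/3)) \<le> h i * elem_mean X f i powr (2/3)"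
    if i: "i \<in> {1..N}" for i
  proof -
    have e: "(LINT x|Om. indicator (K i) x * (f x)\<^sup>2) = h i * (elem_mean X f i)\<^sup>2"
      unfolding h_elem_mean_sq[OF i] enorm_def l2norm_sq
      by (intro Bochner_Integration.integral_cong) (auto simp: indicator_def)
    have "(LINT x|Om. indicator (K i) x * ((f x)\<^sup>2) powr (1/3))
        \<le> h i * ((LINT x|Om. indicator (K i) x * (f x)\<^sup>2) / h i) powr (1/3)"
      by (rule Jensen_powr_Om[OF f2 _ _ _ elem_borel integral_elem[OF i] h_pos[OF i]]) auto
    also have "(LINT x|Om. indicator (K i) x * (f x)\<^sup>2) / h i = (elem_mean X f i)\<^sup>2"
      using e h_pos[OF i] by simp
    also have "((elem_mean X f i)\<^sup>2) powr (1/3) = elem_mean X f i powr (2/3)"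
      using eq[of "elem_mean X f i"] elem_mean_nonneg[OF i, of f] by simp
    finally show ?thesis by (simp add: eq)
  qed
  then show ?thesis
    unfolding integral_elem_sum[OF i] S_def by (rule sum_mono)
qed

text \<open>Conversely, for a function with integrable derivative the difference is controlled by the
  oscillation on the elements.\<close>

lemma S_le_integral_powr:
  assumes g: "integrable Om g" and r: "AE x in Om. r x = k + Prim g x" and r2: "sq_integrable Om r"
    and H: "\<And>i. i \<in> {1..N} \<Longrightarrow> h i \<le> H"
  shows "S r \<le> (LINT x|Om. \<bar>r x\<bar> powr (2/3)) + (H * (LINT x|Om. \<bar>g x\<bar>)) powr (2/3)"
proof -
  define R where "R x = k + Prim g x" for x
  define w where "w i = (LINT x|Om. indicator (K i) x * \<bar>g x\<bar>)" for i
  have gi: "integrable Om (\<lambda>x. \<bar>g x\<bar>)" using g by simp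
  have w0: "0 \<le> w i" for i
    unfolding w_def by (intro Bochner_Integration.integral_nonneg) auto
  have rR: "AE x in Om. r x = R x" using r by (simp add: R_def)
  have R2: "sq_integrable Om R" by (rule sq_integrable_AE_Om(1)[OF r2 rR])
  have eR: "enorm r i = enorm R i" for i
    unfolding enorm_def
  proof (rule sq_integrable_AE_Om(2)[OF sq_integrable_indicator_mult_Om[OF R2 elem_borel]])
    show "AE x in Om. indicator (K i) x * R x = indicator (K i) x * r x"
      using rR by eventually_elim simp
  qed
  have SR: "S r = S R" unfolding S_def by (intro sum.cong refl) (simp add: elem_mean_eq eR)
  have R1: "integrable Om R" by (rule Om.sq_integrable_imp_integrable[OF R2])
  have Ri: "integrable Om (\<lambda>x. \<bar>R x\<bar> powr (2/3))"
    using R1 by (intro integrable_powr_Om) auto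
  have IR: "(LINT x|Om. \<bar>r x\<bar> powr (2/3)) = (LINT x|Om. \<bar>R x\<bar> powr (2/3))"
    by (rule integrable_AE_Om(2)[OF Ri]) (use rR in \<open>eventually_elim, simp\<close>)
  have osc: "\<bar>R x\<bar> \<le> \<bar>R y\<bar> + w i" if i: "i \<in> {1..N}" and xy: "x \<in> K i" "y \<in> K i" for i x y
  proof -
    have le: "\<bar>Prim g t - Prim g s\<bar> \<le> w i" if st: "s \<in> K i" "t \<in> K i" "s \<le> t" for s t
    proof -
      have "\<bar>Prim g t - Prim g s\<bar> \<le> (LINT x|Om. \<bar>indicator {s<..t} x * g x\<bar>)"
        unfolding Prim_diff_eq[OF g st(3)] by (rule integral_abs_bound)
      also have "\<dots> \<le> w i"
        unfolding w_def
      proof (intro integral_mono)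
        show "integrable Om (\<lambda>x. \<bar>indicator {s<..t} x * g x\<bar>)"
          by (intro integrable_abs integrable_indicator_mult_Om g) simp
        show "integrable Om (\<lambda>x. indicator (K i) x * \<bar>g x\<bar>)"
          by (intro integrable_indicator_mult_Om gi elem_borel)
        show "\<bar>indicator {s<..t} x * g x\<bar> \<le> indicator (K i) x * \<bar>g x\<bar>" for x
          using st by (auto simp: indicator_def mesh_elem_def)
      qed
      finally show ?thesis .
    qed
    have "\<bar>Prim g x - Prim g y\<bar> \<le> w i"
      using le[of x y] le[of y x] xy by (cases "x \<le> y") auto
    then show ?thesis unfolding R_def by linarith
  qed
  have elem: "h i * elem_mean X R i powr (2/3)
      \<le> (LINT x|Om. indicator (K i) x * \<bar>R x\<bar> powr (2/3)) + h i * w i powr (2/3)" if i: "i \<in> {1..N}" for i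
  proof -
    have pt: "elem_mean X R i powr (2/3) - w i powr (2/3) \<le> \<bar>R y\<bar> powr (2/3)" if y: "y \<in> K i" for y
    proof -
      have "enorm R i \<le> sqrt (h i) * (\<bar>R y\<bar> + w i)"
        using osc[OF i _ y] w0[of i] by (intro enorm_const_on[OF i] sq_integrable_measurable R2) auto
      then have "elem_mean X R i \<le> \<bar>R y\<bar> + w i"
        using h_pos[OF i] by (simp add: elem_mean_eq[OF i] divide_le_eq mult.commute)
      then have "elem_mean X R i powr (2/3) \<le> (\<bar>R y\<bar> + w i) powr (2/3)"
        using elem_mean_nonneg[OF i] by (intro powr_mono2) auto
      also have "\<dots> \<le> \<bar>R y\<bar> powr (2/3) + w i powr (2/3)"
        using w0 by (intro powr_add_le) auto
      finally show ?thesis by simp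
    qed
    have A1: "integrable Om (indicator (K i) :: real \<Rightarrow> real)"
      using integrable_indicator_mult_Om[of "\<lambda>x. 1" "K i"] by simp
    have "(LINT x|Om. indicator (K i) x * (elem_mean X R i powr (2/3) - w i powr (2/3)))
        \<le> (LINT x|Om. indicator (K i) x * \<bar>R x\<bar> powr (2/3))"
    proof (rule integral_mono)
      show "integrable Om (\<lambda>x. indicator (K i) x * (elem_mean X R i powr (2/3) - w i powr (2/3)))"
        using A1 by (rule integrable_mult_left)
      show "integrable Om (\<lambda>x. indicator (K i) x * \<bar>R x\<bar> powr (2/3))"
        by (intro integrable_indicator_mult_Om Ri elem_borel)
      show "indicator (K i) x * (elem_mean X R i powr (2/3) - w i powr (2/3))
          \<le> indicator (K i) x * \<bar>R x\<bar> powr (2/3)" for x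
        using pt[of x] by (cases "x \<in> K i") auto
    qed
    then show ?thesis
      unfolding integral_mult_left_zero integral_elem[OF i] by (simp add: algebra_simps)
  qed
  have "S R \<le> (\<Sum>i=1..N. (LINT x|Om. indicator (K i) x * \<bar>R x\<bar> powr (2/3)) + h i * w i powr (2/3))"
    unfolding S_def by (intro sum_mono elem)
  also have "\<dots> = (LINT x|Om. \<bar>R x\<bar> powr (2/3)) + (\<Sum>i=1..N. h i * w i powr (2/3))"
    unfolding integral_elem_sum[OF Ri] by (rule sum.distrib)
  also have "(\<Sum>i=1..N. h i * w i powr (2/3)) \<le> (\<Sum>i=1..N. H powr (2/3) * (h i * (w i / h i) powr (2/3)))"
  proof (rule sum_mono)
    fix i assume i: "i \<in> {1..N}"
    have "w i powr (2/3) = h i powr (2/3) * (w i / h i) powr (2/3)"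
      using h_pos[OF i] w0[of i] by (simp flip: powr_mult)
    also have "\<dots> \<le> H powr (2/3) * (w i / h i) powr (2/3)"
      using h_pos[OF i] H[OF i] by (intro mult_right_mono powr_mono2) auto
    finally have "h i * w i powr (2/3) \<le> h i * (H powr (2/3) * (w i / h i) powr (2/3))"
      using h_pos[OF i] by (intro mult_left_mono) auto
    then show "h i * w i powr (2/3) \<le> H powr (2/3) * (h i * (w i / h i) powr (2/3))"
      by (simp add: mult_ac)
  qed
  also have "\<dots> = H powr (2/3) * (\<Sum>i=1..N. h i * (w i / h i) powr (2/3))"
    by (rule sum_distrib_left[symmetric])
  also have "\<dots> = H powr (2/3) * (\<Sum>i=1..N. h i * \<bar>w i / h i\<bar> powr (2/3))"
    using h_pos w0 by (simp add: less_imp_le)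
  also have "\<dots> \<le> H powr (2/3) * (\<Sum>i=1..N. h i * \<bar>w i / h i\<bar>) powr (2/3)"
    by (intro mult_left_mono Jensen_powr_sum) auto
  also have "(\<Sum>i=1..N. h i * \<bar>w i / h i\<bar>) = (\<Sum>i=1..N. w i)"
    using h_pos w0 by (intro sum.cong refl) (auto simp: less_le)
  also have "(\<Sum>i=1..N. w i) = (LINT x|Om. \<bar>g x\<bar>)"
    unfolding w_def by (rule integral_elem_sum[symmetric, OF gi])
  also have "H powr (2/3) * (LINT x|Om. \<bar>g x\<bar>) powr (2/3) = (H * (LINT x|Om. \<bar>g x\<bar>)) powr (2/3)"
    by (rule powr_mult[symmetric])
  finally show ?thesis unfolding SR IR by simp
qed

text \<open>The sum of the \<open>\<rho>\<^sub>i h\<^sub>i\<close> is at most \<open>2\<close>, and \<open>\<rho>\<^sub>i \<ge> 1\<close>. In the degenerate case \<open>\<alpha>\<^sub>h = 0\<close> all local means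
  vanish, and division by zero yields \<open>\<rho>\<^sub>i = 1\<close>, so that both bounds remain valid.\<close>

lemma equidistributing_bounds:
  assumes "equidistributing N X g"
  shows "\<And>i. i \<in> {1..N} \<Longrightarrow> h i \<le> 2 / real N"
    "(\<Sum>i=1..N. h i ^ 3 * (elem_mean X g i)\<^sup>2) \<le> 8 * mesh_alpha N X g / (real N)\<^sup>2"
proof -
  define E where "E = elem_mean X g"
  define al where "al = mesh_alpha N X g"
  define rho where "rho = mesh_rho N X g"
  define sg where "sg = mesh_sigma N X g"
  have rho: "rho i = (1 + (E i)\<^sup>2 / al) powr (1/3)" for i
    by (simp add: rho_def mesh_rho_def E_def al_def)
  have E0: "0 \<le> E i" if "i \<in> {1..N}" for i using elem_mean_nonneg[OF that] by (simp add: E_def)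
  have al: "al = S g ^ 3" by (simp add: al_def mesh_alpha_S)
  have al0: "0 \<le> al" using S_nonneg[of g] by (simp add: al)
  have N: "0 < real N" using N_pos by simp
  have rho1: "1 \<le> rho i" for i
    unfolding rho using al0 by (intro ge_one_powr_ge_zero) auto
  have E_le: "(E i)\<^sup>2 \<le> al * rho i ^ 3" if i: "i \<in> {1..N}" for i
  proof (cases "S g = 0")
    case True
    have "(\<Sum>i=1..N. h i * E i powr (2/3)) = 0" using True by (simp add: S_def E_def)
    then have "\<forall>i\<in>{1..N}. h i * E i powr (2/3) = 0"
      by (subst (asm) sum_nonneg_eq_0_iff) (auto simp: less_imp_le h_pos)
    then have "h i * E i powr (2/3) = 0" using i by blast
    then show ?thesis using h_pos[OF i] True by (simp add: al)
  next
    case False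
    then have "0 < al" using S_nonneg[of g] by (simp add: al)
    have "rho i ^ 3 = 1 + (E i)\<^sup>2 / al"
      unfolding rho using al0 by (simp add: powr_powr flip: powr_numeral)
    then show ?thesis using \<open>0 < al\<close> by (simp add: field_simps)
  qed
  have sg2: "sg \<le> 2"
  proof (cases "S g = 0")
    case True
    then have "rho i = 1" for i by (simp add: rho al)
    then show ?thesis using sum_h by (simp add: sg_def mesh_sigma_def rho_def)
  next
    case False
    then have S: "0 < S g" using S_nonneg[of g] by simp
    have "rho i \<le> 1 + E i powr (2/3) / S g" if i: "i \<in> {1..N}" for i
    proof -
      have "rho i \<le> 1 powr (1/3) + ((E i)\<^sup>2 / al) powr (1/3)"
        unfolding rho using al0 by (intro powr_add_le) auto
      also have "((E i)\<^sup>2 / al) powr (1/3) = ((E i)\<^sup>2) powr (1/3) / al powr (1/3)"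
        using al0 by (simp add: powr_divide)
      also have "((E i)\<^sup>2) powr (1/3) = E i powr (2/3)"
        using E0[OF i] by (cases "E i = 0") (simp_all add: powr_powr flip: powr_numeral)
      also have "al powr (1/3) = S g"
        unfolding al using S by (simp add: powr_powr flip: powr_numeral)
      finally show ?thesis by simp
    qed
    then have "sg \<le> (\<Sum>i=1..N. (1 + E i powr (2/3) / S g) * h i)"
      unfolding sg_def mesh_sigma_def rho_def[symmetric]
      using h_pos by (intro sum_mono mult_right_mono) (auto intro: less_imp_le)
    also have "\<dots> = (\<Sum>i=1..N. h i) + (\<Sum>i=1..N. h i * E i powr (2/3)) / S g"
      by (simp add: sum.distrib sum_divide_distrib algebra_simps)
    also have "\<dots> = 2" using S sum_h by (simp add: S_def E_def)
    finally show ?thesis .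
  qed
  have eq: "rho i * h i = sg / real N" if "i \<in> {1..N}" for i
    using assms that by (simp add: equidistributing_def rho_def sg_def)
  have rh: "rho i * h i \<le> 2 / real N" if i: "i \<in> {1..N}" for i
    unfolding eq[OF i] using sg2 N by (simp add: divide_right_mono)
  show "h i \<le> 2 / real N" if i: "i \<in> {1..N}" for i
    using mult_right_mono[OF rho1[of i] less_imp_le[OF h_pos[OF i]]] rh[OF i] by simp
  have "(\<Sum>i=1..N. h i ^ 3 * (E i)\<^sup>2) \<le> (\<Sum>i=1..N. al * (2 / real N) ^ 3)"
  proof (rule sum_mono)
    fix i assume i: "i \<in> {1..N}"
    have "h i ^ 3 * (E i)\<^sup>2 \<le> h i ^ 3 * (al * rho i ^ 3)"
      using E_le[OF i] h_pos[OF i] by (intro mult_left_mono) auto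
    also have "\<dots> = al * (rho i * h i) ^ 3" by (simp add: power_mult_distrib)
    also have "\<dots> \<le> al * (2 / real N) ^ 3"
      using al0 rho1[of i] h_pos[OF i] by (intro mult_left_mono power_mono rh[OF i]) auto
    finally show "h i ^ 3 * (E i)\<^sup>2 \<le> al * (2 / real N) ^ 3" .
  qed
  also have "\<dots> = 8 * al / (real N)\<^sup>2"
    using N by (simp add: power_divide power3_eq_cube power2_eq_square)
  finally show "(\<Sum>i=1..N. h i ^ 3 * (elem_mean X g i)\<^sup>2) \<le> 8 * mesh_alpha N X g / (real N)\<^sup>2"
    by (simp add: E_def al_def)
qed

end

text \<open>Convergence for a fixed square integrable function, by density of the test functions.\<close>

lemma integral_powr_triangle:
  assumes f: "sq_integrable Om f" and g: "sq_integrable Om g"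
  shows "(LINT x|Om. \<bar>g x\<bar> powr (2/3)) \<le> (LINT x|Om. \<bar>f x\<bar> powr (2/3)) + l2norm Om (\<lambda>x. f x - g x) powr (2/3)"
proof -
  define d where "d x = f x - g x" for x
  have d: "sq_integrable Om d" unfolding d_def by (intro sq_integrable_diff f g)
  have int: "integrable Om (\<lambda>x. \<bar>v x\<bar> powr (2/3))" if "sq_integrable Om v" for v
    using Om.sq_integrable_imp_integrable[OF that] by (intro integrable_powr_Om) auto
  have "(LINT x|Om. \<bar>g x\<bar> powr (2/3)) \<le> (LINT x|Om. \<bar>f x\<bar> powr (2/3) + \<bar>d x\<bar> powr (2/3))"
  proof (rule integral_mono)
    show "\<bar>g x\<bar> powr (2/3) \<le> \<bar>f x\<bar> powr (2/3) + \<bar>d x\<bar> powr (2/3)" for x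
    proof -
      have "\<bar>g x\<bar> powr (2/3) \<le> (\<bar>f x\<bar> + \<bar>d x\<bar>) powr (2/3)"
        by (intro powr_mono2) (auto simp: d_def)
      also have "\<dots> \<le> \<bar>f x\<bar> powr (2/3) + \<bar>d x\<bar> powr (2/3)" by (rule powr_add_le) auto
      finally show ?thesis .
    qed
  qed (use int[OF f] int[OF g] int[OF d] in auto)
  also have "\<dots> = (LINT x|Om. \<bar>f x\<bar> powr (2/3)) + (LINT x|Om. \<bar>d x\<bar> powr (2/3))"
    using int[OF f] int[OF d] by simp
  also have "(LINT x|Om. \<bar>d x\<bar> powr (2/3)) \<le> l2norm Om d powr (2/3)"
  proof -
    have "(LINT x|Om. indicator UNIV x * \<bar>d x\<bar> powr (2/3))
        \<le> 1 * ((LINT x|Om. indicator UNIV x * \<bar>d x\<bar>) / 1) powr (2/3)"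
      by (rule Jensen_powr_Om[OF integrable_abs[OF Om.sq_integrable_imp_integrable[OF d]]])
         (use measure_Om in simp_all)
    also have "\<dots> \<le> l2norm Om d powr (2/3)"
      using abs_integral_le_l2norm_Om[OF d] by (simp add: powr_mono2)
    finally show ?thesis by simp
  qed
  finally show ?thesis by (simp add: d_def[abs_def])
qed

lemma S_tendsto:
  assumes r: "sq_integrable Om r" and mesh: "\<And>k. is_mesh (N k) (X k)"
    and N: "filterlim N at_top sequentially"
    and H: "\<And>k i. i \<in> {1..N k} \<Longrightarrow> mesh_width (X k) i \<le> 2 / real (N k)"
  shows "(\<lambda>k. mesh.S (N k) (X k) r) \<longlonglongrightarrow> (LINT x|Om. \<bar>r x\<bar> powr (2/3))"
proof (rule LIMSEQ_I)
  fix e :: real assume e: "0 < e"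
  let ?R = "LINT x|Om. \<bar>r x\<bar> powr (2/3)"
  have m: "mesh (N k) (X k)" for k by unfold_locales (rule mesh)
  \<comment> \<open>The power \<open>2/3\<close> of this tolerance is \<open>e / 3\<close>.\<close>
  define d where "d = (e / 3) powr (3/2)"
  have d: "0 < d" using e by (simp add: d_def)
  have d23: "d powr (2/3) = e / 3" using e by (simp add: d_def powr_powr)
  obtain \<psi> where \<psi>: "\<psi> \<in> test_functions" "l2norm Om (\<lambda>x. r x - \<psi> x) < d"
    using test_functions_dense_L2[OF r d] by blast
  have ps: "sq_integrable Om \<psi>" by (rule test_sq_integrable[OF \<psi>(1)])
  have gi: "integrable Om (deriv \<psi>)" by (intro test_integrable test_deriv \<psi>)
  define G where "G = (LINT x|Om. \<bar>deriv \<psi> x\<bar>)"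
  have c: "l2norm Om (\<lambda>x. r x - \<psi> x) powr (2/3) \<le> e / 3"
    unfolding d23[symmetric] using \<psi>(2) by (intro powr_mono2) auto
  have up: "mesh.S (N k) (X k) r \<le> ?R + 2 * (e / 3) + (2 / real (N k) * G) powr (2/3)" for k
  proof -
    interpret mesh "N k" "X k" by (rule m)
    have "S r \<le> S \<psi> + l2norm Om (\<lambda>x. r x - \<psi> x) powr (2/3)" by (rule S_triangle[OF r ps])
    also have "S \<psi> \<le> (LINT x|Om. \<bar>\<psi> x\<bar> powr (2/3)) + (2 / real (N k) * G) powr (2/3)"
      unfolding G_def
    proof (rule S_le_integral_powr[OF gi _ ps])
      show "AE x in Om. \<psi> x = 0 + Prim (deriv \<psi>) x"
        by (rule AE_I2) (simp add: Prim_deriv_test \<psi>)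
    qed (use H in auto)
    also have "(LINT x|Om. \<bar>\<psi> x\<bar> powr (2/3)) \<le> ?R + l2norm Om (\<lambda>x. r x - \<psi> x) powr (2/3)"
      by (rule integral_powr_triangle[OF r ps])
    finally show ?thesis using c by simp
  qed
  have lo: "?R \<le> mesh.S (N k) (X k) r" for k
    by (rule mesh.integral_powr_le_S[OF m r])
  have "(\<lambda>k. 2 / real (N k) * G) \<longlonglongrightarrow> 0"
  proof -
    have "filterlim (\<lambda>k. real (N k)) at_infinity sequentially"
      by (rule filterlim_compose[OF filterlim_at_top_imp_at_infinity[OF filterlim_real_sequentially] N])
    then have "(\<lambda>k. 2 / real (N k)) \<longlonglongrightarrow> 0" by (rule tendsto_divide_0[OF tendsto_const])
    then show ?thesis using tendsto_mult_left_zero by blast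
  qed
  then have "(\<lambda>k. (2 / real (N k) * G) powr (2/3)) \<longlonglongrightarrow> 0"
    by (intro tendsto_zero_powrI[where b = "2/3"]) (auto simp: G_def)
  then have "\<forall>\<^sub>F k in sequentially. (2 / real (N k) * G) powr (2/3) < e / 3"
    using e by (intro order_tendstoD) auto
  then obtain k0 where k0: "\<And>k. k \<ge> k0 \<Longrightarrow> (2 / real (N k) * G) powr (2/3) < e / 3"
    unfolding eventually_sequentially by blast
  show "\<exists>no. \<forall>n\<ge>no. norm (mesh.S (N n) (X n) r - ?R) < e"
  proof (intro exI allI impI)
    fix n assume "k0 \<le> n"
    then show "norm (mesh.S (N n) (X n) r - ?R) < e"
      using k0[of n] up[of n] lo[of n] by simp
  qed
qed

section \<open>Comparison of the discrete and the continuous residual\<close>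

text \<open>On an equidistributing mesh the error estimate closes: as the error is bounded by \<open>\<alpha>\<^sub>h\<close> itself,
  replacing the discrete residual by the continuous one changes \<open>S\<close> only by a multiple of the
  discrete value \<open>s\<close> that is small for large \<open>N\<close>.\<close>

lemma (in bvp) equidistributing_estimates:
  assumes f: "sq_integrable Om f" and u: "weak_solution a b c f u"
    and X: "equidistributing_fe_mesh a b c f N X u\<^sub>h"
  defines "r \<equiv> residual a b c f u" and "s \<equiv> mesh.S N X (fe_residual a b c f u\<^sub>h)"
  shows "is_mesh N X" "sq_integrable Om r"
    "sqrt (alpha_h a b c f N X u\<^sub>h) = s powr (3/2)" "0 \<le> s"
    "Lp_norm 2 (wderiv (\<lambda>x. u x - u\<^sub>h x)) \<le> 2 * sqrt 8 / a0 * sqrt (alpha_h a b c f N X u\<^sub>h) / real N"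
    "\<bar>mesh.S N X r - s\<bar> \<le> (3 * M * (2 * sqrt 8 / a0) / real N) powr (2/3) * s"
    "\<And>i. i \<in> {1..N} \<Longrightarrow> mesh_width X i \<le> 2 / real N"
proof -
  define rh where "rh = fe_residual a b c f u\<^sub>h"
  show mX: "is_mesh N X" using X by (simp add: equidistributing_fe_mesh_def)
  have uh: "fe_solution a b c f N X u\<^sub>h" and eq: "equidistributing N X rh"
    using X by (auto simp: equidistributing_fe_mesh_def rh_def)
  interpret mesh N X by unfold_locales (rule mX)
  note err = fe_error[OF f u mX uh]
  show r: "sq_integrable Om r" unfolding r_def by (rule err(1))
  have rh: "sq_integrable Om rh" unfolding rh_def by (rule err(2))
  define al where "al = alpha_h a b c f N X u\<^sub>h"
  have al: "al = mesh_alpha N X rh" by (simp add: al_def alpha_h_def rh_def)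
  have s: "s = S rh" by (simp add: s_def rh_def)
  show sq: "sqrt (alpha_h a b c f N X u\<^sub>h) = s powr (3/2)"
    unfolding s al_def[symmetric] al by (rule sqrt_mesh_alpha)
  show s0: "0 \<le> s" unfolding s by (rule S_nonneg)
  note eb = equidistributing_bounds[OF eq]
  show "\<And>i. i \<in> {1..N} \<Longrightarrow> mesh_width X i \<le> 2 / real N" by (rule eb(1))
  define E where "E = Lp_norm 2 (wderiv (\<lambda>x. u x - u\<^sub>h x))"
  have N: "0 < real N" using N_pos by simp
  have "a0 * E \<le> 2 * sqrt (\<Sum>i=1..N. h i ^ 3 * (elem_mean X rh i)\<^sup>2)"
    unfolding E_def rh_def by (rule err(4))
  also have "\<dots> \<le> 2 * sqrt (8 * al / (real N)\<^sup>2)"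
    unfolding al by (intro mult_left_mono real_sqrt_le_mono eb(2)) auto
  also have "\<dots> = 2 * (sqrt 8 * sqrt al / real N)"
    by (simp add: real_sqrt_mult real_sqrt_divide)
  finally have "a0 * E \<le> 2 * (sqrt 8 * sqrt al / real N)" .
  then have "E \<le> 2 * (sqrt 8 * sqrt al / real N) / a0"
    using a0 by (simp only: pos_le_divide_eq mult.commute)
  then have E: "E \<le> 2 * sqrt 8 / a0 * sqrt al / real N" by (simp add: mult_ac)
  then show "Lp_norm 2 (wderiv (\<lambda>x. u x - u\<^sub>h x)) \<le> 2 * sqrt 8 / a0 * sqrt (alpha_h a b c f N X u\<^sub>h) / real N"
    by (simp add: E_def al_def)
  define c1 where "c1 = 3 * M * (2 * sqrt 8 / a0) / real N"
  have c1: "0 \<le> c1" using M a0 by (simp add: c1_def)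
  define D where "D = l2norm Om (\<lambda>x. r x - rh x)"
  have "D \<le> 3 * M * E" unfolding D_def r_def rh_def E_def by (rule err(3))
  also have "\<dots> \<le> 3 * M * (2 * sqrt 8 / a0 * sqrt al / real N)"
    using E M by (intro mult_left_mono) auto
  also have "\<dots> = c1 * s powr (3/2)"
    using sq by (simp add: c1_def al_def)
  finally have "D powr (2/3) \<le> (c1 * s powr (3/2)) powr (2/3)"
    unfolding D_def by (intro powr_mono2) auto
  also have "\<dots> = c1 powr (2/3) * s"
    using c1 s0 by (simp add: powr_mult powr_powr)
  finally have D: "D powr (2/3) \<le> c1 powr (2/3) * s" .
  have "S r \<le> s + D powr (2/3)" "s \<le> S r + D powr (2/3)"
    using S_triangle[OF r rh] S_triangle[OF rh r] unfolding D_def s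
    by (simp_all add: l2norm_minus_commute[of Om rh r])
  then show "\<bar>mesh.S N X r - s\<bar> \<le> (3 * M * (2 * sqrt 8 / a0) / real N) powr (2/3) * s"
    using D unfolding c1_def[symmetric] by linarith
qed

lemma Lp_norm_two_thirds: "Lp_norm (2/3) v = (LINT x|Om. \<bar>v x\<bar> powr (2/3)) powr (3/2)"
  by (simp add: Lp_norm_def)

lemma Lp_norm_1: "Lp_norm 1 v = (LINT x|Om. \<bar>v x\<bar>)"
  by (simp add: Lp_norm_def)

lemma Lp_space_1: "v \<in> Lp_space 1 \<longleftrightarrow> integrable Om v"
  unfolding Lp_space_def by (auto simp: integrable_abs_iff)

lemma admissible_rhs_sq_integrable: "admissible_rhs f \<Longrightarrow> sq_integrable Om f"
  by (simp add: admissible_rhs_def Lp_space_2)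

context bvp
begin

lemma alpha_h_tendsto:
  assumes f: "sq_integrable Om f" and u: "weak_solution a b c f u"
    and N: "filterlim N at_top sequentially"
    and X: "\<And>k. equidistributing_fe_mesh a b c f (N k) (X k) (uh k)"
  shows "(\<lambda>k. sqrt (alpha_h a b c f (N k) (X k) (uh k))) \<longlonglongrightarrow> Lp_norm (2/3) (residual a b c f u)"
proof -
  define r where "r = residual a b c f u"
  define R where "R = (LINT x|Om. \<bar>r x\<bar> powr (2/3))"
  define s where "s k = mesh.S (N k) (X k) (fe_residual a b c f (uh k))" for k
  define t where "t k = mesh.S (N k) (X k) r" for k
  define q where "q k = (3 * M * (2 * sqrt 8 / a0) / real (N k)) powr (2/3)" for k
  note est = equidistributing_estimates[OF f u X]
  have t: "t \<longlonglongrightarrow> R"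
    unfolding t_def R_def by (rule S_tendsto[OF _ est(1) N est(7)]) (use est(2) in \<open>auto simp: r_def\<close>)
  have q: "q \<longlonglongrightarrow> 0"
  proof -
    have "filterlim (\<lambda>k. real (N k)) at_infinity sequentially"
      by (rule filterlim_compose[OF filterlim_at_top_imp_at_infinity[OF filterlim_real_sequentially] N])
    then have "(\<lambda>k. 3 * M * (2 * sqrt 8 / a0) / real (N k)) \<longlonglongrightarrow> 0"
      by (rule tendsto_divide_0[OF tendsto_const])
    then show ?thesis
      unfolding q_def by (intro tendsto_zero_powrI[where b = "2/3"]) (use M a0 in auto)
  qed
  have s0: "0 \<le> s k" and st: "\<bar>t k - s k\<bar> \<le> q k * s k" for k
    using est(4,6)[of k] by (auto simp: s_def t_def r_def q_def)
  have q1: "\<forall>\<^sub>F k in sequentially. q k < 1" using q by (rule order_tendstoD) simp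
  have q0: "0 \<le> q k" for k by (simp add: q_def)
  have s: "s \<longlonglongrightarrow> R"
  proof (rule tendsto_sandwich)
    show "\<forall>\<^sub>F k in sequentially. t k / (1 + q k) \<le> s k"
    proof (rule always_eventually, rule allI)
      fix k
      have "t k \<le> s k * (1 + q k)" using st[of k] by (simp add: algebra_simps)
      then show "t k / (1 + q k) \<le> s k" using q0[of k] by (subst pos_divide_le_eq) auto
    qed
    show "\<forall>\<^sub>F k in sequentially. s k \<le> t k / (1 - q k)"
      using q1
    proof eventually_elim
      case (elim k)
      have "s k * (1 - q k) \<le> t k" using st[of k] by (simp add: algebra_simps)
      then show ?case using elim by (subst pos_le_divide_eq) auto
    qed
    have "(\<lambda>k. t k / (1 + q k)) \<longlonglongrightarrow> R / (1 + 0)" by (intro tendsto_intros t q) simp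
    then show "(\<lambda>k. t k / (1 + q k)) \<longlonglongrightarrow> R" by simp
    have "(\<lambda>k. t k / (1 - q k)) \<longlonglongrightarrow> R / (1 - 0)" by (intro tendsto_intros t q) simp
    then show "(\<lambda>k. t k / (1 - q k)) \<longlonglongrightarrow> R" by simp
  qed
  have "(\<lambda>k. s k powr (3/2)) \<longlonglongrightarrow> R powr (3/2)"
    by (rule tendsto_powr'[OF s tendsto_const]) (use s0 in auto)
  then show ?thesis
    unfolding est(3) Lp_norm_two_thirds by (simp add: s_def R_def r_def)
qed

text \<open>The constant \<open>2\<close> is needed for the mesh widths, the other lower bound of \<open>cs\<close> for the difference of the
  residuals.\<close>

lemma alpha_h_bounds:
  assumes f: "sq_integrable Om f" and u: "weak_solution a b c f u"
    and wd: "weakly_differentiable (residual a b c f u)" and r': "wderiv (residual a b c f u) \<in> Lp_space 1"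
    and X: "equidistributing_fe_mesh a b c f N X uh"
    and cs: "2 \<le> cs" "3 * M * (2 * sqrt 8 / a0) \<le> cs" and N: "cs < real N"
  shows "(1 + (cs / real N) powr (2/3)) powr (- 3/2) * Lp_norm (2/3) (residual a b c f u)
      \<le> sqrt (alpha_h a b c f N X uh)"
    "sqrt (alpha_h a b c f N X uh) \<le> (1 - (cs / real N) powr (2/3)) powr (- 3/2) *
      (Lp_norm (2/3) (residual a b c f u) powr (2/3) +
        (cs * Lp_norm 1 (wderiv (residual a b c f u)) / real N) powr (2/3)) powr (3/2)"
proof -
  define r where "r = residual a b c f u"
  define R where "R = (LINT x|Om. \<bar>r x\<bar> powr (2/3))"
  define s where "s = mesh.S N X (fe_residual a b c f uh)"
  define t where "t = mesh.S N X r"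
  define q where "q = (cs / real N) powr (2/3)"
  define G where "G = (LINT x|Om. \<bar>wderiv r x\<bar>)"
  note est = equidistributing_estimates[OF f u X]
  interpret mesh N X by unfold_locales (rule est(1))
  have r2: "sq_integrable Om r" using est(2) by (simp add: r_def)
  have s0: "0 \<le> s" using est(4) by (simp add: s_def)
  have R0: "0 \<le> R" unfolding R_def by (intro Bochner_Integration.integral_nonneg) auto
  have G0: "0 \<le> G" unfolding G_def by (intro Bochner_Integration.integral_nonneg) auto
  have N0: "0 < real N" using N cs by linarith
  have q: "0 \<le> q" "q < 1"
  proof -
    have "q < 1 powr (2/3)"
      unfolding q_def using N N0 cs by (intro powr_less_mono2) auto
    then show "q < 1" by simp
  qed (simp add: q_def)
  have "(3 * M * (2 * sqrt 8 / a0) / real N) powr (2/3) \<le> q"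
    unfolding q_def using M a0 N0 cs by (intro powr_mono2 divide_right_mono) auto
  then have "\<bar>t - s\<bar> \<le> q * s"
    using est(6) mult_right_mono[OF _ s0] unfolding t_def s_def r_def by (meson order_trans)
  then have ts: "t \<le> (1 + q) * s" "(1 - q) * s \<le> t" by (auto simp: algebra_simps)
  have lp: "Lp_norm (2/3) r = R powr (3/2)" by (simp add: Lp_norm_two_thirds R_def)
  have "R \<le> (1 + q) * s"
    using integral_powr_le_S[OF r2] ts(1) unfolding R_def t_def by linarith
  then have "R powr (3/2) \<le> ((1 + q) * s) powr (3/2)"
    using R0 by (intro powr_mono2) auto
  then have "(1 + q) powr (- 3/2) * R powr (3/2) \<le> (1 + q) powr (- 3/2) * ((1 + q) powr (3/2) * s powr (3/2))"
    unfolding powr_mult by (intro mult_left_mono) auto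
  also have "\<dots> = ((1 + q) powr (- 3/2) * (1 + q) powr (3/2)) * s powr (3/2)" by (simp only: mult.assoc)
  also have "(1 + q) powr (- 3/2) * (1 + q) powr (3/2) = 1"
    using q by (simp add: powr_add[symmetric])
  finally show "(1 + (cs / real N) powr (2/3)) powr (- 3/2) * Lp_norm (2/3) (residual a b c f u)
      \<le> sqrt (alpha_h a b c f N X uh)"
    unfolding est(3) r_def[symmetric] lp q_def[symmetric] s_def[symmetric] by simp

  have gi: "integrable Om (wderiv r)" using r' by (simp add: Lp_space_1 r_def)
  obtain k where k: "AE x in Om. r x = k + Prim (wderiv r) x"
    using has_weak_deriv_imp_Prim[OF wderiv_has_weak_deriv gi] wd by (auto simp: r_def)
  define T where "T = R + (cs * G / real N) powr (2/3)"
  have "t \<le> R + (2 / real N * G) powr (2/3)"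
    unfolding t_def R_def G_def by (rule S_le_integral_powr[OF gi k r2 est(7)])
  also have "\<dots> \<le> T"
    unfolding T_def using cs G0 N0 by (intro add_left_mono powr_mono2) (auto intro!: divide_right_mono mult_right_mono)
  finally have "s \<le> T / (1 - q)"
    using ts(2) q by (simp add: pos_le_divide_eq mult.commute)
  then have "s powr (3/2) \<le> (T / (1 - q)) powr (3/2)"
    using s0 by (intro powr_mono2) auto
  also have "\<dots> = (1 - q) powr (- 3/2) * T powr (3/2)"
    using q by (simp add: powr_divide powr_minus_divide)
  finally show "sqrt (alpha_h a b c f N X uh) \<le> (1 - (cs / real N) powr (2/3)) powr (- 3/2) *
      (Lp_norm (2/3) (residual a b c f u) powr (2/3) +
        (cs * Lp_norm 1 (wderiv (residual a b c f u)) / real N) powr (2/3)) powr (3/2)"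
    using R0
    unfolding est(3) r_def[symmetric] lp q_def[symmetric] s_def[symmetric] T_def Lp_norm_1 G_def
    by (simp add: powr_powr)
qed

end

theorem theorem2p1:
  fixes a b c :: "real \<Rightarrow> real"
  assumes "admissible_coeffs a b c"
  shows
    "(\<exists>C>0. \<forall>f u N X u\<^sub>h.
        admissible_rhs f \<longrightarrow> weak_solution a b c f u \<longrightarrow>
        equidistributing_fe_mesh a b c f N X u\<^sub>h \<longrightarrow>
          Lp_norm 2 (wderiv (\<lambda>x. u x - u\<^sub>h x)) \<le> C * sqrt (alpha_h a b c f N X u\<^sub>h) / real N) \<and>
     (\<forall>f u. admissible_rhs f \<longrightarrow> weak_solution a b c f u \<longrightarrow>
        (\<forall>(N :: nat \<Rightarrow> nat) X u\<^sub>h.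
           filterlim N at_top sequentially \<longrightarrow>
           (\<forall>k. equidistributing_fe_mesh a b c f (N k) (X k) (u\<^sub>h k)) \<longrightarrow>
             (\<lambda>k. sqrt (alpha_h a b c f (N k) (X k) (u\<^sub>h k)))
               \<longlonglongrightarrow> Lp_norm (2/3) (residual a b c f u))) \<and>
     (\<exists>c_star>0. \<forall>f u N X u\<^sub>h.
        admissible_rhs f \<longrightarrow> weak_solution a b c f u \<longrightarrow>
        weakly_differentiable (residual a b c f u) \<longrightarrow>
        wderiv (residual a b c f u) \<in> Lp_space 1 \<longrightarrow>
        real N > c_star \<longrightarrow> equidistributing_fe_mesh a b c f N X u\<^sub>h \<longrightarrow>
          (1 + (c_star / real N) powr (2/3)) powr (- 3/2) * Lp_norm (2/3) (residual a b c f u)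
            \<le> sqrt (alpha_h a b c f N X u\<^sub>h) \<and>
          sqrt (alpha_h a b c f N X u\<^sub>h)
            \<le> (1 - (c_star / real N) powr (2/3)) powr (- 3/2) *
              (Lp_norm (2/3) (residual a b c f u) powr (2/3) +
               (c_star * Lp_norm 1 (wderiv (residual a b c f u)) / real N) powr (2/3)) powr (3/2))"
proof -
  obtain a0 M ca cb where "bvp a b c a0 M ca cb" using admissible_coeffs_bvp[OF assms] by blast
  then interpret bvp a b c a0 M ca cb .
  define cs where "cs = max 2 (3 * M * (2 * sqrt 8 / a0))"
  have cs: "2 \<le> cs" "3 * M * (2 * sqrt 8 / a0) \<le> cs" by (simp_all add: cs_def)
  show ?thesis
  proof (intro conjI, goal_cases)
    case 1
    show ?case
      using a0 equidistributing_estimates(5)[OF admissible_rhs_sq_integrable]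
      by (intro exI[of _ "2 * sqrt 8 / a0"]) simp
  next
    case 2
    show ?case
      using alpha_h_tendsto[OF admissible_rhs_sq_integrable] by blast
  next
    case 3
    show ?case
      using cs alpha_h_bounds[OF admissible_rhs_sq_integrable _ _ _ _ cs]
      by (intro exI[of _ cs] conjI allI impI) auto
  qed
qed

end
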